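(* Let $n\geq4$ be even, and let $\mu:\Omega\times\mathcal B_n\to\Omega$ be the action of the Brauer monoid $\mathcal B_n$ on the push-out set $\Omega=\Omega_1\sqcup_\xi\Omega_2$ defined in the context. Then $\mu$ is faithful, and consequently $$\deg(\mathcal B_n)\leq1+3p_4+2p_2+p_0,$$ where $p_r$ is the number of projections of $\mathcal B_n$ of rank $r$.
   Context: Brauer monoid. For an integer $n\ge 0$ let $\mathbf n=\{1,\dots,n\}$ and $\mathbf n'=\{1',\dots,n'\}$. $\mathcal B_n$ is the set of all set partitions of $\mathbf n\cup\mathbf n'$ into blocks of size exactly $2$. Product of $\alpha,\beta$: with $\mathbf n''=\{1'',\dots,n''\}$, rename each $x'$ in $\alpha$ as $x''$ and each (unprimed) $x$ in $\beta$ as $x''$; consider the equivalence on $\mathbf n\cup\mathbf n''\cup\mathbf n'$ generated by the blocks of these two renamed partitions; $x,y\in\mathbf n\cup\mathbf n'$ are in the same block of $\alpha\beta$ iff they are related by this equivalence. This is a monoid with identity the partition with blocks $\{x,x'\}$. $\alpha^*$ is obtained from $\alpha$ by interchanging $x$ and $x'$ for all $x$. A transversal of $\alpha$ is a block meeting both $\mathbf n$ and $\mathbf n'$, and $\operatorname{rank}(\alpha)$ is the number of transversals. $\ker(\alpha)=\{(x,y)\in\mathbf n\times\mathbf n: x,y\text{ lie in the same block of }\alpha\}$. The symmetric group $\mathcal S_n$ is identified with the group of units of $\mathcal B_n$, i.e. the elements of rank $n$. A projection is an element $\varepsilon$ with $\varepsilon^2=\varepsilon=\varepsilon^*$. For $0\le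 r\le n$ even, $I_r=\{\alpha\in\mathcal B_n:\operatorname{rank}(\alpha)\leq r\}$. The action ($n=2k$ even). Let $\zeta\in\mathcal B_n$ have blocks $\{2i-1,2i\}$ and $\{(2i-1)',(2i)'\}$ for $1\le i\le k$, and let $\gamma\in\mathcal B_n$ have blocks $\{1,1'\}$, $\{2,2'\}$, and $\{2i-1,2i\}$ and $\{(2i-1)',(2i)'\}$ for $2\le i\le k$. Let $\kappa=\ker(\zeta)$, $K=\{\alpha\in\mathcal B_n:\ker(\alpha)\subseteq\kappa\}$, $I=\mathcal B_n\setminus K$, $U=\{\alpha\in\mathcal S_n:\alpha\zeta=\zeta\}$, and $J=I_2\cap K$ (a right ideal). First action: let $R_\zeta=\{\alpha\in\mathcal{B}_n:\ker(\alpha)=\ker(\zeta)\}$, $R_\gamma=\{\alpha\in\mathcal{B}_n:\ker(\alpha)=\ker(\gamma)\}$ and $\Omega_1=R_\gamma\cup R_\zeta$. This is a right ideal, and $\mu_1:\Omega_1\times\mathcal B_n\to\Omega_1$ is $\mu_1(\alpha,\beta)=\alpha\beta$. Second action: for $\alpha\in I_2$ let $\widehat\alpha=\alpha$ if $\operatorname{rank}(\alpha)=0$, and if $\operatorname{rank}(\alpha)=2$ with transversals $\{a_1,b_1'\},\{a_2,b_2'\}$ let $\widehat\alpha$ be obtained from $\alpha$ by replacing these two blocks by $\{a_1,a_2\}$ and $\{b_1',b_2'\}$. Let $\tau$ be the equivalence on $\mathcal B_n=I\sqcup J\sqcup(K\setminus J)$ such that $(\alpha,\beta)\in\tau$ iff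 either $\alpha,\beta\in I$; or $\alpha,\beta\in J$ and $\widehat\alpha=\widehat\beta$; or $\alpha,\beta\in K\setminus J$ and $U\alpha=U\beta$. This is a right congruence. Let $\Omega_2=\{[\alpha]_\tau:\alpha\in I_4\}$ and $\mu_2:\Omega_2\times\mathcal B_n\to\Omega_2$, $\mu_2([\alpha]_\tau,\beta)=[\alpha\beta]_\tau$. Push-out: the set $\Omega_3=\{[\alpha]_\tau:\alpha\in J\}$ is a sub-act of $\Omega_2$, and $\xi:R_\zeta\to\Omega_3$, $\alpha\mapsto[\alpha]_\tau$, is an isomorphism of sub-acts. $\Omega=\Omega_1\sqcup_\xi\Omega_2$ is the quotient of the disjoint union $\Omega_1\sqcup\Omega_2$ identifying each $\alpha\in R_\zeta$ with $\alpha\xi=[\alpha]_\tau$, and $\mu$ is the well-defined action on $\Omega$ induced by $\mu_1$ on (classes of) elements of $\Omega_1$ and $\mu_2$ on (classes of) elements of $\Omega_2$. A right action of a semigroup $S$ on $X$ is a map $\mu:X\times S\to X$ with $\mu(\mu(x,a),b)=\mu(x,ab)$; it is faithful if distinct elements of $S$ induce distinct maps $X\to X$. For a finite semigroup $S$, $\deg(S)$ is the least $m\geq1$ such that $S$ embeds (via an injective semigroup homomorphism) in the monoid $\mathcal T_m$ of all self-maps of $\{1,\dots,m\}$ composed left to right. *)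

theory Defs
  imports
    "HOL-Algebra.Coset"
    "HOL-Library.Disjoint_Sets"
begin

section \<open>The Brauer monoid\<close>

text \<open>
  \<open>Upper x\<close>, \<open>Lower x\<close> and \<open>Middle x\<close> stand for \<open>x\<close>, \<open>x'\<close> and \<open>x''\<close>.
  Middle vertices occur only while a product is being formed.
\<close>

datatype vertex = Upper nat | Lower nat | Middle nat

type_synonym diagram = "vertex set set"

definition vertices :: "nat \<Rightarrow> vertex set" where
  "vertices n = Upper ` {1..n} \<union> Lower ` {1..n}"

definition brauer_diagrams :: "nat \<Rightarrow> diagram set" where
  "brauer_diagrams n = {\<alpha>. partition_on (vertices n) \<alpha> \<and> (\<forall>B\<in>\<alpha>. card B = 2)}"

definition same_block :: "diagram \<Rightarrow> vertex \<Rightarrow> vertex \<Rightarrow> bool" where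
  "same_block \<alpha> x y \<longleftrightarrow> (\<exists>B\<in>\<alpha>. x \<in> B \<and> y \<in> B)"

fun lower_to_middle :: "vertex \<Rightarrow> vertex" where
  "lower_to_middle (Lower x) = Middle x"
| "lower_to_middle v = v"

fun upper_to_middle :: "vertex \<Rightarrow> vertex" where
  "upper_to_middle (Upper x) = Middle x"
| "upper_to_middle v = v"

definition product_rel :: "diagram \<Rightarrow> diagram \<Rightarrow> vertex \<Rightarrow> vertex \<Rightarrow> bool" where
  "product_rel \<alpha> \<beta> =
     equivclp (same_block (image lower_to_middle ` \<alpha> \<union> image upper_to_middle ` \<beta>))"

definition diagram_mult :: "nat \<Rightarrow> diagram \<Rightarrow> diagram \<Rightarrow> diagram" where
  "diagram_mult n \<alpha> \<beta> =
     vertices n // {(x, y) \<in> vertices n \<times> vertices n. product_rel \<alpha> \<beta> x y}"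

definition brauer :: "nat \<Rightarrow> diagram monoid" where
  "brauer n = \<lparr>carrier = brauer_diagrams n, mult = diagram_mult n,
     one = (\<lambda>x. {Upper x, Lower x}) ` {1..n}\<rparr>"

fun flip_vertex :: "vertex \<Rightarrow> vertex" where
  "flip_vertex (Upper x) = Lower x"
| "flip_vertex (Lower x) = Upper x"
| "flip_vertex (Middle x) = Middle x"

definition star :: "diagram \<Rightarrow> diagram" where
  "star \<alpha> = image flip_vertex ` \<alpha>"

definition transversals :: "diagram \<Rightarrow> vertex set set" where
  "transversals \<alpha> = {B \<in> \<alpha>. B \<inter> range Upper \<noteq> {} \<and> B \<inter> range Lower \<noteq> {}}"

definition rank :: "diagram \<Rightarrow> nat" where
  "rank \<alpha> = card (transversals \<alpha>)"

definition ker :: "diagram \<Rightarrow> (nat \<times> nat) set" where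
  "ker \<alpha> = {(x, y). same_block \<alpha> (Upper x) (Upper y)}"

definition projections :: "nat \<Rightarrow> diagram set" where
  "projections n = {\<epsilon> \<in> carrier (brauer n). \<epsilon> \<otimes>\<^bsub>brauer n\<^esub> \<epsilon> = \<epsilon> \<and> star \<epsilon> = \<epsilon>}"

definition num_projections :: "nat \<Rightarrow> nat \<Rightarrow> nat" where
  "num_projections n r = card {\<epsilon> \<in> projections n. rank \<epsilon> = r}"

definition rank_ideal :: "nat \<Rightarrow> nat \<Rightarrow> diagram set" where
  "rank_ideal n r = {\<alpha> \<in> carrier (brauer n). rank \<alpha> \<le> r}"


section \<open>Right actions and transformation degree\<close>

definition right_action :: "('s, 'm) monoid_scheme \<Rightarrow> 'x set \<Rightarrow> ('x \<Rightarrow> 's \<Rightarrow> 'x) \<Rightarrow> bool" where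
  "right_action S X \<mu> \<longleftrightarrow>
     (\<forall>x\<in>X. \<forall>a\<in>carrier S. \<mu> x a \<in> X) \<and>
     (\<forall>x\<in>X. \<forall>a\<in>carrier S. \<forall>b\<in>carrier S. \<mu> (\<mu> x a) b = \<mu> x (a \<otimes>\<^bsub>S\<^esub> b))"

definition faithful_right_action ::
    "('s, 'm) monoid_scheme \<Rightarrow> 'x set \<Rightarrow> ('x \<Rightarrow> 's \<Rightarrow> 'x) \<Rightarrow> bool" where
  "faithful_right_action S X \<mu> \<longleftrightarrow>
     right_action S X \<mu> \<and> inj_on (\<lambda>a. \<lambda>x\<in>X. \<mu> x a) (carrier S)"

text \<open>Self-maps of \<open>{1..m}\<close> act on the right, so the product of \<open>f\<close> and \<open>g\<close> is "first \<open>f\<close>, then \<open>g\<close>".\<close>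

definition full_transf_monoid :: "nat \<Rightarrow> (nat \<Rightarrow> nat) monoid" where
  "full_transf_monoid m = \<lparr>carrier = {1..m} \<rightarrow>\<^sub>E {1..m},
     mult = (\<lambda>f g. compose {1..m} g f), one = (\<lambda>x\<in>{1..m}. x)\<rparr>"

text \<open>
  Membership in \<^const>\<open>hom\<close> only requires multiplicativity, so embeddings are
  semigroup embeddings and need not preserve the identity.
\<close>

definition transf_degree :: "('s, 'm) monoid_scheme \<Rightarrow> nat" where
  "transf_degree S =
     (LEAST m. 1 \<le> m \<and> (\<exists>\<phi> \<in> hom S (full_transf_monoid m). inj_on \<phi> (carrier S)))"


section \<open>The two actions\<close>

definition zeta :: "nat \<Rightarrow> diagram" where
  "zeta n = (\<Union>i\<in>{1..n div 2}.
     {{Upper (2 * i - 1), Upper (2 * i)}, {Lower (2 * i - 1), Lower (2 * i)}})"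

definition gamma :: "nat \<Rightarrow> diagram" where
  "gamma n = {{Upper 1, Lower 1}, {Upper 2, Lower 2}} \<union> (\<Union>i\<in>{2..n div 2}.
     {{Upper (2 * i - 1), Upper (2 * i)}, {Lower (2 * i - 1), Lower (2 * i)}})"

definition K_set :: "nat \<Rightarrow> diagram set" where
  "K_set n = {\<alpha> \<in> carrier (brauer n). ker \<alpha> \<subseteq> ker (zeta n)}"

definition I_set :: "nat \<Rightarrow> diagram set" where
  "I_set n = carrier (brauer n) - K_set n"

definition J_set :: "nat \<Rightarrow> diagram set" where
  "J_set n = rank_ideal n 2 \<inter> K_set n"

definition U_grp :: "nat \<Rightarrow> diagram set" where
  "U_grp n = {\<alpha> \<in> Units (brauer n). \<alpha> \<otimes>\<^bsub>brauer n\<^esub> zeta n = zeta n}"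

definition R_zeta :: "nat \<Rightarrow> diagram set" where
  "R_zeta n = {\<alpha> \<in> carrier (brauer n). ker \<alpha> = ker (zeta n)}"

definition R_gamma :: "nat \<Rightarrow> diagram set" where
  "R_gamma n = {\<alpha> \<in> carrier (brauer n). ker \<alpha> = ker (gamma n)}"

definition Omega1 :: "nat \<Rightarrow> diagram set" where
  "Omega1 n = R_gamma n \<union> R_zeta n"

definition mu1 :: "nat \<Rightarrow> diagram \<Rightarrow> diagram \<Rightarrow> diagram" where
  "mu1 n \<alpha> \<beta> = \<alpha> \<otimes>\<^bsub>brauer n\<^esub> \<beta>"

text \<open>
  If the transversals are \<open>{a\<^sub>1, b\<^sub>1'}\<close> and \<open>{a\<^sub>2, b\<^sub>2'}\<close>, the two added blocks are
  \<open>{a\<^sub>1, a\<^sub>2}\<close> and \<open>{b\<^sub>1', b\<^sub>2'}\<close>.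
\<close>

definition hat :: "diagram \<Rightarrow> diagram" where
  "hat \<alpha> = (if rank \<alpha> = 2
     then (\<alpha> - transversals \<alpha>) \<union>
       {\<Union>(transversals \<alpha>) \<inter> range Upper, \<Union>(transversals \<alpha>) \<inter> range Lower}
     else \<alpha>)"

definition tau :: "nat \<Rightarrow> (diagram \<times> diagram) set" where
  "tau n = {(\<alpha>, \<beta>).
     (\<alpha> \<in> I_set n \<and> \<beta> \<in> I_set n) \<or>
     (\<alpha> \<in> J_set n \<and> \<beta> \<in> J_set n \<and> hat \<alpha> = hat \<beta>) \<or>
     (\<alpha> \<in> K_set n - J_set n \<and> \<beta> \<in> K_set n - J_set n \<and>
        U_grp n #>\<^bsub>brauer n\<^esub> \<alpha> = U_grp n #>\<^bsub>brauer n\<^esub> \<beta>)}"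

definition tau_class :: "nat \<Rightarrow> diagram \<Rightarrow> diagram set" where
  "tau_class n \<alpha> = tau n `` {\<alpha>}"

definition Omega2 :: "nat \<Rightarrow> diagram set set" where
  "Omega2 n = tau_class n ` rank_ideal n 4"

text \<open>
  As usual for operations on quotients, the union below is over classes that all coincide,
  because \<^const>\<open>tau\<close> is a right congruence.
\<close>

definition mu2 :: "nat \<Rightarrow> diagram set \<Rightarrow> diagram \<Rightarrow> diagram set" where
  "mu2 n C \<beta> = (\<Union>\<alpha>\<in>C. tau_class n (\<alpha> \<otimes>\<^bsub>brauer n\<^esub> \<beta>))"


section \<open>The push-out\<close>

definition pushout_rel :: "nat \<Rightarrow> ((diagram + diagram set) \<times> (diagram + diagram set)) set" where
  "pushout_rel n = {(u, v) \<in> (Omega1 n <+> Omega2 n) \<times> (Omega1 n <+> Omega2 n).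
     equivclp (\<lambda>x y. \<exists>\<alpha>\<in>R_zeta n. x = Inl \<alpha> \<and> y = Inr (tau_class n \<alpha>)) u v}"

definition Omega :: "nat \<Rightarrow> (diagram + diagram set) set set" where
  "Omega n = (Omega1 n <+> Omega2 n) // pushout_rel n"

definition mu :: "nat \<Rightarrow> (diagram + diagram set) set \<Rightarrow> diagram \<Rightarrow> (diagram + diagram set) set" where
  "mu n P \<beta> = (\<Union>u\<in>P. pushout_rel n ``
     {case u of Inl \<alpha> \<Rightarrow> Inl (mu1 n \<alpha> \<beta>) | Inr C \<Rightarrow> Inr (mu2 n C \<beta>)})"

end

theory Submission
  imports Defs "HOL-Combinatorics.Permutations"
begin

text \<open>
  All computations with products rest on one principle: blocks have two elements, so a single path
  in the product graph determines a block of the product. That products again have blocks of size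
  two is proved by contracting the middle vertices one pair at a time.

  For faithfulness, rank two elements of \<open>R\<^sub>\<gamma>\<close> detect transversals and \<open>\<zeta>\<close> detects lower blocks; if
  two elements agree in these but differ in an upper block, some rank four element of \<open>K\<close> is moved
  into \<open>J\<close> by one of them and into \<open>I\<close> by the other. For the degree, an element is counted by its
  lower blocks, which correspond to a projection of the same rank, together with the way the free
  lower points are joined: two ways for \<open>R\<^sub>\<gamma>\<close>, and three pairings, given by \<open>\<zeta>\<alpha>\<close>, for the
  \<open>U\<close>-orbits of rank four.
\<close>

section \<open>Perfect matchings\<close>

text \<open>The middle part of a product graph may contain closed loops, and before blocks can be
  traced it must be known that the outer vertices fall into pairs. Doubling the middle row turns the
  blocks of both factors into one perfect matching and the identification of the two copies into a
  second one, so pairing up becomes a statement about two matchings on any set.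

  Points of rank at most two cannot suffice for faithfulness: two elements of rank 0 with the same
  lower blocks act identically on \<open>Omega1\<close>. This is what brings in points of rank four,
  while \<tau> may be coarse elsewhere: all of I is one class, and in J only
  \<open>zeta n \<odot> \<alpha>\<close> is remembered.

  Each kind of point contributes one summand of the bound: 1 for the class I, p_0 for
  \<open>R_zeta\<close>, with which every class in J is glued, 2 p_2 for \<open>R_gamma\<close> and
  3 p_4 for the classes of rank four. Odd ranks do not occur in K, since the free upper points of
  its elements come in pairs {2i-1, 2i}.\<close>

lemma equivclp_map:
  assumes "equivclp R x y" and "\<And>u v. R u v \<Longrightarrow> equivclp S (f u) (f v)"
  shows "equivclp S (f x) (f y)"
  using assms(1)
proof (induction rule: equivclp_induct)
  case base
  show ?case by simp
next
  case (step y z)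
  then show ?case using assms(2) equivclp_sym equivclp_trans by metis
qed

lemma equivclp_mono:
  assumes "equivclp R x y" and "\<And>u v. R u v \<Longrightarrow> equivclp S u v"
  shows "equivclp S x y"
  using equivclp_map[of R x y S "\<lambda>x. x"] assms by simp

text \<open>The vertex set and its type are left open because contraction works on the sum of two
  vertex sets and shrinks it step by step. Brauer diagrams are the case
  \<open>W = vertices n\<close>.\<close>

definition perfect_matching :: "'a set \<Rightarrow> 'a set set \<Rightarrow> bool" where
  "perfect_matching W P \<longleftrightarrow> partition_on W P \<and> (\<forall>B\<in>P. card B = 2)"

lemma perfect_matching_block:
  assumes "perfect_matching W P" "B \<in> P"
  obtains x y where "B = {x, y}" "x \<noteq> y"
  using assms unfolding perfect_matching_def by (metis card_2_iff)

lemma perfect_matchingI: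
  assumes "\<And>B. B \<in> P \<Longrightarrow> \<exists>x y. x \<noteq> y \<and> B = {x, y}"
    and "\<And>x y. {x, y} \<in> P \<Longrightarrow> x \<in> W"
    and "\<And>x. x \<in> W \<Longrightarrow> \<exists>y. {x, y} \<in> P"
    and "\<And>x y z. {x, y} \<in> P \<Longrightarrow> {x, z} \<in> P \<Longrightarrow> y = z"
  shows "perfect_matching W P"
proof -
  have "\<Union>P = W"
  proof (intro equalityI subsetI)
    fix x assume "x \<in> \<Union>P"
    then obtain B where B: "x \<in> B" "B \<in> P" by blast
    obtain u v where "B = {u, v}" using assms(1)[OF B(2)] by blast
    with B show "x \<in> W" using assms(2)[of u v] assms(2)[of v u] by (auto simp: insert_commute)
  next
    fix x assume "x \<in> W"
    then show "x \<in> \<Union>P" using assms(3) by blast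
  qed
  moreover have "disjoint P"
  proof (rule disjointI)
    fix B C assume B: "B \<in> P" "C \<in> P" "B \<noteq> C"
    obtain a b where ab: "B = {a, b}" using assms(1)[OF B(1)] by blast
    obtain c d where cd: "C = {c, d}" using assms(1)[OF B(2)] by blast
    have eq: "B = C" if "x \<in> B" "x \<in> C" for x
    proof -
      have "B = {x, a} \<or> B = {x, b}" "C = {x, c} \<or> C = {x, d}" using that unfolding ab cd by auto
      then show ?thesis using assms(4)[of x] B by auto
    qed
    then show "B \<inter> C = {}" using B(3) by blast
  qed
  moreover have "{} \<notin> P" using assms(1)[of "{}"] by auto
  ultimately have "partition_on W P" by (simp add: partition_on_def)
  moreover have "card B = 2" if "B \<in> P" for B using assms(1)[OF that] by auto
  ultimately show ?thesis unfolding perfect_matching_def by blast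
qed

lemma perfect_matching_edge:
  assumes "perfect_matching W P" "{x, y} \<in> P"
  shows "x \<noteq> y" "x \<in> W" "y \<in> W"
proof -
  have "card {x, y} = 2" "\<Union>P = W" using assms unfolding perfect_matching_def partition_on_def by auto
  then show "x \<noteq> y" "x \<in> W" "y \<in> W" using assms(2) by auto
qed

lemma perfect_matching_unique:
  assumes "perfect_matching W P" "{x, y} \<in> P" "{x, z} \<in> P"
  shows "y = z"
proof -
  have "disjoint P" using assms(1) unfolding perfect_matching_def partition_on_def by blast
  moreover have "x \<in> {x, y} \<inter> {x, z}" by simp
  ultimately have "{x, y} = {x, z}" using disjointD[OF _ assms(2,3)] by (metis empty_iff)
  then show ?thesis by (auto simp: doubleton_eq_iff)
qed

lemma perfect_matching_partner:
  assumes "perfect_matching W P" "x \<in> W"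
  obtains y where "{x, y} \<in> P"
proof -
  have "\<Union>P = W" using assms unfolding perfect_matching_def partition_on_def by auto
  then obtain B where B: "B \<in> P" "x \<in> B" using assms(2) by blast
  obtain u v where uv: "B = {u, v}" using perfect_matching_block[OF assms(1) B(1)] by metis
  then have "B = {x, u} \<or> B = {x, v}" using B by auto
  then show thesis using that B by blast
qed

text \<open>One inclusion suffices: an end of a pair in \<open>Q\<close> has a partner in
  \<open>P\<close>, which by inclusion is a partner in \<open>Q\<close>, hence the same point. This
  halves every later proof that two diagrams are equal.\<close>

lemma perfect_matching_eqI:
  assumes P: "perfect_matching W P" and Q: "perfect_matching W Q"
    and sub: "\<And>x y. {x, y} \<in> P \<Longrightarrow> {x, y} \<in> Q"
  shows "P = Q"
proof (intro equalityI subsetI)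
  fix B assume B: "B \<in> P"
  then show "B \<in> Q" using perfect_matching_block[OF P B] sub by metis
next
  fix B assume B: "B \<in> Q"
  obtain x y where xy: "B = {x, y}" using perfect_matching_block[OF Q B] by metis
  then have "x \<in> W" using perfect_matching_edge[OF Q] B by blast
  then obtain z where z: "{x, z} \<in> P" using perfect_matching_partner[OF P] by metis
  then have "y = z" using perfect_matching_unique[OF Q] sub xy B by metis
  then show "B \<in> P" using z xy by simp
qed

lemma perfect_matching_remove:
  assumes P: "perfect_matching W P" and pq: "{p, q} \<in> P"
  shows "perfect_matching (W - {p, q}) (P - {{p, q}})"
proof (rule perfect_matchingI)
  fix B assume "B \<in> P - {{p, q}}"
  then show "\<exists>x y. x \<noteq> y \<and> B = {x, y}" using perfect_matching_block[OF P] by (metis DiffD1)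
next
  fix x y assume xy: "{x, y} \<in> P - {{p, q}}"
  have "x \<noteq> p" using perfect_matching_unique[OF P pq, of y] xy by auto
  moreover have "x \<noteq> q"
    using perfect_matching_unique[OF P, of q p y] pq xy by (auto simp: insert_commute)
  ultimately show "x \<in> W - {p, q}" using perfect_matching_edge[OF P] xy by blast
next
  fix x assume x: "x \<in> W - {p, q}"
  then obtain y where "{x, y} \<in> P" using perfect_matching_partner[OF P] by blast
  then show "\<exists>y. {x, y} \<in> P - {{p, q}}" using x by blast
next
  fix x y z assume "{x, y} \<in> P - {{p, q}}" "{x, z} \<in> P - {{p, q}}"
  then show "y = z" using perfect_matching_unique[OF P] by blast
qed

lemma perfect_matching_insert:
  assumes P: "perfect_matching W P" and "p \<notin> W" "q \<notin> W" "p \<noteq> q"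
  shows "perfect_matching (insert p (insert q W)) (insert {p, q} P)"
proof (rule perfect_matchingI)
  fix B assume "B \<in> insert {p, q} P"
  then show "\<exists>x y. x \<noteq> y \<and> B = {x, y}" using perfect_matching_block[OF P] assms(4) by (metis insertE)
next
  fix x y assume xy: "{x, y} \<in> insert {p, q} P"
  then show "x \<in> insert p (insert q W)" using perfect_matching_edge(2)[OF P, of x y] by (auto simp: doubleton_eq_iff)
next
  fix x assume x: "x \<in> insert p (insert q W)"
  then show "\<exists>y. {x, y} \<in> insert {p, q} P"
  proof (cases "x \<in> W")
    case True
    then show ?thesis using perfect_matching_partner[OF P True] by blast
  next
    case False
    then have "x = p \<or> x = q" using x by blast
    then have "{x, q} = {p, q} \<or> {x, p} = {p, q}" by (auto simp: doubleton_eq_iff)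
    then show ?thesis by auto
  qed
next
  fix x y z assume "{x, y} \<in> insert {p, q} P" "{x, z} \<in> insert {p, q} P"
  then show "y = z" using perfect_matching_unique[OF P, of x y z] perfect_matching_edge(2)[OF P, of x] assms(2,3)
    by (auto simp: doubleton_eq_iff)
qed

section \<open>Contracting one perfect matching along another\<close>

definition adj :: "'a set set \<Rightarrow> 'a \<Rightarrow> 'a \<Rightarrow> bool" where
  "adj E x y \<longleftrightarrow> {x, y} \<in> E"

text \<open>Removing one connecting edge \<open>{p, q}\<close> either deletes a cycle or joins the
  partners of \<open>p\<close> and \<open>q\<close>; the retraction \<open>f\<close> shows that connectivity elsewhere is unchanged.\<close>

lemma perfect_matching_contract_edge:
  assumes P: "perfect_matching W P" and p: "p \<in> W" and q: "q \<in> W" and "p \<noteq> q"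
    and Q: "\<And>B. B \<in> Q \<Longrightarrow> p \<notin> B \<and> q \<notin> B"
  obtains P' where "perfect_matching (W - {p, q}) P'"
    and "\<And>x y. x \<in> W - {p, q} \<Longrightarrow> y \<in> W - {p, q} \<Longrightarrow>
      equivclp (adj (P' \<union> Q)) x y \<longleftrightarrow> equivclp (adj (P \<union> insert {p, q} Q)) x y"
proof (cases "{p, q} \<in> P")
  case True
  have pm: "perfect_matching (W - {p, q}) (P - {{p, q}})"
    by (rule perfect_matching_remove[OF P True])
  define f where "f = (\<lambda>x. if x = q then p else x)"
  have "equivclp (adj ((P - {{p, q}}) \<union> Q)) x y \<longleftrightarrow> equivclp (adj (P \<union> insert {p, q} Q)) x y"
    if xy: "x \<in> W - {p, q}" "y \<in> W - {p, q}" for x y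
  proof
    assume "equivclp (adj ((P - {{p, q}}) \<union> Q)) x y"
    then show "equivclp (adj (P \<union> insert {p, q} Q)) x y"
      by (rule equivclp_mono) (auto simp: adj_def intro!: r_into_equivclp)
  next
    assume "equivclp (adj (P \<union> insert {p, q} Q)) x y"
    then have "equivclp (adj ((P - {{p, q}}) \<union> Q)) (f x) (f y)"
    proof (rule equivclp_map)
      fix u v assume "adj (P \<union> insert {p, q} Q) u v"
      then consider "{u, v} = {p, q}" | "{u, v} \<in> P - {{p, q}}" | "{u, v} \<in> Q" unfolding adj_def by blast
      then show "equivclp (adj ((P - {{p, q}}) \<union> Q)) (f u) (f v)"
      proof cases
        case 1
        then have "f u = f v" unfolding f_def by (auto simp: doubleton_eq_iff)
        then show ?thesis by simp
      next
        case 2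
        then have "u \<noteq> q" "v \<noteq> q" using perfect_matching_edge[OF pm 2] by auto
        then show ?thesis using 2 unfolding f_def by (auto simp: adj_def intro!: r_into_equivclp)
      next
        case 3
        then have "u \<noteq> q" "v \<noteq> q" using Q by blast+
        then show ?thesis using 3 unfolding f_def by (auto simp: adj_def intro!: r_into_equivclp)
      qed
    qed
    then show "equivclp (adj ((P - {{p, q}}) \<union> Q)) x y" using xy unfolding f_def by auto
  qed
  then show thesis using that pm by blast
next
  case False
  obtain p' where p': "{p, p'} \<in> P" using perfect_matching_partner[OF P p] by blast
  obtain q' where q': "{q, q'} \<in> P" using perfect_matching_partner[OF P q] by blast
  have ne: "p' \<noteq> q" "q' \<noteq> p" using False p' q' by (auto simp: insert_commute)
  have ne2: "p' \<noteq> q'"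
    using perfect_matching_unique[OF P, of p' p q] p' q' \<open>p \<noteq> q\<close> by (auto simp: insert_commute)
  have pp: "p' \<noteq> p" "q' \<noteq> q" "p' \<in> W" "q' \<in> W"
    using perfect_matching_edge[OF P p'] perfect_matching_edge[OF P q'] by auto
  have qq: "{q, q'} \<in> P - {{p, p'}}" using q' ne \<open>p \<noteq> q\<close> by (auto simp: doubleton_eq_iff)
  define P0 where "P0 = P - {{p, p'}} - {{q, q'}}"
  have P0: "perfect_matching (W - {p, p'} - {q, q'}) P0"
    unfolding P0_def by (rule perfect_matching_remove[OF perfect_matching_remove[OF P p'] qq])
  define P' where "P' = insert {p', q'} P0"
  have "perfect_matching (insert p' (insert q' (W - {p, p'} - {q, q'}))) P'"
    unfolding P'_def by (rule perfect_matching_insert[OF P0]) (use ne2 in auto)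
  moreover have "insert p' (insert q' (W - {p, p'} - {q, q'})) = W - {p, q}"
    using pp ne by auto
  ultimately have pm: "perfect_matching (W - {p, q}) P'" by simp
  \<comment> \<open>Moving each of \<open>p\<close>, \<open>q\<close> to its partner in
    \<open>P\<close> collapses \<open>{p, p'}\<close> and \<open>{q, q'}\<close> to points and
    carries the connecting edge to the new edge \<open>{p', q'}\<close>.\<close>
  define f where "f = (\<lambda>x. if x = p then p' else if x = q then q' else x)"
  have "equivclp (adj (P' \<union> Q)) x y \<longleftrightarrow> equivclp (adj (P \<union> insert {p, q} Q)) x y"
    if xy: "x \<in> W - {p, q}" "y \<in> W - {p, q}" for x y
  proof
    assume "equivclp (adj (P' \<union> Q)) x y"
    then show "equivclp (adj (P \<union> insert {p, q} Q)) x y"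
    proof (rule equivclp_mono)
      let ?R = "adj (P \<union> insert {p, q} Q)"
      fix u v assume uv: "adj (P' \<union> Q) u v"
      \<comment> \<open>The new edge \<open>{p', q'}\<close> stands for the path p' - p - q - q' of
        the old graph.\<close>
      have "?R p p'" "?R p q" "?R q q'" using p' q' by (auto simp: adj_def)
      then have pq': "equivclp ?R p' q'"
        by (intro equivclp_trans[OF converse_r_into_equivclp equivclp_trans[OF r_into_equivclp r_into_equivclp]])
      from equivclp_sym[OF this] pq' show "equivclp ?R u v"
        using uv unfolding P'_def P0_def adj_def
        by (auto simp: doubleton_eq_iff adj_def intro!: r_into_equivclp[of "adj _"])
    qed
  next
    assume "equivclp (adj (P \<union> insert {p, q} Q)) x y"
    then have "equivclp (adj (P' \<union> Q)) (f x) (f y)"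
    proof (rule equivclp_map)
      fix u v assume "adj (P \<union> insert {p, q} Q) u v"
      then consider "{u, v} = {p, q}" | "{u, v} = {p, p'}" | "{u, v} = {q, q'}" | "{u, v} \<in> P0" | "{u, v} \<in> Q"
        unfolding P0_def adj_def by blast
      then show "equivclp (adj (P' \<union> Q)) (f u) (f v)"
      proof cases
        case 1
        then have "{f u, f v} = {p', q'}" using \<open>p \<noteq> q\<close> unfolding f_def by (auto simp: doubleton_eq_iff)
        then have "{f u, f v} \<in> P' \<union> Q" unfolding P'_def by simp
        then show ?thesis by (simp add: adj_def r_into_equivclp)
      next
        case 2
        then have "f u = f v" using ne pp \<open>p \<noteq> q\<close> unfolding f_def by (auto simp: doubleton_eq_iff)
        then show ?thesis by simp
      next
        case 3
        then have "f u = f v" using ne pp \<open>p \<noteq> q\<close> unfolding f_def by (auto simp: doubleton_eq_iff)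
        then show ?thesis by simp
      next
        case 4
        then have "f u = u" "f v = v" using perfect_matching_edge[OF P0 4] unfolding f_def by auto
        then have "{f u, f v} \<in> P' \<union> Q" using 4 unfolding P'_def by simp
        then show ?thesis by (simp add: adj_def r_into_equivclp)
      next
        case 5
        then have "f u = u" "f v = v" using Q[OF 5] unfolding f_def by auto
        then have "{f u, f v} \<in> P' \<union> Q" using 5 by simp
        then show ?thesis by (simp add: adj_def r_into_equivclp)
      qed
    qed
    then show "equivclp (adj (P' \<union> Q)) x y" using xy unfolding f_def by auto
  qed
  then show thesis using that pm by blast
qed

text \<open>A vertex outside \<open>X\<close> meets an edge of \<open>P\<close> but none of
  \<open>Q\<close>, so its component is a path, and the other end of that path is again outside
  \<open>X\<close>. The induction avoids paths: it contracts the edges of \<open>Q\<close> one by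
  one, letting \<open>W\<close>, \<open>P\<close> and \<open>X\<close> vary, and connectivity among
  the vertices of \<open>W - X\<close> never changes.\<close>

lemma perfect_matching_contract:
  assumes "finite Q" "perfect_matching W P" "perfect_matching X Q" "X \<subseteq> W" "x \<in> W - X"
  shows "\<exists>!y. y \<in> W - X \<and> y \<noteq> x \<and> equivclp (adj (P \<union> Q)) x y"
  using assms
proof (induction Q arbitrary: W P X rule: finite_induct)
  case empty
  then have X: "X = {}" unfolding perfect_matching_def partition_on_def by auto
  \<comment> \<open>With no connecting edges left, the components are the blocks of
    \<open>P\<close>.\<close>
  have eq: "equivclp (adj P) x y \<longleftrightarrow> y = x \<or> {x, y} \<in> P" for y
  proof
    assume "equivclp (adj P) x y"
    then show "y = x \<or> {x, y} \<in> P"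
    proof (induction rule: equivclp_induct)
      case (step y z)
      then show ?case using perfect_matching_unique[OF empty.prems(1)] unfolding adj_def by (metis insert_commute)
    qed simp
  qed (auto simp: adj_def intro: r_into_equivclp)
  have "x \<in> W" using empty by auto
  from perfect_matching_partner[OF empty.prems(1) this] obtain z where z: "{x, z} \<in> P" by blast
  show ?case unfolding X using z perfect_matching_edge[OF empty.prems(1)]
      perfect_matching_unique[OF empty.prems(1)] by (simp add: eq) metis
next
  case (insert B Q)
  obtain p q where B: "B = {p, q}" "p \<noteq> q" using perfect_matching_block[OF insert.prems(2)] by blast
  have pq: "p \<in> X" "q \<in> X" using perfect_matching_edge[OF insert.prems(2), of p q] B by auto
  have "insert B Q - {{p, q}} = Q" using insert.hyps B by auto
  then have Q: "perfect_matching (X - {p, q}) Q"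
    using perfect_matching_remove[OF insert.prems(2), of p q] B by simp
  have nB: "p \<notin> C \<and> q \<notin> C" if "C \<in> Q" for C
    using Q that unfolding perfect_matching_def partition_on_def by blast
  obtain P' where P': "perfect_matching (W - {p, q}) P'"
    and eq: "\<And>x y. x \<in> W - {p, q} \<Longrightarrow> y \<in> W - {p, q} \<Longrightarrow>
      equivclp (adj (P' \<union> Q)) x y \<longleftrightarrow> equivclp (adj (P \<union> insert {p, q} Q)) x y"
    using perfect_matching_contract_edge[of W P p q Q, OF insert.prems(1) _ _ B(2) nB]
      subsetD[OF insert.prems(3) pq(1)] subsetD[OF insert.prems(3) pq(2)] by blast
  have WX: "W - {p, q} - (X - {p, q}) = W - X" using pq by auto
  have "\<exists>!y. y \<in> W - X \<and> y \<noteq> x \<and> equivclp (adj (P' \<union> Q)) x y"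
    using insert.IH[OF P' Q] insert.prems(3,4) unfolding WX by blast
  moreover have "equivclp (adj (P' \<union> Q)) x y \<longleftrightarrow> equivclp (adj (P \<union> insert B Q)) x y" if "y \<in> W - X" for y
    unfolding B by (rule eq) (use that pq insert.prems(4) in auto)
  ultimately show ?case by blast
qed

section \<open>Products of Brauer diagrams\<close>

lemma brauer_diagrams_eq: "brauer_diagrams n = {\<alpha>. perfect_matching (vertices n) \<alpha>}"
  by (simp add: brauer_diagrams_def perfect_matching_def)

lemma brauer_diagramsD: "\<alpha> \<in> brauer_diagrams n \<Longrightarrow> perfect_matching (vertices n) \<alpha>"
  by (simp add: brauer_diagrams_eq)

lemmas brauer_edge = perfect_matching_edge[OF brauer_diagramsD]
lemmas brauer_unique = perfect_matching_unique[OF brauer_diagramsD]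
lemmas brauer_partner = perfect_matching_partner[OF brauer_diagramsD]
lemma brauer_ex: "\<alpha> \<in> brauer_diagrams n \<Longrightarrow> x \<in> vertices n \<Longrightarrow> \<exists>y. {x, y} \<in> \<alpha>"
  using brauer_partner by blast

lemmas brauer_eqI = perfect_matching_eqI[OF brauer_diagramsD brauer_diagramsD]

lemma finite_vertices [simp]: "finite (vertices n)"
  by (simp add: vertices_def)

lemma in_vertices [simp]:
  "Upper x \<in> vertices n \<longleftrightarrow> x \<in> {1..n}" "Lower x \<in> vertices n \<longleftrightarrow> x \<in> {1..n}" "Middle x \<notin> vertices n"
  by (auto simp: vertices_def)

lemma verticesE:
  assumes "v \<in> vertices n"
  obtains x where "x \<in> {1..n}" "v = Upper x" | x where "x \<in> {1..n}" "v = Lower x"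
  using assms unfolding vertices_def by blast

lemma finite_brauer_diagrams [simp]: "finite (brauer_diagrams n)"
proof (rule finite_subset)
  show "brauer_diagrams n \<subseteq> Pow (Pow (vertices n))"
    unfolding brauer_diagrams_def partition_on_def by blast
qed simp

lemma same_block_brauer:
  assumes "\<alpha> \<in> brauer_diagrams n"
  shows "same_block \<alpha> x y \<longleftrightarrow> (x \<in> vertices n \<and> x = y) \<or> {x, y} \<in> \<alpha>"
proof
  assume "same_block \<alpha> x y"
  then obtain B where B: "B \<in> \<alpha>" "x \<in> B" "y \<in> B" unfolding same_block_def by blast
  obtain u v where uv: "B = {u, v}" by (rule perfect_matching_block[OF brauer_diagramsD[OF assms] B(1)])
  then have "u \<in> vertices n" "v \<in> vertices n" using brauer_edge[OF assms, of u v] B by simp_all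
  moreover have "x = y \<or> {x, y} = B" using B(2,3) unfolding uv by auto
  ultimately show "(x \<in> vertices n \<and> x = y) \<or> {x, y} \<in> \<alpha>" using B uv by auto
next
  assume "(x \<in> vertices n \<and> x = y) \<or> {x, y} \<in> \<alpha>"
  moreover have "same_block \<alpha> x x" if "x \<in> vertices n"
    unfolding same_block_def using brauer_ex[OF assms that] by blast
  moreover have "same_block \<alpha> x y" if "{x, y} \<in> \<alpha>"
    unfolding same_block_def using that by (intro bexI[of _ "{x, y}"]) auto
  ultimately show "same_block \<alpha> x y" by blast
qed

text \<open>The product graph with the two copies of the middle row kept apart and joined by edges:
  it is covered by the perfect matching \<open>doubled \<alpha> \<beta>\<close>, and \<open>connectors\<close> matches the middle rows.\<close>

definition doubled :: "diagram \<Rightarrow> diagram \<Rightarrow> (vertex + vertex) set set" where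
  "doubled \<alpha> \<beta> = image Inl ` \<alpha> \<union> image Inr ` \<beta>"

definition connectors :: "nat \<Rightarrow> (vertex + vertex) set set" where
  "connectors n = (\<lambda>m. {Inl (Lower m), Inr (Upper m)}) ` {1..n}"

lemma doubled_iff:
  "{u, v} \<in> doubled \<alpha> \<beta> \<longleftrightarrow>
    (\<exists>x y. u = Inl x \<and> v = Inl y \<and> {x, y} \<in> \<alpha>) \<or> (\<exists>x y. u = Inr x \<and> v = Inr y \<and> {x, y} \<in> \<beta>)"
  (is "?l = ?r")
proof
  assume ?l
  then consider B where "B \<in> \<alpha>" "{u, v} = Inl ` B" | B where "B \<in> \<beta>" "{u, v} = Inr ` B"
    unfolding doubled_def by blast
  then show ?r
  proof cases
    case 1
    then have "u \<in> Inl ` B" "v \<in> Inl ` B" by blast+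
    then obtain x y where "u = Inl x" "v = Inl y" by blast
    have "(Inl ` {x, y} :: (vertex + vertex) set) = Inl ` B"
      using 1(2) \<open>u = Inl x\<close> \<open>v = Inl y\<close> by (simp only: image_insert image_empty)
    then have "{x, y} = B" by (simp only: inj_image_eq_iff[OF inj_Inl])
    then show ?thesis using 1 \<open>u = Inl x\<close> \<open>v = Inl y\<close> by blast
  next
    case 2
    then have "u \<in> Inr ` B" "v \<in> Inr ` B" by blast+
    then obtain x y where "u = Inr x" "v = Inr y" by blast
    have "(Inr ` {x, y} :: (vertex + vertex) set) = Inr ` B"
      using 2(2) \<open>u = Inr x\<close> \<open>v = Inr y\<close> by (simp only: image_insert image_empty)
    then have "{x, y} = B" by (simp only: inj_image_eq_iff[OF inj_Inr])
    then show ?thesis using 2 \<open>u = Inr x\<close> \<open>v = Inr y\<close> by blast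
  qed
next
  assume ?r
  then show ?l
  proof (elim disjE exE conjE)
    fix x y assume "u = Inl x" "v = Inl y" "{x, y} \<in> \<alpha>"
    then have "Inl ` {x, y} \<in> doubled \<alpha> \<beta>" "{u, v} = Inl ` {x, y}" unfolding doubled_def by blast+
    then show ?l by simp
  next
    fix x y assume "u = Inr x" "v = Inr y" "{x, y} \<in> \<beta>"
    then have "Inr ` {x, y} \<in> doubled \<alpha> \<beta>" "{u, v} = Inr ` {x, y}" unfolding doubled_def by blast+
    then show ?l by simp
  qed
qed

lemma perfect_matching_doubled:
  assumes "\<alpha> \<in> brauer_diagrams n" "\<beta> \<in> brauer_diagrams n"
  shows "perfect_matching (vertices n <+> vertices n) (doubled \<alpha> \<beta>)"
proof (rule perfect_matchingI)
  fix B assume "B \<in> doubled \<alpha> \<beta>"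
  then consider C where "C \<in> \<alpha>" "B = Inl ` C" | C where "C \<in> \<beta>" "B = Inr ` C"
    unfolding doubled_def by blast
  then show "\<exists>x y. x \<noteq> y \<and> B = {x, y}"
  proof cases
    case 1
    obtain x y where "C = {x, y}" "x \<noteq> y"
      by (rule perfect_matching_block[OF brauer_diagramsD[OF assms(1)] 1(1)])
    then show ?thesis using 1(2) by (intro exI[of _ "Inl x"] exI[of _ "Inl y"]) simp
  next
    case 2
    obtain x y where "C = {x, y}" "x \<noteq> y"
      by (rule perfect_matching_block[OF brauer_diagramsD[OF assms(2)] 2(1)])
    then show ?thesis using 2(2) by (intro exI[of _ "Inr x"] exI[of _ "Inr y"]) simp
  qed
next
  fix x y assume "{x, y} \<in> doubled \<alpha> \<beta>"
  then show "x \<in> vertices n <+> vertices n"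
    using brauer_edge[OF assms(1)] brauer_edge[OF assms(2)] unfolding doubled_iff by blast
next
  fix x assume "x \<in> vertices n <+> vertices n"
  then show "\<exists>y. {x, y} \<in> doubled \<alpha> \<beta>"
    using brauer_ex[OF assms(1)] brauer_ex[OF assms(2)] unfolding doubled_iff by auto
next
  fix x y z assume "{x, y} \<in> doubled \<alpha> \<beta>" "{x, z} \<in> doubled \<alpha> \<beta>"
  then consider a b c where "y = Inl b" "z = Inl c" "{a, b} \<in> \<alpha>" "{a, c} \<in> \<alpha>"
    | a b c where "y = Inr b" "z = Inr c" "{a, b} \<in> \<beta>" "{a, c} \<in> \<beta>" unfolding doubled_iff by auto
  then show "y = z"
  proof cases
    case 1
    then show ?thesis using brauer_unique[OF assms(1) 1(3,4)] by simp
  next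
    case 2
    then show ?thesis using brauer_unique[OF assms(2) 2(3,4)] by simp
  qed
qed

lemma connectors_iff:
  "{u, v} \<in> connectors n \<longleftrightarrow>
    (\<exists>m\<in>{1..n}. u = Inl (Lower m) \<and> v = Inr (Upper m) \<or> v = Inl (Lower m) \<and> u = Inr (Upper m))"
  unfolding connectors_def image_iff doubleton_eq_iff by blast

lemma perfect_matching_connectors:
  "perfect_matching (Lower ` {1..n} <+> Upper ` {1..n}) (connectors n)"
proof (rule perfect_matchingI)
  fix B assume "B \<in> connectors n"
  then obtain m where "B = {Inl (Lower m), Inr (Upper m)}" unfolding connectors_def by blast
  then show "\<exists>x y. x \<noteq> y \<and> B = {x, y}"
    by (intro exI[of _ "Inl (Lower m)"] exI[of _ "Inr (Upper m)"]) simp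
next
  fix x y assume "{x, y} \<in> connectors n"
  then show "x \<in> Lower ` {1..n} <+> Upper ` {1..n}" unfolding connectors_iff by blast
next
  fix x assume "x \<in> Lower ` {1..n} <+> Upper ` {1..n}"
  then obtain m where "m \<in> {1..n}" "x = Inl (Lower m) \<or> x = Inr (Upper m)" by blast
  then show "\<exists>y. {x, y} \<in> connectors n" unfolding connectors_iff by blast
next
  fix x y z assume "{x, y} \<in> connectors n" "{x, z} \<in> connectors n"
  then show "y = z" unfolding connectors_iff by auto
qed

definition edge :: "diagram \<Rightarrow> diagram \<Rightarrow> vertex \<Rightarrow> vertex \<Rightarrow> bool" where
  "edge \<alpha> \<beta> u v \<longleftrightarrow>
    (\<exists>x y. {x, y} \<in> \<alpha> \<and> u = lower_to_middle x \<and> v = lower_to_middle y) \<or>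
    (\<exists>x y. {x, y} \<in> \<beta> \<and> u = upper_to_middle x \<and> v = upper_to_middle y)"

lemma product_rel_lower:
  assumes "{x, y} \<in> \<alpha>"
  shows "product_rel \<alpha> \<beta> (lower_to_middle x) (lower_to_middle y)"
  unfolding product_rel_def
  by (rule r_into_equivclp, unfold same_block_def, rule bexI[of _ "lower_to_middle ` {x, y}"])
    (use assms in blast)+

lemma product_rel_upper:
  assumes "{x, y} \<in> \<beta>"
  shows "product_rel \<alpha> \<beta> (upper_to_middle x) (upper_to_middle y)"
  unfolding product_rel_def
  by (rule r_into_equivclp, unfold same_block_def, rule bexI[of _ "upper_to_middle ` {x, y}"])
    (use assms in blast)+

lemma product_rel_edge:
  assumes "\<alpha> \<in> brauer_diagrams n" "\<beta> \<in> brauer_diagrams n"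
  shows "product_rel \<alpha> \<beta> = equivclp (edge \<alpha> \<beta>)"
proof (intro ext iffI)
  fix x y
  let ?S = "same_block (image lower_to_middle ` \<alpha> \<union> image upper_to_middle ` \<beta>)"
  assume "product_rel \<alpha> \<beta> x y"
  then show "equivclp (edge \<alpha> \<beta>) x y" unfolding product_rel_def
  proof (rule equivclp_mono)
    fix u v assume "?S u v"
    then consider B a b where "B \<in> \<alpha>" "a \<in> B" "b \<in> B" "u = lower_to_middle a" "v = lower_to_middle b"
      | B a b where "B \<in> \<beta>" "a \<in> B" "b \<in> B" "u = upper_to_middle a" "v = upper_to_middle b"
      unfolding same_block_def by blast
    then show "equivclp (edge \<alpha> \<beta>) u v"
    proof cases
      case 1
      then have "same_block \<alpha> a b" unfolding same_block_def by blast
      then have "a = b \<or> edge \<alpha> \<beta> u v" unfolding same_block_brauer[OF assms(1)] edge_def using 1 by blast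
      then show ?thesis using 1 by auto
    next
      case 2
      then have "same_block \<beta> a b" unfolding same_block_def by blast
      then have "a = b \<or> edge \<alpha> \<beta> u v" unfolding same_block_brauer[OF assms(2)] edge_def using 2 by blast
      then show ?thesis using 2 by auto
    qed
  qed
next
  fix x y assume "equivclp (edge \<alpha> \<beta>) x y"
  then show "product_rel \<alpha> \<beta> x y" unfolding product_rel_def
  proof (rule equivclp_mono)
    fix u v assume "edge \<alpha> \<beta> u v"
    then have "product_rel \<alpha> \<beta> u v"
      unfolding edge_def using product_rel_lower product_rel_upper by blast
    then show "equivclp (same_block (image lower_to_middle ` \<alpha> \<union> image upper_to_middle ` \<beta>)) u v"
      unfolding product_rel_def .
  qed
qed

lemma product_rel_trans: "product_rel \<alpha> \<beta> x y \<Longrightarrow> product_rel \<alpha> \<beta> y z \<Longrightarrow> product_rel \<alpha> \<beta> x z"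
  unfolding product_rel_def by (rule equivclp_trans)

lemma product_rel_sym: "product_rel \<alpha> \<beta> x y \<Longrightarrow> product_rel \<alpha> \<beta> y x"
  unfolding product_rel_def by (rule equivclp_sym)

lemma product_rel_refl: "product_rel \<alpha> \<beta> x x"
  unfolding product_rel_def by simp

text \<open>A middle vertex is represented by its copy in the lower row of the first factor; a
  connector joins this copy to the one in the upper row of the second factor.\<close>

fun split_vertex :: "vertex \<Rightarrow> vertex + vertex" where
  "split_vertex (Upper x) = Inl (Upper x)"
| "split_vertex (Middle x) = Inl (Lower x)"
| "split_vertex (Lower x) = Inr (Lower x)"

lemma product_rel_doubled:
  assumes "\<alpha> \<in> brauer_diagrams n" "\<beta> \<in> brauer_diagrams n"
  shows "product_rel \<alpha> \<beta> x y \<longleftrightarrow>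
    equivclp (adj (doubled \<alpha> \<beta> \<union> connectors n)) (split_vertex x) (split_vertex y)" (is "_ \<longleftrightarrow> equivclp ?R _ _")
proof
  have low: "equivclp ?R (split_vertex (lower_to_middle a)) (Inl a)" if "a \<in> vertices n" for a
    using that by (cases a) auto
  have up: "equivclp ?R (split_vertex (upper_to_middle a)) (Inr a)" if "a \<in> vertices n" for a
    using that by (cases a) (auto simp: adj_def connectors_iff intro!: r_into_equivclp)
  assume "product_rel \<alpha> \<beta> x y"
  then have "equivclp (edge \<alpha> \<beta>) x y" by (simp add: product_rel_edge[OF assms])
  then show "equivclp ?R (split_vertex x) (split_vertex y)"
  proof (rule equivclp_map)
    fix u v assume "edge \<alpha> \<beta> u v"
    then consider a b where "{a, b} \<in> \<alpha>" "u = lower_to_middle a" "v = lower_to_middle b"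
      | a b where "{a, b} \<in> \<beta>" "u = upper_to_middle a" "v = upper_to_middle b" unfolding edge_def by blast
    then show "equivclp ?R (split_vertex u) (split_vertex v)"
    proof cases
      case 1
      have "equivclp ?R (Inl a) (Inl b)"
        by (rule r_into_equivclp) (use 1 in \<open>simp add: adj_def doubled_iff\<close>)
      then show ?thesis unfolding 1 using low[of a] low[of b] brauer_edge[OF assms(1) 1(1)]
        by (blast intro: equivclp_trans equivclp_sym)
    next
      case 2
      have "equivclp ?R (Inr a) (Inr b)"
        by (rule r_into_equivclp) (use 2 in \<open>simp add: adj_def doubled_iff\<close>)
      then show ?thesis unfolding 2 using up[of a] up[of b] brauer_edge[OF assms(2) 2(1)]
        by (blast intro: equivclp_trans equivclp_sym)
    qed
  qed
next
  \<comment> \<open>\<open>f\<close> glues the two middle rows together again, so that connectors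
    collapse to points and the other edges become edges of the product graph.\<close>
  define f where "f = case_sum lower_to_middle upper_to_middle"
  assume "equivclp ?R (split_vertex x) (split_vertex y)"
  then have "equivclp (edge \<alpha> \<beta>) (f (split_vertex x)) (f (split_vertex y))"
  proof (rule equivclp_map)
    fix u v assume "?R u v"
    then have "{u, v} \<in> connectors n \<or> edge \<alpha> \<beta> (f u) (f v)"
      unfolding adj_def f_def edge_def Un_iff doubled_iff by fastforce
    moreover have "f u = f v" if "{u, v} \<in> connectors n"
      using that unfolding connectors_iff f_def by auto
    ultimately show "equivclp (edge \<alpha> \<beta>) (f u) (f v)" by auto
  qed
  moreover have "f (split_vertex z) = z" for z unfolding f_def by (cases z) auto
  ultimately show "product_rel \<alpha> \<beta> x y" by (simp add: product_rel_edge[OF assms])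
qed

text \<open>This is where the blocks of a product get size two. Contraction is applied with
  \<open>X\<close> the two copies of the middle row; what remains of the doubled vertex set is the
  image of the outer rows under \<open>split_vertex\<close>.\<close>

lemma product_rel_ex1:
  assumes "\<alpha> \<in> brauer_diagrams n" "\<beta> \<in> brauer_diagrams n" "x \<in> vertices n"
  shows "\<exists>!y. y \<in> vertices n \<and> y \<noteq> x \<and> product_rel \<alpha> \<beta> x y"
proof -
  let ?W = "vertices n <+> vertices n" and ?X = "Lower ` {1..n} <+> Upper ` {1..n}"
  have img: "split_vertex ` vertices n = ?W - ?X"
  proof (intro equalityI subsetI)
    fix u assume "u \<in> split_vertex ` vertices n"
    then show "u \<in> ?W - ?X" by (auto elim!: verticesE)
  next
    fix u assume "u \<in> ?W - ?X"
    then consider a where "a \<in> vertices n" "a \<notin> Lower ` {1..n}" "u = Inl a"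
      | a where "a \<in> vertices n" "a \<notin> Upper ` {1..n}" "u = Inr a" by auto
    then show "u \<in> split_vertex ` vertices n"
    proof cases
      case 1
      then have "u = split_vertex a" by (cases a) auto
      then show ?thesis using 1 by blast
    next
      case 2
      then have "u = split_vertex a" by (cases a) auto
      then show ?thesis using 2 by blast
    qed
  qed
  have inj: "split_vertex a = split_vertex b \<longleftrightarrow> a = b" for a b by (cases a; cases b) auto
  have "finite (connectors n)" unfolding connectors_def by simp
  moreover have "?X \<subseteq> ?W" by auto
  moreover have "split_vertex x \<in> ?W - ?X" unfolding img[symmetric] using assms(3) by simp
  ultimately have "\<exists>!u. u \<in> ?W - ?X \<and> u \<noteq> split_vertex x \<and>
      equivclp (adj (doubled \<alpha> \<beta> \<union> connectors n)) (split_vertex x) u"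
    by (rule perfect_matching_contract[OF _ perfect_matching_doubled[OF assms(1,2)] perfect_matching_connectors])
  then obtain u where u: "u \<in> split_vertex ` vertices n" "u \<noteq> split_vertex x"
      "equivclp (adj (doubled \<alpha> \<beta> \<union> connectors n)) (split_vertex x) u"
    and uniq: "\<And>v. v \<in> split_vertex ` vertices n \<Longrightarrow> v \<noteq> split_vertex x \<Longrightarrow>
      equivclp (adj (doubled \<alpha> \<beta> \<union> connectors n)) (split_vertex x) v \<Longrightarrow> v = u"
    unfolding img[symmetric] by blast
  from u(1) obtain y where y: "u = split_vertex y" "y \<in> vertices n" by blast
  show ?thesis
  proof (rule ex1I[of _ y])
    show "y \<in> vertices n \<and> y \<noteq> x \<and> product_rel \<alpha> \<beta> x y"
      using u(2,3) y unfolding product_rel_doubled[OF assms(1,2)] by blast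
  next
    fix z assume "z \<in> vertices n \<and> z \<noteq> x \<and> product_rel \<alpha> \<beta> x z"
    then have "split_vertex z = u"
      by (intro uniq) (simp_all add: inj product_rel_doubled[OF assms(1,2)])
    then show "z = y" unfolding y(1) inj .
  qed
qed

section \<open>The product of two diagrams as a perfect matching\<close>

lemma diagram_mult_eq:
  "diagram_mult n \<alpha> \<beta> = (\<lambda>x. {y \<in> vertices n. product_rel \<alpha> \<beta> x y}) ` vertices n"
  unfolding diagram_mult_def quotient_def by auto

lemma diagram_mult_iff:
  assumes "\<alpha> \<in> brauer_diagrams n" "\<beta> \<in> brauer_diagrams n"
  shows "{x, y} \<in> diagram_mult n \<alpha> \<beta> \<longleftrightarrow> x \<in> vertices n \<and> y \<in> vertices n \<and> x \<noteq> y \<and> product_rel \<alpha> \<beta> x y"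
proof
  assume "{x, y} \<in> diagram_mult n \<alpha> \<beta>"
  then obtain z where z: "z \<in> vertices n" "{x, y} = {w \<in> vertices n. product_rel \<alpha> \<beta> z w}"
    unfolding diagram_mult_eq by blast
  have x: "x \<in> vertices n" "product_rel \<alpha> \<beta> z x" and y: "y \<in> vertices n" "product_rel \<alpha> \<beta> z y"
    using z(2) by blast+
  then have xy: "product_rel \<alpha> \<beta> x y" using product_rel_sym product_rel_trans by blast
  \<comment> \<open>A second vertex in the class of \<open>x\<close> excludes \<open>x = y\<close>,
    since it too must lie in \<open>{x, y}\<close>.\<close>
  obtain w where w: "w \<in> vertices n" "w \<noteq> x" "product_rel \<alpha> \<beta> x w" using product_rel_ex1[OF assms x(1)] by blast
  then have "w \<in> {x, y}" unfolding z(2) using x(2) product_rel_trans by blast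
  then show "x \<in> vertices n \<and> y \<in> vertices n \<and> x \<noteq> y \<and> product_rel \<alpha> \<beta> x y" using w x y xy by blast
next
  assume a: "x \<in> vertices n \<and> y \<in> vertices n \<and> x \<noteq> y \<and> product_rel \<alpha> \<beta> x y"
  then have "{w \<in> vertices n. product_rel \<alpha> \<beta> x w} = {x, y}"
    using product_rel_ex1[OF assms, of x] product_rel_refl by blast
  then show "{x, y} \<in> diagram_mult n \<alpha> \<beta>" unfolding diagram_mult_eq using a by (metis (no_types, lifting) image_eqI)
qed

lemma diagram_mult_closed:
  assumes "\<alpha> \<in> brauer_diagrams n" "\<beta> \<in> brauer_diagrams n"
  shows "diagram_mult n \<alpha> \<beta> \<in> brauer_diagrams n"
  unfolding brauer_diagrams_eq mem_Collect_eq
proof (rule perfect_matchingI)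
  fix B assume "B \<in> diagram_mult n \<alpha> \<beta>"
  then obtain x where x: "x \<in> vertices n" "B = {y \<in> vertices n. product_rel \<alpha> \<beta> x y}"
    unfolding diagram_mult_eq by blast
  then obtain y where "y \<in> vertices n" "y \<noteq> x" "product_rel \<alpha> \<beta> x y" "B = {x, y}"
    using product_rel_ex1[OF assms x(1)] product_rel_refl[of \<alpha> \<beta> x] by blast
  then show "\<exists>x y. x \<noteq> y \<and> B = {x, y}" by blast
next
  fix x assume "x \<in> vertices n"
  then show "\<exists>y. {x, y} \<in> diagram_mult n \<alpha> \<beta>"
    using product_rel_ex1[OF assms, of x] unfolding diagram_mult_iff[OF assms] by blast
next
  fix x y z assume "{x, y} \<in> diagram_mult n \<alpha> \<beta>" "{x, z} \<in> diagram_mult n \<alpha> \<beta>"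
  then show "y = z" using product_rel_ex1[OF assms, of x] unfolding diagram_mult_iff[OF assms] by blast
qed (simp add: diagram_mult_iff[OF assms])

lemma adj_sym: "adj \<alpha> x y \<Longrightarrow> adj \<alpha> y x"
  by (simp add: adj_def insert_commute)

lemma adj_commute: "adj \<alpha> x y \<longleftrightarrow> adj \<alpha> y x"
  using adj_sym by metis

lemma adjD:
  assumes "\<alpha> \<in> brauer_diagrams n" "adj \<alpha> x y"
  shows "x \<noteq> y" "x \<in> vertices n" "y \<in> vertices n"
  using brauer_edge[OF assms(1)] assms(2) unfolding adj_def by auto

lemma adj_unique: "\<alpha> \<in> brauer_diagrams n \<Longrightarrow> adj \<alpha> x y \<Longrightarrow> adj \<alpha> x z \<Longrightarrow> y = z"
  unfolding adj_def by (rule brauer_unique)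

lemma adj_unique': "\<alpha> \<in> brauer_diagrams n \<Longrightarrow> adj \<alpha> y x \<Longrightarrow> adj \<alpha> z x \<Longrightarrow> y = z"
  using adj_unique adj_sym by metis

lemma adj_ex: "\<alpha> \<in> brauer_diagrams n \<Longrightarrow> x \<in> vertices n \<Longrightarrow> \<exists>y. adj \<alpha> x y"
  unfolding adj_def by (rule brauer_ex)

lemma brauer_adj_eqI:
  "\<alpha> \<in> brauer_diagrams n \<Longrightarrow> \<beta> \<in> brauer_diagrams n \<Longrightarrow> (\<And>x y. adj \<alpha> x y \<Longrightarrow> adj \<beta> x y) \<Longrightarrow> \<alpha> = \<beta>"
  unfolding adj_def by (rule brauer_eqI)

lemma adj_mult:
  assumes "\<alpha> \<in> brauer_diagrams n" "\<beta> \<in> brauer_diagrams n"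
  shows "adj (diagram_mult n \<alpha> \<beta>) x y \<longleftrightarrow> x \<in> vertices n \<and> y \<in> vertices n \<and> x \<noteq> y \<and> product_rel \<alpha> \<beta> x y"
  unfolding adj_def by (rule diagram_mult_iff[OF assms])

lemma edge_adj:
  "edge \<alpha> \<beta> u v \<longleftrightarrow>
    (\<exists>x y. adj \<alpha> x y \<and> u = lower_to_middle x \<and> v = lower_to_middle y) \<or>
    (\<exists>x y. adj \<beta> x y \<and> u = upper_to_middle x \<and> v = upper_to_middle y)"
  unfolding edge_def adj_def ..

subsection \<open>Associativity\<close>

lemma equivclp_neq:
  assumes "equivclp R x y" "x \<noteq> y"
  shows "\<exists>z. R x z \<or> R z x"
  using assms by (induction rule: converse_equivclp_induct) blast+

text \<open>A path is cut at its visits to \<open>X\<close>: a stretch between two visits uses only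
  \<open>R\<close> and becomes a single step. In the induction, \<open>w\<close> is a point of
  \<open>X\<close> already reached by such steps, from which the current vertex is reached by
  \<open>R\<close> alone.\<close>

lemma equivclp_restrict:
  assumes "equivclp (\<lambda>u v. R u v \<or> S u v) x z" and x: "x \<in> X" and z: "z \<in> X"
    and S: "\<And>u v. S u v \<Longrightarrow> u \<in> X \<and> v \<in> X"
  shows "equivclp (\<lambda>u v. (u \<in> X \<and> v \<in> X \<and> equivclp R u v) \<or> S u v) x z" (is "equivclp ?T x z")
proof -
  from assms(1) have "\<exists>w\<in>X. equivclp ?T x w \<and> equivclp R w z"
  proof (induction rule: equivclp_induct)
    case base
    show ?case using x by (intro bexI[of _ x]) auto
  next
    case (step y z)
    then obtain w where w: "w \<in> X" "equivclp ?T x w" "equivclp R w y" by blast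
    consider "R y z \<or> R z y" | "S y z \<or> S z y" using step.hyps by blast
    then show ?case
    proof cases
      case 1
      then have "equivclp R y z" by (auto intro: r_into_equivclp converse_r_into_equivclp)
      then have "equivclp R w z" by (rule equivclp_trans[OF w(3)])
      then show ?thesis using w by blast
    next
      case 2
      then have X: "y \<in> X" "z \<in> X" using S by blast+
      have "?T w y" using w X by blast
      then have "equivclp ?T w y" by (rule r_into_equivclp)
      moreover have "equivclp ?T y z" using 2 by (intro equivclp_into_equivclp[of _ y y z]) auto
      ultimately have "equivclp ?T x z" using w(2) by (blast intro: equivclp_trans)
      then show ?thesis using X by (intro bexI[of _ z]) auto
    qed
  qed
  then obtain w where w: "w \<in> X" "equivclp ?T x w" "equivclp R w z" by blast
  have "?T w z" using w z by blast
  then show ?thesis using w(2) by (blast intro: equivclp_trans r_into_equivclp)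
qed

text \<open>A point of a stack of diagrams is a pair (row, position). Numbered rows let products of
  two and of three factors live in the same graph.\<close>

fun embed :: "nat \<Rightarrow> nat \<Rightarrow> nat \<Rightarrow> vertex \<Rightarrow> nat \<times> nat" where
  "embed i k j (Upper x) = (i, x)"
| "embed i k j (Middle x) = (k, x)"
| "embed i k j (Lower x) = (j, x)"

definition layer :: "diagram \<Rightarrow> nat \<Rightarrow> nat \<Rightarrow> nat \<times> nat \<Rightarrow> nat \<times> nat \<Rightarrow> bool" where
  "layer \<alpha> i j u v \<longleftrightarrow> (\<exists>x y. adj \<alpha> x y \<and> u = embed i i j x \<and> v = embed i i j y)"

lemma layer_in:
  assumes "\<alpha> \<in> brauer_diagrams n" "layer \<alpha> i j u v"
  shows "u \<in> {i, j} \<times> {1..n}" "v \<in> {i, j} \<times> {1..n}"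
proof -
  obtain x y where xy: "adj \<alpha> x y" "u = embed i i j x" "v = embed i i j y"
    using assms(2) unfolding layer_def by blast
  have "embed i i j z \<in> {i, j} \<times> {1..n}" if "z \<in> vertices n" for z using that by (cases z) auto
  then show "u \<in> {i, j} \<times> {1..n}" "v \<in> {i, j} \<times> {1..n}"
    using adjD[OF assms(1) xy(1)] xy(2,3) by blast+
qed

lemma product_rel_layers:
  assumes "\<alpha> \<in> brauer_diagrams n" "\<beta> \<in> brauer_diagrams n" and "distinct [i, k, j]"
  shows "product_rel \<alpha> \<beta> x y \<longleftrightarrow>
    equivclp (\<lambda>u v. layer \<alpha> i k u v \<or> layer \<beta> k j u v) (embed i k j x) (embed i k j y)"
proof
  have low: "embed i k j (lower_to_middle a) = embed i i k a" if "a \<in> vertices n" for a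
    using that by (cases a) auto
  have up: "embed i k j (upper_to_middle a) = embed k k j a" if "a \<in> vertices n" for a
    using that by (cases a) auto
  define f where "f = (\<lambda>(a, x). if a = i then Upper x else if a = k then Middle x else Lower x)"
  have f: "f (embed i k j a) = a" for a using assms(3) unfolding f_def by (cases a) auto
  {
    assume "product_rel \<alpha> \<beta> x y"
    then have "equivclp (edge \<alpha> \<beta>) x y" by (simp add: product_rel_edge[OF assms(1,2)])
    then show "equivclp (\<lambda>u v. layer \<alpha> i k u v \<or> layer \<beta> k j u v) (embed i k j x) (embed i k j y)"
    proof (rule equivclp_map)
      fix u v assume "edge \<alpha> \<beta> u v"
      then consider a b where "adj \<alpha> a b" "u = lower_to_middle a" "v = lower_to_middle b"
        | a b where "adj \<beta> a b" "u = upper_to_middle a" "v = upper_to_middle b" unfolding edge_adj by blast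
      then have "layer \<alpha> i k (embed i k j u) (embed i k j v) \<or> layer \<beta> k j (embed i k j u) (embed i k j v)"
      proof cases
        case 1
        then show ?thesis using adjD[OF assms(1) 1(1)] low unfolding layer_def by metis
      next
        case 2
        then show ?thesis using adjD[OF assms(2) 2(1)] up unfolding layer_def by metis
      qed
      then show "equivclp (\<lambda>u v. layer \<alpha> i k u v \<or> layer \<beta> k j u v) (embed i k j u) (embed i k j v)"
        by (rule r_into_equivclp)
    qed
  next
    assume "equivclp (\<lambda>u v. layer \<alpha> i k u v \<or> layer \<beta> k j u v) (embed i k j x) (embed i k j y)"
    then have "equivclp (edge \<alpha> \<beta>) (f (embed i k j x)) (f (embed i k j y))"
    proof (rule equivclp_map)
      fix u v assume "layer \<alpha> i k u v \<or> layer \<beta> k j u v"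
      then consider a b where "adj \<alpha> a b" "u = embed i i k a" "v = embed i i k b"
        | a b where "adj \<beta> a b" "u = embed k k j a" "v = embed k k j b" unfolding layer_def by blast
      then have "edge \<alpha> \<beta> (f u) (f v)"
      proof cases
        case 1
        then show ?thesis using adjD[OF assms(1) 1(1)] low f unfolding edge_adj by metis
      next
        case 2
        then show ?thesis using adjD[OF assms(2) 2(1)] up f unfolding edge_adj by metis
      qed
      then show "equivclp (edge \<alpha> \<beta>) (f u) (f v)" by (rule r_into_equivclp)
    qed
    then show "product_rel \<alpha> \<beta> x y" by (simp add: product_rel_edge[OF assms(1,2)] f)
  }
qed

text \<open>The elimination step behind associativity: row \<open>k\<close> of a stack disappears in
  favour of the edges of a product. Equality is a separate case because the closure is reflexive
  while a diagram has no loops.\<close>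

lemma layer_mult:
  assumes "\<alpha> \<in> brauer_diagrams n" "\<beta> \<in> brauer_diagrams n" and d: "distinct [i, k, j]"
    and u: "fst u \<noteq> k" and v: "fst v \<noteq> k"
  shows "equivclp (\<lambda>u v. layer \<alpha> i k u v \<or> layer \<beta> k j u v) u v \<longleftrightarrow> u = v \<or> layer (diagram_mult n \<alpha> \<beta>) i j u v"
    (is "equivclp ?R u v \<longleftrightarrow> _")
proof
  have emb: "embed i i j a = embed i k j a" if "a \<in> vertices n" for a using that by (cases a) auto
  {
    assume uv: "equivclp ?R u v"
    have "layer (diagram_mult n \<alpha> \<beta>) i j u v" if neq: "u \<noteq> v"
    proof -
      \<comment> \<open>An end of a nontrivial path meets some edge, so it lies in one of the three
        rows; not being in row \<open>k\<close>, it is an outer vertex.\<close>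
      have ex: "\<exists>x\<in>vertices n. w = embed i k j x" if w: "fst w \<noteq> k" "\<exists>z. ?R w z \<or> ?R z w" for w
      proof -
        have "w \<in> {i, k, j} \<times> {1..n}" using w(2) layer_in[OF assms(1), of i k] layer_in[OF assms(2), of k j] by blast
        then have "w = (i, snd w) \<or> w = (j, snd w)" "snd w \<in> {1..n}" using w(1) by (cases w; auto)+
        then obtain a where "w = (i, a) \<or> w = (j, a)" "a \<in> {1..n}" by blast
        then have "w = embed i k j (Upper a) \<or> w = embed i k j (Lower a)" by simp
        then show ?thesis using \<open>a \<in> {1..n}\<close> by (metis in_vertices(1,2))
      qed
      obtain x where x: "x \<in> vertices n" "u = embed i k j x"
        using ex[OF u equivclp_neq[OF uv neq]] by blast
      obtain y where y: "y \<in> vertices n" "v = embed i k j y"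
        using ex[OF v equivclp_neq[OF equivclp_sym[OF uv] neq[symmetric]]] by blast
      have "product_rel \<alpha> \<beta> x y" using uv unfolding x y product_rel_layers[OF assms(1,2) d] .
      then have "adj (diagram_mult n \<alpha> \<beta>) x y" using x y that unfolding adj_mult[OF assms(1,2)] by blast
      then show ?thesis unfolding layer_def using x y emb by metis
    qed
    then show "u = v \<or> layer (diagram_mult n \<alpha> \<beta>) i j u v" by blast
  next
    assume "u = v \<or> layer (diagram_mult n \<alpha> \<beta>) i j u v"
    moreover have "equivclp ?R u v" if layer: "layer (diagram_mult n \<alpha> \<beta>) i j u v"
    proof -
      obtain x y where xy: "adj (diagram_mult n \<alpha> \<beta>) x y" "u = embed i i j x" "v = embed i i j y"
        using layer unfolding layer_def by blast
      then have "product_rel \<alpha> \<beta> x y" "u = embed i k j x" "v = embed i k j y"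
        using emb unfolding adj_mult[OF assms(1,2)] by blast+
      then show ?thesis unfolding product_rel_layers[OF assms(1,2) d] by simp
    qed
    ultimately show "equivclp ?R u v" by auto
  }
qed

text \<open>Both bracketings come from the stack with rows 0, 1, 2, 3 by eliminating the rows 1 and
  2, in different orders. The first bracketing is expanded by restoring row 1; then row 2 is
  eliminated.\<close>

lemma diagram_mult_assoc:
  assumes A: "\<alpha> \<in> brauer_diagrams n" and B: "\<beta> \<in> brauer_diagrams n" and C: "\<gamma> \<in> brauer_diagrams n"
  shows "diagram_mult n (diagram_mult n \<alpha> \<beta>) \<gamma> = diagram_mult n \<alpha> (diagram_mult n \<beta> \<gamma>)"
proof (rule brauer_adj_eqI)
  let ?AB = "diagram_mult n \<alpha> \<beta>" and ?BC = "diagram_mult n \<beta> \<gamma>"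
  have AB: "?AB \<in> brauer_diagrams n" and BC: "?BC \<in> brauer_diagrams n"
    using diagram_mult_closed A B C by blast+
  show "diagram_mult n ?AB \<gamma> \<in> brauer_diagrams n" "diagram_mult n \<alpha> ?BC \<in> brauer_diagrams n"
    using diagram_mult_closed A B C AB BC by blast+
  have d: "distinct [0, 1, 2::nat]" "distinct [0, 2, 3::nat]" "distinct [1, 2, 3::nat]" "distinct [0, 1, 3::nat]"
    by simp_all
  define R where "R = (\<lambda>u v. layer \<beta> 1 2 u v \<or> layer \<gamma> 2 3 u v)"
  fix x y assume "adj (diagram_mult n ?AB \<gamma>) x y"
  then have xy: "x \<in> vertices n" "y \<in> vertices n" "x \<noteq> y" and "product_rel ?AB \<gamma> x y"
    unfolding adj_mult[OF AB C] by blast+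
  then have "equivclp (\<lambda>u v. layer ?AB 0 2 u v \<or> layer \<gamma> 2 3 u v) (embed 0 2 3 x) (embed 0 2 3 y)"
    unfolding product_rel_layers[OF AB C d(2)] by blast
  then have "equivclp (\<lambda>u v. R u v \<or> layer \<alpha> 0 1 u v) (embed 0 2 3 x) (embed 0 2 3 y)" (is "equivclp ?T _ _")
  proof (rule equivclp_mono)
    fix u v assume "layer ?AB 0 2 u v \<or> layer \<gamma> 2 3 u v"
    moreover have "equivclp ?T u v" if "layer ?AB 0 2 u v"
    proof -
      have "fst u \<noteq> 1" "fst v \<noteq> 1" using layer_in[OF AB that] by auto
      then have "equivclp (\<lambda>u v. layer \<alpha> 0 1 u v \<or> layer \<beta> 1 2 u v) u v"
        using that layer_mult[OF A B d(1)] by blast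
      then show ?thesis by (rule equivclp_mono) (auto simp: R_def intro: r_into_equivclp)
    qed
    ultimately show "equivclp ?T u v" by (auto simp: R_def intro: r_into_equivclp)
  qed
  \<comment> \<open>The two embeddings differ only on middle vertices, which do not belong to
    \<open>vertices n\<close>.\<close>
  moreover have emb: "embed 0 2 3 z = embed 0 1 3 z" if "z \<in> vertices n" for z using that by (cases z) auto
  ultimately have T: "equivclp ?T (embed 0 1 3 x) (embed 0 1 3 y)" using xy by simp
  \<comment> \<open>The layer of \<alpha> avoids row 2, so every visit to row 2 happens inside a
    stretch through \<beta> and \<gamma>, which can be cut out.\<close>
  let ?X = "{u. fst u \<noteq> (2::nat)}"
  have S: "u \<in> ?X \<and> v \<in> ?X" if "layer \<alpha> 0 1 u v" for u v :: "nat \<times> nat" using layer_in[OF A that] by auto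
  have X: "embed 0 1 3 z \<in> ?X" for z by (cases z) auto
  have "equivclp (\<lambda>u v. (u \<in> ?X \<and> v \<in> ?X \<and> equivclp R u v) \<or> layer \<alpha> 0 1 u v) (embed 0 1 3 x) (embed 0 1 3 y)"
    by (rule equivclp_restrict[OF T X X S])
  then have "equivclp (\<lambda>u v. layer \<alpha> 0 1 u v \<or> layer ?BC 1 3 u v) (embed 0 1 3 x) (embed 0 1 3 y)"
  proof (rule equivclp_mono)
    fix u v assume "(u \<in> ?X \<and> v \<in> ?X \<and> equivclp R u v) \<or> layer \<alpha> 0 1 u v"
    then have "u = v \<or> layer ?BC 1 3 u v \<or> layer \<alpha> 0 1 u v"
      using layer_mult[OF B C d(3), of u v] unfolding R_def by blast
    then show "equivclp (\<lambda>u v. layer \<alpha> 0 1 u v \<or> layer ?BC 1 3 u v) u v"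
      by (auto intro: r_into_equivclp)
  qed
  then have "product_rel \<alpha> ?BC x y" unfolding product_rel_layers[OF A BC d(4)] .
  then show "adj (diagram_mult n \<alpha> ?BC) x y" using xy unfolding adj_mult[OF A BC] by blast
qed

subsection \<open>Tracing products\<close>

lemma product_path_lower: "adj \<alpha> x y \<Longrightarrow> product_rel \<alpha> \<beta> (lower_to_middle x) (lower_to_middle y)"
  unfolding adj_def by (rule product_rel_lower)

lemma product_path_upper: "adj \<beta> x y \<Longrightarrow> product_rel \<alpha> \<beta> (upper_to_middle x) (upper_to_middle y)"
  unfolding adj_def by (rule product_rel_upper)

context
  fixes n \<alpha> \<beta>
  assumes A: "\<alpha> \<in> brauer_diagrams n" and B: "\<beta> \<in> brauer_diagrams n"
begin

lemma mult_Upper_Upper: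
  assumes "adj \<alpha> (Upper x) (Upper y)"
  shows "adj (diagram_mult n \<alpha> \<beta>) (Upper x) (Upper y)"
  unfolding adj_mult[OF A B] using adjD[OF A assms] product_path_lower[OF assms, of \<beta>] by simp

lemma mult_Lower_Lower:
  assumes "adj \<beta> (Lower x) (Lower y)"
  shows "adj (diagram_mult n \<alpha> \<beta>) (Lower x) (Lower y)"
  unfolding adj_mult[OF A B] using adjD[OF B assms] product_path_upper[OF assms, of \<alpha>] by simp

lemma mult_Upper_Lower:
  assumes "adj \<alpha> (Upper x) (Lower m)" "adj \<beta> (Upper m) (Lower y)"
  shows "adj (diagram_mult n \<alpha> \<beta>) (Upper x) (Lower y)"
proof -
  have "product_rel \<alpha> \<beta> (Upper x) (Middle m)" "product_rel \<alpha> \<beta> (Middle m) (Lower y)"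
    using product_path_lower[OF assms(1), of \<beta>] product_path_upper[OF assms(2), of \<alpha>] by simp_all
  then show ?thesis
    unfolding adj_mult[OF A B] using adjD[OF A assms(1)] adjD[OF B assms(2)] by (blast intro: product_rel_trans)
qed

lemma mult_Upper_Upper_via:
  assumes "adj \<alpha> (Upper x) (Lower m)" "adj \<beta> (Upper m) (Upper m')" "adj \<alpha> (Upper y) (Lower m')"
  shows "adj (diagram_mult n \<alpha> \<beta>) (Upper x) (Upper y)"
proof -
  have "product_rel \<alpha> \<beta> (Upper x) (Middle m)" "product_rel \<alpha> \<beta> (Middle m) (Middle m')"
    "product_rel \<alpha> \<beta> (Middle m') (Upper y)"
    using product_path_lower[OF assms(1), of \<beta>] product_path_upper[OF assms(2), of \<alpha>]
      product_path_lower[OF adj_sym[OF assms(3)], of \<beta>] by simp_all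
  then have "product_rel \<alpha> \<beta> (Upper x) (Upper y)" by (blast intro: product_rel_trans)
  \<comment> \<open>A path gives a block only if its ends differ; equal ends would force
    \<open>m = m'\<close>, a loop in \<beta>.\<close>
  moreover have "x \<noteq> y" using adj_unique[OF A assms(1), of "Lower m'"] assms(3) adjD(1)[OF B assms(2)] by auto
  ultimately show ?thesis
    unfolding adj_mult[OF A B] using adjD[OF A assms(1)] adjD[OF A assms(3)] by blast
qed

lemma mult_Lower_Lower_via:
  assumes "adj \<beta> (Upper m) (Lower x)" "adj \<alpha> (Lower m) (Lower m')" "adj \<beta> (Upper m') (Lower y)"
  shows "adj (diagram_mult n \<alpha> \<beta>) (Lower x) (Lower y)"
proof -
  have "product_rel \<alpha> \<beta> (Lower x) (Middle m)" "product_rel \<alpha> \<beta> (Middle m) (Middle m')"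
    "product_rel \<alpha> \<beta> (Middle m') (Lower y)"
    using product_path_upper[OF adj_sym[OF assms(1)], of \<alpha>] product_path_lower[OF assms(2), of \<beta>]
      product_path_upper[OF assms(3), of \<alpha>] by simp_all
  then have "product_rel \<alpha> \<beta> (Lower x) (Lower y)" by (blast intro: product_rel_trans)
  moreover have "x \<noteq> y"
    using adj_unique'[OF B assms(1), of "Upper m'"] assms(3) adjD(1)[OF A assms(2)] by auto
  ultimately show ?thesis
    unfolding adj_mult[OF A B] using adjD[OF B assms(1)] adjD[OF B assms(3)] by blast
qed

end

section \<open>The Brauer monoid\<close>

lemma brauer_eqI_cases:
  assumes "\<alpha> \<in> brauer_diagrams n" "\<beta> \<in> brauer_diagrams n"
    and "\<And>x y. adj \<alpha> (Upper x) (Upper y) \<Longrightarrow> adj \<beta> (Upper x) (Upper y)"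
    and "\<And>x y. adj \<alpha> (Upper x) (Lower y) \<Longrightarrow> adj \<beta> (Upper x) (Lower y)"
    and "\<And>x y. adj \<alpha> (Lower x) (Lower y) \<Longrightarrow> adj \<beta> (Lower x) (Lower y)"
  shows "\<alpha> = \<beta>"
proof (rule brauer_adj_eqI[OF assms(1,2)])
  fix v w assume vw: "adj \<alpha> v w"
  then have "v \<in> vertices n" "w \<in> vertices n" using adjD[OF assms(1)] by blast+
  moreover have "adj \<beta> (Lower x) (Upper y)" if "adj \<alpha> (Lower x) (Upper y)" for x y
    using assms(4)[OF adj_sym[OF that]] by (rule adj_sym)
  ultimately show "adj \<beta> v w"
    using vw assms(3-5) by (cases v; cases w) simp_all
qed

text \<open>Brauer diagrams amount to fixed-point-free involutions of the vertex set. The identity,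
  permutations, \<open>theta\<close> and the projections are all given in this form, so that
  membership reduces to a pointwise check.\<close>

definition diagram_of :: "nat \<Rightarrow> (vertex \<Rightarrow> vertex) \<Rightarrow> diagram" where
  "diagram_of n f = (\<lambda>v. {v, f v}) ` vertices n"

lemma diagram_of:
  assumes "\<And>v. v \<in> vertices n \<Longrightarrow> f v \<in> vertices n \<and> f v \<noteq> v \<and> f (f v) = v"
  shows "diagram_of n f \<in> brauer_diagrams n"
    and "adj (diagram_of n f) v w \<longleftrightarrow> v \<in> vertices n \<and> w = f v"
proof -
  have iff: "adj (diagram_of n f) v w \<longleftrightarrow> v \<in> vertices n \<and> w = f v" for v w
  proof
    assume "adj (diagram_of n f) v w"
    then obtain u where "u \<in> vertices n" "{v, w} = {u, f u}" unfolding adj_def diagram_of_def by blast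
    then show "v \<in> vertices n \<and> w = f v" using assms[of u] unfolding doubleton_eq_iff by auto
  qed (auto simp: adj_def diagram_of_def)
  then show "adj (diagram_of n f) v w \<longleftrightarrow> v \<in> vertices n \<and> w = f v" .
  show "diagram_of n f \<in> brauer_diagrams n"
    unfolding brauer_diagrams_eq mem_Collect_eq
  proof (rule perfect_matchingI)
    fix B assume "B \<in> diagram_of n f"
    then obtain v where "v \<in> vertices n" "B = {v, f v}" unfolding diagram_of_def by blast
    then show "\<exists>x y. x \<noteq> y \<and> B = {x, y}" using assms by (intro exI[of _ v] exI[of _ "f v"]) auto
  qed (simp_all flip: adj_def add: iff)
qed

definition identity :: "nat \<Rightarrow> diagram" where
  "identity n = (\<lambda>x. {Upper x, Lower x}) ` {1..n}"

lemma identity_eq: "identity n = diagram_of n flip_vertex"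
proof (intro equalityI subsetI)
  fix B assume "B \<in> identity n"
  then obtain x where "x \<in> {1..n}" "B = {Upper x, flip_vertex (Upper x)}" unfolding identity_def by auto
  then show "B \<in> diagram_of n flip_vertex" unfolding diagram_of_def using in_vertices(1) by blast
next
  fix B assume "B \<in> diagram_of n flip_vertex"
  then obtain v where "v \<in> vertices n" "B = {v, flip_vertex v}" unfolding diagram_of_def by blast
  then have "\<exists>x\<in>{1..n}. B = {Upper x, Lower x}" by (elim verticesE) (auto simp: insert_commute)
  then show "B \<in> identity n" unfolding identity_def by blast
qed

lemma identity_closed: "identity n \<in> brauer_diagrams n"
  and adj_identity: "adj (identity n) v w \<longleftrightarrow> v \<in> vertices n \<and> w = flip_vertex v"
  unfolding identity_eq by (rule diagram_of; elim verticesE; simp)+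

lemma brauer_simps [simp]:
  "carrier (brauer n) = brauer_diagrams n" "monoid.mult (brauer n) = diagram_mult n" "monoid.one (brauer n) = identity n"
  by (simp_all add: brauer_def identity_def)

lemma identity_left:
  assumes A: "\<alpha> \<in> brauer_diagrams n"
  shows "diagram_mult n (identity n) \<alpha> = \<alpha>"
proof (rule brauer_eqI_cases[symmetric, OF A diagram_mult_closed[OF identity_closed A]])
  note I = identity_closed[of n]
  have id: "adj (identity n) (Upper x) (Lower x)" if "adj \<alpha> (Upper x) v" for x v
    using adjD[OF A that] unfolding adj_identity by simp
  show "adj (diagram_mult n (identity n) \<alpha>) (Upper x) (Upper y)" if "adj \<alpha> (Upper x) (Upper y)" for x y
    by (rule mult_Upper_Upper_via[OF I A id[OF that] that id[OF adj_sym[OF that]]])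
  show "adj (diagram_mult n (identity n) \<alpha>) (Upper x) (Lower y)" if "adj \<alpha> (Upper x) (Lower y)" for x y
    by (rule mult_Upper_Lower[OF I A id[OF that] that])
  show "adj (diagram_mult n (identity n) \<alpha>) (Lower x) (Lower y)" if "adj \<alpha> (Lower x) (Lower y)" for x y
    by (rule mult_Lower_Lower[OF I A that])
qed

lemma identity_right:
  assumes A: "\<alpha> \<in> brauer_diagrams n"
  shows "diagram_mult n \<alpha> (identity n) = \<alpha>"
proof (rule brauer_eqI_cases[symmetric, OF A diagram_mult_closed[OF A identity_closed]])
  note I = identity_closed[of n]
  have id: "adj (identity n) (Upper x) (Lower x)" if "adj \<alpha> v (Lower x)" for x v
    using adjD[OF A that] unfolding adj_identity by simp
  show "adj (diagram_mult n \<alpha> (identity n)) (Upper x) (Upper y)" if "adj \<alpha> (Upper x) (Upper y)" for x y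
    by (rule mult_Upper_Upper[OF A I that])
  show "adj (diagram_mult n \<alpha> (identity n)) (Upper x) (Lower y)" if "adj \<alpha> (Upper x) (Lower y)" for x y
    by (rule mult_Upper_Lower[OF A I that id[OF that]])
  show "adj (diagram_mult n \<alpha> (identity n)) (Lower x) (Lower y)" if "adj \<alpha> (Lower x) (Lower y)" for x y
    by (rule mult_Lower_Lower_via[OF A I id[OF adj_sym[OF that]] that id[OF that]])
qed

lemma monoid_brauer: "monoid (brauer n)"
  by (rule monoidI) (simp_all add: diagram_mult_closed diagram_mult_assoc identity_closed identity_left identity_right)

lemma Upper_partner:
  assumes "\<alpha> \<in> brauer_diagrams n" "x \<in> {1..n}"
  obtains y where "adj \<alpha> (Upper x) (Upper y)" | y where "adj \<alpha> (Upper x) (Lower y)"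
proof -
  obtain v where v: "adj \<alpha> (Upper x) v" using adj_ex[OF assms(1), of "Upper x"] assms(2) by auto
  then have "v \<in> vertices n" using adjD[OF assms(1)] by blast
  then show thesis using v that by (cases v) simp_all
qed

lemma Lower_partner:
  assumes "\<alpha> \<in> brauer_diagrams n" "x \<in> {1..n}"
  obtains y where "adj \<alpha> (Lower x) (Lower y)" | y where "adj \<alpha> (Upper y) (Lower x)"
proof -
  obtain v where v: "adj \<alpha> (Lower x) v" using adj_ex[OF assms(1), of "Lower x"] assms(2) by auto
  then have "v \<in> vertices n" using adjD[OF assms(1)] by blast
  then show thesis using v that adj_sym[OF v] by (cases v) simp_all
qed

lemma adj_range:
  assumes "\<alpha> \<in> brauer_diagrams n"
  shows "adj \<alpha> (Upper x) v \<Longrightarrow> x \<in> {1..n}" "adj \<alpha> v (Upper x) \<Longrightarrow> x \<in> {1..n}"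
    "adj \<alpha> (Lower x) v \<Longrightarrow> x \<in> {1..n}" "adj \<alpha> v (Lower x) \<Longrightarrow> x \<in> {1..n}"
  using adjD(2,3)[OF assms] by (metis in_vertices(1,2))+

lemma ker_iff:
  assumes "\<alpha> \<in> brauer_diagrams n"
  shows "(x, y) \<in> ker \<alpha> \<longleftrightarrow> x \<in> {1..n} \<and> x = y \<or> adj \<alpha> (Upper x) (Upper y)"
  unfolding ker_def using same_block_brauer[OF assms] by (auto simp: adj_def)

subsection \<open>Rank\<close>

text \<open>Usually called the domain of \<alpha>; \<open>lower_free\<close> is its
  codomain.\<close>

definition upper_free :: "diagram \<Rightarrow> nat set" where
  "upper_free \<alpha> = {x. \<exists>y. adj \<alpha> (Upper x) (Lower y)}"

definition lower_free :: "diagram \<Rightarrow> nat set" where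
  "lower_free \<alpha> = {y. \<exists>x. adj \<alpha> (Upper x) (Lower y)}"

lemma transversals_eq:
  assumes "\<alpha> \<in> brauer_diagrams n"
  shows "transversals \<alpha> = (\<lambda>(x, y). {Upper x, Lower y}) ` {(x, y). adj \<alpha> (Upper x) (Lower y)}"
proof (intro equalityI subsetI)
  fix B assume "B \<in> transversals \<alpha>"
  then obtain x y where B: "B \<in> \<alpha>" "Upper x \<in> B" "Lower y \<in> B" unfolding transversals_def by blast
  obtain u v where uv: "B = {u, v}" by (rule perfect_matching_block[OF brauer_diagramsD[OF assms] B(1)])
  then have eq: "B = {Upper x, Lower y}" using B(2,3) by auto
  then have "adj \<alpha> (Upper x) (Lower y)" using B(1) unfolding adj_def by simp
  then show "B \<in> (\<lambda>(x, y). {Upper x, Lower y}) ` {(x, y). adj \<alpha> (Upper x) (Lower y)}"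
    unfolding eq by blast
next
  fix B assume "B \<in> (\<lambda>(x, y). {Upper x, Lower y}) ` {(x, y). adj \<alpha> (Upper x) (Lower y)}"
  then obtain x y where "B = {Upper x, Lower y}" "adj \<alpha> (Upper x) (Lower y)" by auto
  then show "B \<in> transversals \<alpha>" unfolding transversals_def adj_def by auto
qed

lemma rank_free:
  assumes "\<alpha> \<in> brauer_diagrams n"
  shows "rank \<alpha> = card (upper_free \<alpha>)" "rank \<alpha> = card (lower_free \<alpha>)"
proof -
  let ?T = "{(x, y). adj \<alpha> (Upper x) (Lower y)}"
  have "inj_on (\<lambda>(x, y). {Upper x, Lower y}) ?T" by (auto simp: inj_on_def doubleton_eq_iff)
  then have rank: "rank \<alpha> = card ?T" unfolding rank_def transversals_eq[OF assms] by (rule card_image)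
  have "inj_on fst ?T" using adj_unique[OF assms] by (fastforce intro: inj_onI)
  moreover have "fst ` ?T = upper_free \<alpha>" unfolding upper_free_def by force
  ultimately show "rank \<alpha> = card (upper_free \<alpha>)" using rank card_image by metis
  have "inj_on snd ?T" using adj_unique'[OF assms] by (fastforce intro: inj_onI)
  moreover have "snd ` ?T = lower_free \<alpha>" unfolding lower_free_def by force
  ultimately show "rank \<alpha> = card (lower_free \<alpha>)" using rank card_image by metis
qed

lemma upper_free_iff:
  assumes "\<alpha> \<in> brauer_diagrams n"
  shows "x \<in> upper_free \<alpha> \<longleftrightarrow> x \<in> {1..n} \<and> (\<forall>y. \<not> adj \<alpha> (Upper x) (Upper y))"
proof
  assume "x \<in> upper_free \<alpha>"
  then obtain y where y: "adj \<alpha> (Upper x) (Lower y)" unfolding upper_free_def by blast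
  then show "x \<in> {1..n} \<and> (\<forall>y. \<not> adj \<alpha> (Upper x) (Upper y))"
    using adj_range[OF assms] adj_unique[OF assms y] by blast
next
  assume "x \<in> {1..n} \<and> (\<forall>y. \<not> adj \<alpha> (Upper x) (Upper y))"
  then show "x \<in> upper_free \<alpha>" unfolding upper_free_def by (blast elim: Upper_partner[OF assms])
qed

lemma lower_free_iff:
  assumes "\<alpha> \<in> brauer_diagrams n"
  shows "x \<in> lower_free \<alpha> \<longleftrightarrow> x \<in> {1..n} \<and> (\<forall>y. \<not> adj \<alpha> (Lower x) (Lower y))"
proof
  assume "x \<in> lower_free \<alpha>"
  then obtain y where y: "adj \<alpha> (Upper y) (Lower x)" unfolding lower_free_def by blast
  then show "x \<in> {1..n} \<and> (\<forall>y. \<not> adj \<alpha> (Lower x) (Lower y))"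
    using adj_range[OF assms] adj_unique[OF assms adj_sym[OF y]] by blast
next
  assume "x \<in> {1..n} \<and> (\<forall>y. \<not> adj \<alpha> (Lower x) (Lower y))"
  then show "x \<in> lower_free \<alpha>" unfolding lower_free_def by (blast elim: Lower_partner[OF assms])
qed

lemma free_subset:
  assumes "\<alpha> \<in> brauer_diagrams n"
  shows "upper_free \<alpha> \<subseteq> {1..n}" "lower_free \<alpha> \<subseteq> {1..n}"
  using upper_free_iff[OF assms] lower_free_iff[OF assms] by blast+

lemma finite_free:
  assumes "\<alpha> \<in> brauer_diagrams n"
  shows "finite (upper_free \<alpha>)" "finite (lower_free \<alpha>)"
  using free_subset[OF assms] by (auto intro: finite_subset)

lemma upper_free_mult:
  assumes A: "\<alpha> \<in> brauer_diagrams n" and B: "\<beta> \<in> brauer_diagrams n"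
  shows "upper_free (diagram_mult n \<alpha> \<beta>) \<subseteq> upper_free \<alpha>"
proof
  fix x assume "x \<in> upper_free (diagram_mult n \<alpha> \<beta>)"
  then show "x \<in> upper_free \<alpha>"
    using mult_Upper_Upper[OF A B] unfolding upper_free_iff[OF A] upper_free_iff[OF diagram_mult_closed[OF A B]]
    by blast
qed

lemma lower_free_mult:
  assumes A: "\<alpha> \<in> brauer_diagrams n" and B: "\<beta> \<in> brauer_diagrams n"
  shows "lower_free (diagram_mult n \<alpha> \<beta>) \<subseteq> lower_free \<beta>"
proof
  fix x assume "x \<in> lower_free (diagram_mult n \<alpha> \<beta>)"
  then show "x \<in> lower_free \<beta>"
    using mult_Lower_Lower[OF A B] unfolding lower_free_iff[OF B] lower_free_iff[OF diagram_mult_closed[OF A B]]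
    by blast
qed

lemma rank_mult_le:
  assumes A: "\<alpha> \<in> brauer_diagrams n" and B: "\<beta> \<in> brauer_diagrams n"
  shows "rank (diagram_mult n \<alpha> \<beta>) \<le> rank \<alpha>" "rank (diagram_mult n \<alpha> \<beta>) \<le> rank \<beta>"
  using card_mono[OF finite_free(1)[OF A] upper_free_mult[OF A B]] rank_free(1)[OF A]
    card_mono[OF finite_free(2)[OF B] lower_free_mult[OF A B]] rank_free(2)[OF B]
    rank_free[OF diagram_mult_closed[OF A B]] by simp_all

subsection \<open>Units\<close>

fun permute_vertex :: "(nat \<Rightarrow> nat) \<Rightarrow> vertex \<Rightarrow> vertex" where
  "permute_vertex \<pi> (Upper x) = Lower (\<pi> x)"
| "permute_vertex \<pi> (Lower x) = Upper (inv_into UNIV \<pi> x)"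
| "permute_vertex \<pi> (Middle x) = Middle x"

definition perm_diagram :: "nat \<Rightarrow> (nat \<Rightarrow> nat) \<Rightarrow> diagram" where
  "perm_diagram n \<pi> = diagram_of n (permute_vertex \<pi>)"

context
  fixes n :: nat and \<pi> :: "nat \<Rightarrow> nat"
  assumes \<pi>: "\<pi> permutes {1..n}"
begin

lemma permute_vertex:
  assumes "v \<in> vertices n"
  shows "permute_vertex \<pi> v \<in> vertices n \<and> permute_vertex \<pi> v \<noteq> v \<and> permute_vertex \<pi> (permute_vertex \<pi> v) = v"
  using assms
proof (cases rule: verticesE)
  case (1 x)
  then show ?thesis using permutes_in_image[OF \<pi>, of x] permutes_inverses[OF \<pi>] by simp
next
  case (2 x)
  then show ?thesis using permutes_in_image[OF permutes_inv[OF \<pi>], of x] permutes_inverses[OF \<pi>] by simp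
qed

lemma perm_diagram_closed: "perm_diagram n \<pi> \<in> brauer_diagrams n"
  unfolding perm_diagram_def by (rule diagram_of(1)[OF permute_vertex])

lemma adj_perm_diagram: "adj (perm_diagram n \<pi>) v w \<longleftrightarrow> v \<in> vertices n \<and> w = permute_vertex \<pi> v"
  unfolding perm_diagram_def by (rule diagram_of(2)[OF permute_vertex])

lemma adj_perm_Upper: "x \<in> {1..n} \<Longrightarrow> adj (perm_diagram n \<pi>) (Upper x) (Lower (\<pi> x))"
  unfolding adj_perm_diagram by simp

lemma adj_perm_Lower: "x \<in> {1..n} \<Longrightarrow> adj (perm_diagram n \<pi>) (Upper (inv_into UNIV \<pi> x)) (Lower x)"
  unfolding adj_perm_diagram using permutes_in_image[OF permutes_inv[OF \<pi>], of x] permutes_inverses[OF \<pi>] by simp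

end

lemma perm_diagram_inverse:
  assumes \<pi>: "\<pi> permutes {1..n}"
  shows "diagram_mult n (perm_diagram n \<pi>) (perm_diagram n (inv_into UNIV \<pi>)) = identity n"
proof (rule brauer_eqI_cases[symmetric])
  note \<pi>' = permutes_inv[OF \<pi>]
  note P = perm_diagram_closed[OF \<pi>] perm_diagram_closed[OF \<pi>']
  show "identity n \<in> brauer_diagrams n" by (rule identity_closed)
  show "diagram_mult n (perm_diagram n \<pi>) (perm_diagram n (inv_into UNIV \<pi>)) \<in> brauer_diagrams n"
    by (rule diagram_mult_closed[OF P])
  fix x y assume "adj (identity n) (Upper x) (Lower y)"
  then have xy: "x \<in> {1..n}" "y = x" unfolding adj_identity by auto
  have "adj (perm_diagram n (inv_into UNIV \<pi>)) (Upper (\<pi> x)) (Lower x)"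
    using adj_perm_Upper[OF \<pi>', of "\<pi> x"] permutes_in_image[OF \<pi>, of x] permutes_inverses[OF \<pi>] xy by simp
  then show "adj (diagram_mult n (perm_diagram n \<pi>) (perm_diagram n (inv_into UNIV \<pi>))) (Upper x) (Lower y)"
    unfolding xy(2) by (rule mult_Upper_Lower[OF P adj_perm_Upper[OF \<pi> xy(1)]])
qed (auto simp: adj_identity)

lemma perm_diagram_Units:
  assumes \<pi>: "\<pi> permutes {1..n}"
  shows "perm_diagram n \<pi> \<in> Units (brauer n)"
proof -
  have "inv_into UNIV (inv_into UNIV \<pi>) = \<pi>" using permutes_bij[OF \<pi>] by (rule inv_inv_eq)
  then have "diagram_mult n (perm_diagram n (inv_into UNIV \<pi>)) (perm_diagram n \<pi>) = identity n"
    using perm_diagram_inverse[OF permutes_inv[OF \<pi>]] by simp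
  then show ?thesis
    unfolding Units_def using perm_diagram_inverse[OF \<pi>] perm_diagram_closed[OF \<pi>]
      perm_diagram_closed[OF permutes_inv[OF \<pi>]] by auto
qed

text \<open>An upper block of \<open>u\<close> would survive in \<open>u v\<close>, which is the
  identity. Hence every upper point lies on a transversal, and the lower ends define an injection of
  \<open>{1..n}\<close> into itself.\<close>

lemma Units_perm_diagram:
  assumes "u \<in> Units (brauer n)"
  obtains \<pi> where "\<pi> permutes {1..n}" "u = perm_diagram n \<pi>"
proof -
  obtain v where u: "u \<in> brauer_diagrams n" and v: "v \<in> brauer_diagrams n"
    and uv: "diagram_mult n u v = identity n"
    using assms unfolding Units_def by auto
  have ex: "\<exists>y. adj u (Upper x) (Lower y)" if "x \<in> {1..n}" for x
    using u that
  proof (cases rule: Upper_partner)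
    case (1 y)
    then show ?thesis using mult_Upper_Upper[OF u v] unfolding uv adj_identity by auto
  qed blast
  define \<pi> where "\<pi> = (\<lambda>x. if x \<in> {1..n} then SOME y. adj u (Upper x) (Lower y) else x)"
  have adj: "adj u (Upper x) (Lower (\<pi> x))" if "x \<in> {1..n}" for x
    using someI_ex[OF ex[OF that]] that unfolding \<pi>_def by simp
  have "inj_on \<pi> {1..n}"
  proof (rule inj_onI)
    fix x y assume "x \<in> {1..n}" "y \<in> {1..n}" "\<pi> x = \<pi> y"
    then show "x = y" using adj_unique'[OF u adj[of x], of "Upper y"] adj[of y] by simp
  qed
  moreover have "\<pi> ` {1..n} \<subseteq> {1..n}" using adj_range(4)[OF u adj] by blast
  ultimately have "bij_betw \<pi> {1..n} {1..n}" by (simp add: bij_betw_def endo_inj_surj)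
  then have \<pi>: "\<pi> permutes {1..n}" by (rule bij_imp_permutes) (auto simp: \<pi>_def)
  have "perm_diagram n \<pi> = u"
  proof (rule brauer_eqI_cases[OF perm_diagram_closed[OF \<pi>] u])
  qed (use adj in \<open>auto simp: adj_perm_diagram[OF \<pi>]\<close>)
  then show thesis using that \<pi> by blast
qed

section \<open>The diagrams \<open>\<zeta>\<close> and \<open>\<gamma>\<close>\<close>

text \<open>The involution exchanging 2i-1 and 2i, whose orbits give the blocks of \<zeta>.
  Truncated subtraction makes 0 a fixed point, whence the positivity conditions below.\<close>

definition mate :: "nat \<Rightarrow> nat" where
  "mate x = (if odd x then x + 1 else x - 1)"

lemma mate_mate [simp]: "0 < x \<Longrightarrow> mate (mate x) = x"
  by (auto simp: mate_def elim!: evenE)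

lemma mate_neq [simp]: "0 < x \<Longrightarrow> mate x \<noteq> x"
  by (auto simp: mate_def elim!: evenE)

lemma mate_le_iff: "even r \<Longrightarrow> 0 < x \<Longrightarrow> mate x \<le> r \<longleftrightarrow> x \<le> r"
  unfolding mate_def by (cases "odd x"; simp; presburger)

lemma mate_pos: "0 < x \<Longrightarrow> 0 < mate x"
  by (auto simp: mate_def elim!: evenE)

lemma odd_mate: "0 < x \<Longrightarrow> odd (mate x) \<longleftrightarrow> even x"
  by (auto simp: mate_def)

text \<open>Each pair {2i-1, 2i} has exactly one odd element, so the odd elements represent the
  pairs.\<close>

lemma mate_closed_split:
  assumes "0 \<notin> A" and "\<And>x. x \<in> A \<Longrightarrow> mate x \<in> A"
  shows "A = {x \<in> A. odd x} \<union> mate ` {x \<in> A. odd x}" "{x \<in> A. odd x} \<inter> mate ` {x \<in> A. odd x} = {}"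
    "inj_on mate {x \<in> A. odd x}"
proof -
  have "x \<in> mate ` {x \<in> A. odd x}" if "x \<in> A" "even x" for x
  proof -
    have "0 < x" using that assms(1) by (metis gr0I)
    then have "mate x \<in> {x \<in> A. odd x}" "x = mate (mate x)" using assms(2)[OF that(1)] that(2) odd_mate by auto
    then show ?thesis by blast
  qed
  then show "A = {x \<in> A. odd x} \<union> mate ` {x \<in> A. odd x}" using assms(2) by blast
  show "{x \<in> A. odd x} \<inter> mate ` {x \<in> A. odd x} = {}" by (auto simp: mate_def)
  show "inj_on mate {x \<in> A. odd x}" by (auto simp: inj_on_def mate_def)
qed

lemma card_mate_closed:
  assumes "0 \<notin> A" "finite A" and "\<And>x. x \<in> A \<Longrightarrow> mate x \<in> A"
  shows "card A = 2 * card {x \<in> A. odd x}"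
proof -
  let ?O = "{x \<in> A. odd x}"
  have "card A = card (?O \<union> mate ` ?O)" using mate_closed_split(1)[OF assms(1,3)] by simp
  also have "\<dots> = card ?O + card (mate ` ?O)"
    by (rule card_Un_disjoint) (use assms(2) mate_closed_split(2)[OF assms(1,3)] in auto)
  also have "card (mate ` ?O) = card ?O" by (rule card_image[OF mate_closed_split(3)[OF assms(1,3)]])
  finally show ?thesis by simp
qed

fun theta_vertex :: "nat \<Rightarrow> vertex \<Rightarrow> vertex" where
  "theta_vertex r (Upper x) = (if x \<le> r then Lower x else Upper (mate x))"
| "theta_vertex r (Lower x) = (if x \<le> r then Upper x else Lower (mate x))"
| "theta_vertex r (Middle x) = Middle x"

text \<open>For even \<open>r\<close>, vertical up to \<open>r\<close> and equal to \<zeta> beyond: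
  \<open>r = 0\<close> gives \<zeta>, \<open>r = 2\<close> gives \<gamma>, and \<open>r = 4\<close>
  provides the rank four element on which faithfulness rests.\<close>

definition theta :: "nat \<Rightarrow> nat \<Rightarrow> diagram" where
  "theta n r = diagram_of n (theta_vertex r)"

locale even_degree =
  fixes n :: nat
  assumes n_ge: "4 \<le> n" and n_even: "even n"
begin

abbreviation D :: "diagram set" where
  "D \<equiv> brauer_diagrams n"

abbreviation mult :: "diagram \<Rightarrow> diagram \<Rightarrow> diagram"  (infixl \<open>\<odot>\<close> 70) where
  "\<alpha> \<odot> \<beta> \<equiv> diagram_mult n \<alpha> \<beta>"

lemmas mult_closed = diagram_mult_closed[of _ n]

lemmas mult_assoc = diagram_mult_assoc[of _ n]

lemma mate_in: "x \<in> {1..n} \<Longrightarrow> mate x \<in> {1..n}"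
  using mate_le_iff[OF n_even, of x] mate_pos[of x] by auto

lemma mate_mate_in [simp]: "x \<in> {1..n} \<Longrightarrow> mate (mate x) = x"
  by simp

lemma theta_vertex:
  assumes "even r" "v \<in> vertices n"
  shows "theta_vertex r v \<in> vertices n \<and> theta_vertex r v \<noteq> v \<and> theta_vertex r (theta_vertex r v) = v"
  using assms(2)
proof (cases rule: verticesE)
  case (1 x)
  then show ?thesis using mate_in[OF 1(1)] mate_le_iff[OF assms(1), of x] by simp
next
  case (2 x)
  then show ?thesis using mate_in[OF 2(1)] mate_le_iff[OF assms(1), of x] by simp
qed

lemma theta_closed: "even r \<Longrightarrow> theta n r \<in> D"
  unfolding theta_def by (rule diagram_of(1)[OF theta_vertex])

lemma adj_theta: "even r \<Longrightarrow> adj (theta n r) v w \<longleftrightarrow> v \<in> vertices n \<and> w = theta_vertex r v"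
  unfolding theta_def by (rule diagram_of(2)[OF theta_vertex])

text \<open>Translates the indexed families in \<open>zeta\<close> and \<open>gamma\<close>, whose
  indices start at 1 and 2, into the involution form. An index names a pair, whereas the involution
  produces each block from both of its ends.\<close>

lemma theta_pairs:
  assumes r: "even r" and k: "k = r div 2"
  shows "(\<lambda>v. {v, theta_vertex r v}) ` {v \<in> vertices n. \<forall>x. v = Upper x \<or> v = Lower x \<longrightarrow> r < x} =
    (\<Union>i\<in>{k + 1..n div 2}. {{Upper (2 * i - 1), Upper (2 * i)}, {Lower (2 * i - 1), Lower (2 * i)}})" (is "?L = ?R")
proof (intro equalityI subsetI)
  fix B assume "B \<in> ?L"
  then obtain v where v: "v \<in> vertices n" "\<forall>x. v = Upper x \<or> v = Lower x \<longrightarrow> r < x" "B = {v, theta_vertex r v}" by blast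
  have pair: "\<exists>i\<in>{k + 1..n div 2}. x = 2 * i - 1 \<and> mate x = 2 * i \<or> x = 2 * i \<and> mate x = 2 * i - 1"
    if "x \<in> {1..n}" "r < x" for x
  \<comment> \<open>The index of the pair containing \<open>x\<close>, whether \<open>x\<close> is
    its odd or its even element.\<close>
  proof (intro bexI[of _ "(x + 1) div 2"])
    show "(x + 1) div 2 \<in> {k + 1..n div 2}" using that n_even r k by simp presburger
    show "x = 2 * ((x + 1) div 2) - 1 \<and> mate x = 2 * ((x + 1) div 2) \<or>
        x = 2 * ((x + 1) div 2) \<and> mate x = 2 * ((x + 1) div 2) - 1"
      unfolding mate_def by (cases "odd x"; simp)
  qed
  from v(1) show "B \<in> ?R"
  proof (cases rule: verticesE)
    case (1 x)
    then have "r < x" "B = {Upper x, Upper (mate x)}" using v by auto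
    moreover obtain i where i: "i \<in> {k + 1..n div 2}"
      "x = 2 * i - 1 \<and> mate x = 2 * i \<or> x = 2 * i \<and> mate x = 2 * i - 1"
      using pair[OF 1(1) \<open>r < x\<close>] by blast
    ultimately have "B = {Upper (2 * i - 1), Upper (2 * i)}" by auto
    then show ?thesis using i(1) by blast
  next
    case (2 x)
    then have "r < x" "B = {Lower x, Lower (mate x)}" using v by auto
    moreover obtain i where i: "i \<in> {k + 1..n div 2}"
      "x = 2 * i - 1 \<and> mate x = 2 * i \<or> x = 2 * i \<and> mate x = 2 * i - 1"
      using pair[OF 2(1) \<open>r < x\<close>] by blast
    ultimately have "B = {Lower (2 * i - 1), Lower (2 * i)}" by auto
    then show ?thesis using i(1) by blast
  qed
next
  fix B assume "B \<in> ?R"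
  then obtain i where i: "i \<in> {k + 1..n div 2}"
    "B = {Upper (2 * i - 1), Upper (2 * i)} \<or> B = {Lower (2 * i - 1), Lower (2 * i)}" by blast
  have x: "2 * i - 1 \<in> {1..n}" "r < 2 * i - 1" "mate (2 * i - 1) = 2 * i"
    using i(1) r k by (auto simp: mate_def elim!: evenE)
  have "B = {Upper (2 * i - 1), theta_vertex r (Upper (2 * i - 1))} \<or>
      B = {Lower (2 * i - 1), theta_vertex r (Lower (2 * i - 1))}" using i(2) x by auto
  moreover have "Upper (2 * i - 1) \<in> {v \<in> vertices n. \<forall>x. v = Upper x \<or> v = Lower x \<longrightarrow> r < x}"
    "Lower (2 * i - 1) \<in> {v \<in> vertices n. \<forall>x. v = Upper x \<or> v = Lower x \<longrightarrow> r < x}"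
    using x by auto
  ultimately show "B \<in> ?L" by (elim disjE) (rule image_eqI, assumption, assumption)+
qed

lemma zeta_eq: "zeta n = theta n 0"
proof -
  have "{v \<in> vertices n. \<forall>x. v = Upper x \<or> v = Lower x \<longrightarrow> 0 < x} = vertices n" by (auto simp: vertices_def)
  then show ?thesis using theta_pairs[of 0 0] unfolding zeta_def theta_def diagram_of_def by simp
qed

lemma gamma_eq: "gamma n = theta n 2"
proof -
  let ?V = "{v \<in> vertices n. \<forall>x. v = Upper x \<or> v = Lower x \<longrightarrow> 2 < x}"
  have "vertices n = {Upper 1, Lower 1, Upper 2, Lower 2} \<union> ?V"
    using n_ge by (auto elim!: verticesE)
  then have "theta n 2 = (\<lambda>v. {v, theta_vertex 2 v}) ` ({Upper 1, Lower 1, Upper 2, Lower 2} \<union> ?V)"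
    unfolding theta_def diagram_of_def by simp
  also have "\<dots> = {{Upper 1, Lower 1}, {Upper 2, Lower 2}} \<union> (\<lambda>v. {v, theta_vertex 2 v}) ` ?V"
    by (auto simp: insert_commute)
  finally show ?thesis using theta_pairs[of 2 1] unfolding gamma_def by (simp add: numeral_2_eq_2)
qed

lemma zeta_closed: "zeta n \<in> D"
  unfolding zeta_eq by (rule theta_closed) simp

lemma gamma_closed: "gamma n \<in> D"
  unfolding gamma_eq by (rule theta_closed) simp

lemma adj_zeta: "adj (zeta n) (Upper x) v \<longleftrightarrow> x \<in> {1..n} \<and> v = Upper (mate x)"
  "adj (zeta n) (Lower x) v \<longleftrightarrow> x \<in> {1..n} \<and> v = Lower (mate x)"
  unfolding zeta_eq adj_theta[of 0, simplified] by auto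

section \<open>The kernel conditions for K, \<open>R_zeta\<close>, \<open>R_gamma\<close> and
  \<open>Omega1\<close> in terms of blocks\<close>

lemma K_iff: "\<alpha> \<in> K_set n \<longleftrightarrow> \<alpha> \<in> D \<and> (\<forall>x y. adj \<alpha> (Upper x) (Upper y) \<longrightarrow> y = mate x)"
proof (cases "\<alpha> \<in> D")
  case True
  have "ker \<alpha> \<subseteq> ker (zeta n) \<longleftrightarrow> (\<forall>x y. adj \<alpha> (Upper x) (Upper y) \<longrightarrow> y = mate x)"
    unfolding subset_iff split_paired_All ker_iff[OF True] ker_iff[OF zeta_closed] adj_zeta
    using adj_range[OF True] adjD(1)[OF True] by blast
  then show ?thesis unfolding K_set_def using True by simp
next
  case False
  then show ?thesis unfolding K_set_def by simp
qed

lemma R_zeta_iff: "\<alpha> \<in> R_zeta n \<longleftrightarrow> \<alpha> \<in> D \<and> (\<forall>x\<in>{1..n}. adj \<alpha> (Upper x) (Upper (mate x)))"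
proof (cases "\<alpha> \<in> D")
  case True
  have "ker \<alpha> = ker (zeta n) \<longleftrightarrow> (\<forall>x\<in>{1..n}. adj \<alpha> (Upper x) (Upper (mate x)))"
  proof
    assume "ker \<alpha> = ker (zeta n)"
    then have eq: "(x, y) \<in> ker \<alpha> \<longleftrightarrow> (x, y) \<in> ker (zeta n)" for x y by simp
    show "\<forall>x\<in>{1..n}. adj \<alpha> (Upper x) (Upper (mate x))"
    proof
      fix x assume x: "x \<in> {1..n}"
      then have "mate x \<noteq> x" by simp
      then show "adj \<alpha> (Upper x) (Upper (mate x))"
        using eq[of x "mate x"] x unfolding ker_iff[OF True] ker_iff[OF zeta_closed] adj_zeta by auto
    qed
  next
    assume a: "\<forall>x\<in>{1..n}. adj \<alpha> (Upper x) (Upper (mate x))"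
    have "adj \<alpha> (Upper x) (Upper y) \<longleftrightarrow> x \<in> {1..n} \<and> y = mate x" for x y
      using a adj_range(1)[OF True, of x "Upper y"] adj_unique[OF True, of "Upper x" "Upper y"] by blast
    then have "(x, y) \<in> ker \<alpha> \<longleftrightarrow> (x, y) \<in> ker (zeta n)" for x y
      unfolding ker_iff[OF True] ker_iff[OF zeta_closed] adj_zeta by simp
    then show "ker \<alpha> = ker (zeta n)" by auto
  qed
  then show ?thesis unfolding R_zeta_def using True by simp
next
  case False
  then show ?thesis unfolding R_zeta_def by simp
qed

text \<open>Once the points above 2 are paired among themselves, 1 and 2 could share an upper block
  only with each other; one negation therefore rules out all further kernel pairs.\<close>

lemma R_gamma_iff:
  "\<alpha> \<in> R_gamma n \<longleftrightarrow>
    \<alpha> \<in> D \<and> (\<forall>x\<in>{3..n}. adj \<alpha> (Upper x) (Upper (mate x))) \<and> \<not> adj \<alpha> (Upper 1) (Upper 2)"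
proof (cases "\<alpha> \<in> D")
  case True
  have g: "adj (gamma n) (Upper x) (Upper y) \<longleftrightarrow> x \<in> {3..n} \<and> y = mate x" for x y
    unfolding gamma_eq using adj_theta[of 2] by auto
  have "ker \<alpha> = ker (gamma n) \<longleftrightarrow>
    (\<forall>x\<in>{3..n}. adj \<alpha> (Upper x) (Upper (mate x))) \<and> \<not> adj \<alpha> (Upper 1) (Upper 2)"
  proof
    assume "ker \<alpha> = ker (gamma n)"
    then have eq: "(x, y) \<in> ker \<alpha> \<longleftrightarrow> (x, y) \<in> ker (gamma n)" for x y by simp
    have "adj \<alpha> (Upper x) (Upper (mate x))" if x: "x \<in> {3..n}" for x
    proof -
      have "mate x \<noteq> x" using x by simp
      then show "adj \<alpha> (Upper x) (Upper (mate x))"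
        using eq[of x "mate x"] x unfolding ker_iff[OF True] ker_iff[OF gamma_closed] g by auto
    qed
    moreover have "\<not> adj \<alpha> (Upper 1) (Upper 2)"
      using eq[of 1 2] unfolding ker_iff[OF True] ker_iff[OF gamma_closed] g by simp
    ultimately show "(\<forall>x\<in>{3..n}. adj \<alpha> (Upper x) (Upper (mate x))) \<and> \<not> adj \<alpha> (Upper 1) (Upper 2)" by blast
  next
    assume a: "(\<forall>x\<in>{3..n}. adj \<alpha> (Upper x) (Upper (mate x))) \<and> \<not> adj \<alpha> (Upper 1) (Upper 2)"
    have "adj \<alpha> (Upper x) (Upper y) \<longleftrightarrow> x \<in> {3..n} \<and> y = mate x" for x y
    proof
      assume xy: "adj \<alpha> (Upper x) (Upper y)"
      have "x \<in> {1..n}" "y \<in> {1..n}" "x \<noteq> y" using adj_range[OF True] adjD(1)[OF True] xy by blast+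
      have "x \<in> {3..n}"
      proof (rule ccontr)
        assume "x \<notin> {3..n}"
        then have x: "x = 1 \<or> x = 2" using \<open>x \<in> {1..n}\<close> by auto
        have "y \<in> {3..n}" using x a xy adj_sym[OF xy] \<open>y \<in> {1..n}\<close> \<open>x \<noteq> y\<close> by (cases "y = 1"; cases "y = 2") auto
        then have "x = mate y" using a adj_unique[OF True adj_sym[OF xy], of "Upper (mate y)"] by simp
        moreover have "2 < mate y" using mate_le_iff[of 2 y] \<open>y \<in> {3..n}\<close> by auto
        ultimately show False using x by auto
      qed
      then show "x \<in> {3..n} \<and> y = mate x" using a adj_unique[OF True xy, of "Upper (mate x)"] by simp
    qed (use a in simp)
    then have "(x, y) \<in> ker \<alpha> \<longleftrightarrow> (x, y) \<in> ker (gamma n)" for x y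
      unfolding ker_iff[OF True] ker_iff[OF gamma_closed] g by simp
    then show "ker \<alpha> = ker (gamma n)" by auto
  qed
  then show ?thesis unfolding R_gamma_def using True by simp
next
  case False
  then show ?thesis unfolding R_gamma_def by simp
qed

lemma mate_small: "mate 1 = 2" "mate 2 = 1"
  by (simp_all add: mate_def)

text \<open>The two halves differ only in whether 1 and 2 form an upper block, so their union leaves
  this open.\<close>

lemma Omega1_iff: "\<alpha> \<in> Omega1 n \<longleftrightarrow> \<alpha> \<in> D \<and> (\<forall>x\<in>{3..n}. adj \<alpha> (Upper x) (Upper (mate x)))"
proof -
  have split: "{1..n} = insert 1 (insert 2 {3..n})" using n_ge by auto
  show ?thesis
    unfolding Omega1_def Un_iff R_gamma_iff R_zeta_iff split ball_simps mate_small
    using adj_commute[of \<alpha> "Upper 1" "Upper 2"] by blast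
qed

section \<open>The right congruence \<open>\<tau>\<close>\<close>

text \<open>If \<open>mate x\<close> lay in an upper block, membership in K would force its partner
  to be \<open>mate (mate x) = x\<close>. Hence free upper points come in pairs, which makes the
  rank even on K.\<close>

lemma upper_free_mate:
  assumes "\<alpha> \<in> K_set n" "x \<in> upper_free \<alpha>"
  shows "mate x \<in> upper_free \<alpha>"
proof -
  have A: "\<alpha> \<in> D" and K: "\<And>x y. adj \<alpha> (Upper x) (Upper y) \<Longrightarrow> y = mate x" using assms(1) unfolding K_iff by blast+
  have x: "x \<in> {1..n}" "\<not> adj \<alpha> (Upper x) (Upper (mate x))" using assms(2) unfolding upper_free_iff[OF A] by blast+
  have "\<not> adj \<alpha> (Upper (mate x)) (Upper y)" for y
    using K[of "mate x" y] x(2) mate_mate_in[OF x(1)] adj_commute[of \<alpha> "Upper x"] by auto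
  then show ?thesis unfolding upper_free_iff[OF A] using mate_in[OF x(1)] by blast
qed

lemma rank_K_even:
  assumes "\<alpha> \<in> K_set n"
  shows "even (rank \<alpha>)"
proof -
  have A: "\<alpha> \<in> D" using assms unfolding K_iff by blast
  have "0 \<notin> upper_free \<alpha>" using free_subset(1)[OF A] by auto
  then show ?thesis
    unfolding rank_free(1)[OF A] using card_mate_closed[OF _ finite_free(1)[OF A] upper_free_mate[OF assms]] by simp
qed

lemma J_iff: "\<alpha> \<in> J_set n \<longleftrightarrow> \<alpha> \<in> K_set n \<and> rank \<alpha> \<le> 2"
  unfolding J_set_def rank_ideal_def by (auto simp: K_iff)

lemma J_upper_free:
  assumes "\<alpha> \<in> J_set n" "x \<in> upper_free \<alpha>"
  shows "upper_free \<alpha> = {x, mate x}"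
proof -
  have K: "\<alpha> \<in> K_set n" and A: "\<alpha> \<in> D" using assms(1) unfolding J_iff K_iff by blast+
  have sub: "{x, mate x} \<subseteq> upper_free \<alpha>" using assms(2) upper_free_mate[OF K] by blast
  have "x \<in> {1..n}" using free_subset(1)[OF A] assms(2) by blast
  then have "mate x \<noteq> x" by simp
  then have "card {x, mate x} = 2" by simp
  moreover have "card (upper_free \<alpha>) \<le> 2" using assms(1) rank_free(1)[OF A] unfolding J_iff by simp
  ultimately show ?thesis using card_seteq[OF finite_free(1)[OF A] sub] by simp
qed

text \<open>An upper block of the product that is new joins two free upper points of \<alpha>. In J
  there are at most two of these and they are mates, so the new block respects \<zeta>. With four
  free points it may fail to, and faithfulness exploits this.\<close>

lemma J_mult:
  assumes J: "\<alpha> \<in> J_set n" and B: "\<beta> \<in> D"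
  shows "\<alpha> \<odot> \<beta> \<in> J_set n"
proof -
  have A: "\<alpha> \<in> D" and K: "\<And>x y. adj \<alpha> (Upper x) (Upper y) \<Longrightarrow> y = mate x"
    using J unfolding J_iff K_iff by blast+
  note AB = mult_closed[OF A B]
  have "y = mate x" if xy: "adj (\<alpha> \<odot> \<beta>) (Upper x) (Upper y)" for x y
  proof (cases "x \<in> upper_free \<alpha>")
    case True
    have y: "y \<in> {1..n}" "x \<noteq> y" using adj_range(2)[OF AB xy] adjD(1)[OF AB xy] by auto
    have "y \<in> upper_free \<alpha>"
    proof (rule ccontr)
      assume "y \<notin> upper_free \<alpha>"
      then obtain z where z: "adj \<alpha> (Upper y) (Upper z)" unfolding upper_free_iff[OF A] using y by blast
      have "z = x" using adj_unique[OF AB mult_Upper_Upper[OF A B z] adj_sym[OF xy]] by simp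
      then have "adj \<alpha> (Upper x) (Upper y)" using adj_sym[OF z] by simp
      then show False using True unfolding upper_free_iff[OF A] by blast
    qed
    then show ?thesis using J_upper_free[OF J True] y by simp
  next
    case False
    then obtain z where z: "adj \<alpha> (Upper x) (Upper z)"
      unfolding upper_free_iff[OF A] using adj_range(1)[OF AB xy] by blast
    have "z = y" using adj_unique[OF AB mult_Upper_Upper[OF A B z] xy] by simp
    then show ?thesis using K[OF z] by simp
  qed
  then have "\<alpha> \<odot> \<beta> \<in> K_set n" unfolding K_iff using AB by blast
  then show ?thesis using J rank_mult_le(1)[OF A B] unfolding J_iff by simp
qed

lemma I_iff: "\<alpha> \<in> I_set n \<longleftrightarrow> \<alpha> \<in> D \<and> (\<exists>x y. adj \<alpha> (Upper x) (Upper y) \<and> y \<noteq> mate x)"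
  unfolding I_set_def using K_iff by auto

lemma I_mult:
  assumes "\<alpha> \<in> I_set n" and B: "\<beta> \<in> D"
  shows "\<alpha> \<odot> \<beta> \<in> I_set n"
  using assms(1) mult_Upper_Upper[OF _ B] mult_closed[OF _ B] unfolding I_iff by blast

lemma zeta_mult_R_zeta: "\<alpha> \<in> D \<Longrightarrow> zeta n \<odot> \<alpha> \<in> R_zeta n"
  unfolding R_zeta_iff
  using mult_closed[OF zeta_closed] mult_Upper_Upper[OF zeta_closed, of \<alpha>] adj_zeta(1) by simp

lemma upper_free_R_zeta:
  assumes "\<alpha> \<in> R_zeta n"
  shows "upper_free \<alpha> = {}"
proof -
  have "\<alpha> \<in> D" using assms unfolding R_zeta_iff by blast
  then show ?thesis using assms upper_free_iff[of \<alpha> n] unfolding R_zeta_iff by blast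
qed

text \<open>Without transversals, upper and lower blocks pass unchanged into the product. So
  \<open>zeta n \<odot> \<alpha>\<close> is a normal form: it leaves the elements of
  \<open>R_zeta\<close> fixed and, by \<open>hat_eq\<close>, separates the classes in J.\<close>

lemma R_zeta_zeta_mult:
  assumes "\<alpha> \<in> R_zeta n"
  shows "zeta n \<odot> \<alpha> = \<alpha>"
proof (rule brauer_eqI_cases[symmetric])
  show A: "\<alpha> \<in> D" using assms unfolding R_zeta_iff by blast
  note Z = zeta_closed
  show "zeta n \<odot> \<alpha> \<in> D" by (rule mult_closed[OF Z A])
  fix x y
  show "adj (zeta n \<odot> \<alpha>) (Upper x) (Upper y)" if xy: "adj \<alpha> (Upper x) (Upper y)"
  proof -
    have x: "x \<in> {1..n}" using adj_range(1)[OF A xy] .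
    then have "y = mate x" using assms adj_unique[OF A xy, of "Upper (mate x)"] unfolding R_zeta_iff by simp
    then show ?thesis using x mult_Upper_Upper[OF Z A] adj_zeta(1) by simp
  qed
  show "adj (zeta n \<odot> \<alpha>) (Upper x) (Lower y)" if "adj \<alpha> (Upper x) (Lower y)"
    using that upper_free_R_zeta[OF assms] unfolding upper_free_def by blast
  show "adj (zeta n \<odot> \<alpha>) (Lower x) (Lower y)" if "adj \<alpha> (Lower x) (Lower y)"
    by (rule mult_Lower_Lower[OF Z A that])
qed

text \<open>Since \<open>\<zeta>\<close> joins the upper ends of the two transversals, \<open>hat\<close> is left multiplication
  by \<open>\<zeta>\<close> on \<open>J\<close>, which turns the compatibility of \<open>\<tau>\<close> into associativity.\<close>

lemma hat_eq:
  assumes J: "\<alpha> \<in> J_set n"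
  shows "hat \<alpha> = zeta n \<odot> \<alpha>"
proof (cases "rank \<alpha> = 2")
  case False
  have K: "\<alpha> \<in> K_set n" and A: "\<alpha> \<in> D" using J unfolding J_iff K_iff by blast+
  have "rank \<alpha> \<le> 2" using J unfolding J_iff by blast
  then have "rank \<alpha> = 0" using False rank_K_even[OF K] by (cases "rank \<alpha> = 1") auto
  then have "upper_free \<alpha> = {}" using rank_free(1)[OF A] finite_free(1)[OF A] by simp
  then have "\<alpha> \<in> R_zeta n" unfolding R_zeta_iff
    using A K upper_free_iff[OF A] unfolding K_iff by blast
  then show ?thesis using R_zeta_zeta_mult False unfolding hat_def by simp
next
  case True
  have K: "\<alpha> \<in> K_set n" and A: "\<alpha> \<in> D" and UU: "\<And>x y. adj \<alpha> (Upper x) (Upper y) \<Longrightarrow> y = mate x"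
    using J unfolding J_iff K_iff by blast+
  note Z = zeta_closed
  note ZA = mult_closed[OF Z A]
  have "upper_free \<alpha> \<noteq> {}" using True rank_free(1)[OF A] by auto
  then obtain a where "a \<in> upper_free \<alpha>" by blast
  then have free: "upper_free \<alpha> = {a, mate a}" and a: "a \<in> {1..n}"
    using J_upper_free[OF J] free_subset(1)[OF A] by blast+
  obtain b where b: "adj \<alpha> (Upper a) (Lower b)" using free unfolding upper_free_def by blast
  obtain c where c: "adj \<alpha> (Upper (mate a)) (Lower c)" using free unfolding upper_free_def by blast
  have T: "transversals \<alpha> = {{Upper a, Lower b}, {Upper (mate a), Lower c}}"
  proof -
    have "{(x, y). adj \<alpha> (Upper x) (Lower y)} = {(a, b), (mate a, c)}"
    proof (intro equalityI subsetI)
      fix p assume "p \<in> {(x, y). adj \<alpha> (Upper x) (Lower y)}"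
      then obtain x y where p: "p = (x, y)" "adj \<alpha> (Upper x) (Lower y)" by blast
      then have "x \<in> upper_free \<alpha>" unfolding upper_free_def by blast
      then consider "x = a" | "x = mate a" unfolding free by blast
      then show "p \<in> {(a, b), (mate a, c)}"
        using adj_unique[OF A b, of "Lower y"] adj_unique[OF A c, of "Lower y"] p by cases auto
    qed (use b c in auto)
    then show ?thesis unfolding transversals_eq[OF A] by simp
  qed
  have "\<Union>(transversals \<alpha>) \<inter> range Upper = {Upper a, Upper (mate a)}"
    "\<Union>(transversals \<alpha>) \<inter> range Lower = {Lower b, Lower c}" unfolding T by auto
  then have hat: "hat \<alpha> = (\<alpha> - transversals \<alpha>) \<union> {{Upper a, Upper (mate a)}, {Lower b, Lower c}}"
    unfolding hat_def using True by simp
  have new: "adj (zeta n \<odot> \<alpha>) (Upper a) (Upper (mate a))" "adj (zeta n \<odot> \<alpha>) (Lower b) (Lower c)"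
  proof -
    show "adj (zeta n \<odot> \<alpha>) (Upper a) (Upper (mate a))" using mult_Upper_Upper[OF Z A] adj_zeta(1) a by simp
    show "adj (zeta n \<odot> \<alpha>) (Lower b) (Lower c)"
      by (rule mult_Lower_Lower_via[OF Z A b _ c]) (use a adj_zeta(2) in simp)
  qed
  have old: "adj (zeta n \<odot> \<alpha>) v w" if vw: "adj \<alpha> v w" "{v, w} \<notin> transversals \<alpha>" for v w
  proof -
    have nt: "\<not> adj \<alpha> (Upper x) (Lower y)" if "{v, w} = {Upper x, Lower y}" for x y
      using vw that unfolding transversals_def adj_def by auto
    have "(\<exists>x y. v = Upper x \<and> w = Upper y) \<or> (\<exists>x y. v = Lower x \<and> w = Lower y)"
      using adjD(2,3)[OF A vw(1)] nt vw(1) adj_sym[OF vw(1)]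
      by (cases v; cases w) (auto simp: insert_commute)
    then show ?thesis
    proof (elim disjE exE conjE)
      fix x y assume e: "v = Upper x" "w = Upper y"
      have "x \<in> {1..n}" "y = mate x" using vw(1) UU adj_range(1)[OF A] unfolding e by blast+
      then show ?thesis unfolding e using mult_Upper_Upper[OF Z A] adj_zeta(1) by simp
    next
      fix x y assume e: "v = Lower x" "w = Lower y"
      show ?thesis using vw(1) unfolding e by (rule mult_Lower_Lower[OF Z A])
    qed
  qed
  show ?thesis
  proof (intro equalityI subsetI)
    fix B assume "B \<in> hat \<alpha>"
    then consider "B \<in> \<alpha>" "B \<notin> transversals \<alpha>" | "B = {Upper a, Upper (mate a)}" | "B = {Lower b, Lower c}"
      unfolding hat by blast
    then show "B \<in> zeta n \<odot> \<alpha>"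
    proof cases
      case 1
      obtain v w where vw: "B = {v, w}" by (rule perfect_matching_block[OF brauer_diagramsD[OF A] 1(1)])
      show ?thesis using old[of v w] 1 unfolding vw adj_def by blast
    qed (use new in \<open>simp_all add: adj_def\<close>)
  next
    fix B assume B: "B \<in> zeta n \<odot> \<alpha>"
    obtain v w where vw: "B = {v, w}" by (rule perfect_matching_block[OF brauer_diagramsD[OF ZA] B])
    then have adj: "adj (zeta n \<odot> \<alpha>) v w" using B unfolding adj_def by simp
    then have "v \<in> vertices n" using adjD[OF ZA] by blast
    then obtain v' where v': "adj \<alpha> v v'" using adj_ex[OF A] by blast
    show "B \<in> hat \<alpha>"
    proof (cases "{v, v'} \<in> transversals \<alpha>")
      case False
      then have "w = v'" using old[OF v'] adj_unique[OF ZA adj] by blast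
      then show ?thesis unfolding hat vw using v' False unfolding adj_def by blast
    next
      case True
      then have "v \<in> {Upper a, Lower b, Upper (mate a), Lower c}" unfolding T by (auto simp: doubleton_eq_iff)
      then have "{v, w} = {Upper a, Upper (mate a)} \<or> {v, w} = {Lower b, Lower c}"
        using new new[THEN adj_sym] adj_unique[OF ZA adj] by (auto simp: insert_commute)
      then show ?thesis unfolding hat vw by blast
    qed
  qed
qed

subsection \<open>The stabilizer \<open>U\<close>\<close>

interpretation B: monoid "brauer n"
  by (rule monoid_brauer)

lemma U_closed: "u \<in> U_grp n \<Longrightarrow> u \<in> D"
  unfolding U_grp_def Units_def by simp

lemma U_one: "identity n \<in> U_grp n"
  unfolding U_grp_def using B.Units_one_closed identity_left[OF zeta_closed] by simp

lemma U_mult: "u \<in> U_grp n \<Longrightarrow> v \<in> U_grp n \<Longrightarrow> u \<odot> v \<in> U_grp n"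
  using U_closed[of u] U_closed[of v] B.Units_m_closed[of u v] zeta_closed
  unfolding U_grp_def by (auto simp: mult_assoc)

lemma U_inv:
  assumes "u \<in> U_grp n"
  obtains v where "v \<in> U_grp n" "u \<odot> v = identity n" "v \<odot> u = identity n"
proof -
  have u: "u \<in> Units (brauer n)" "u \<odot> zeta n = zeta n" "u \<in> D" using assms U_closed unfolding U_grp_def by auto
  let ?v = "inv\<^bsub>brauer n\<^esub> u"
  have v: "?v \<in> Units (brauer n)" "?v \<in> D" "u \<odot> ?v = identity n" "?v \<odot> u = identity n"
    using u(1) B.Units_inv_Units B.Units_inv_closed B.Units_r_inv B.Units_l_inv by force+
  have "?v \<odot> zeta n = ?v \<odot> (u \<odot> zeta n)" using u(2) by simp
  also have "\<dots> = zeta n" using mult_assoc[OF v(2) u(3) zeta_closed] v(4) identity_left[OF zeta_closed] by simp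
  finally have "?v \<in> U_grp n" unfolding U_grp_def using v by simp
  then show thesis using that v by blast
qed

text \<open>Tracing \<open>x\<close> through \<open>u \<odot> zeta n\<close> leads to the preimage
  under \<pi> of \<open>mate (\<pi> x)\<close>; in \<zeta> the partner of \<open>x\<close> is
  \<open>mate x\<close>. So U consists of permutations that preserve the pairs {2i-1, 2i}.\<close>

lemma U_perm:
  assumes "u \<in> U_grp n"
  obtains \<pi> where "\<pi> permutes {1..n}" "u = perm_diagram n \<pi>" "\<And>x. x \<in> {1..n} \<Longrightarrow> \<pi> (mate x) = mate (\<pi> x)"
proof -
  have "u \<in> Units (brauer n)" and uz: "u \<odot> zeta n = zeta n" using assms unfolding U_grp_def by auto
  then obtain \<pi> where \<pi>: "\<pi> permutes {1..n}" "u = perm_diagram n \<pi>" by (blast elim: Units_perm_diagram)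
  note u = perm_diagram_closed[OF \<pi>(1)]
  have "\<pi> (mate x) = mate (\<pi> x)" if x: "x \<in> {1..n}" for x
  proof -
    have px: "\<pi> x \<in> {1..n}" using permutes_in_image[OF \<pi>(1)] x by blast
    let ?w = "inv_into UNIV \<pi> (mate (\<pi> x))"
    have "adj (perm_diagram n \<pi> \<odot> zeta n) (Upper x) (Upper ?w)"
    proof (rule mult_Upper_Upper_via[OF u zeta_closed adj_perm_Upper[OF \<pi>(1) x]])
      show "adj (zeta n) (Upper (\<pi> x)) (Upper (mate (\<pi> x)))" using px adj_zeta(1) by simp
      show "adj (perm_diagram n \<pi>) (Upper ?w) (Lower (mate (\<pi> x)))"
        by (rule adj_perm_Lower[OF \<pi>(1) mate_in[OF px]])
    qed
    then have "adj (zeta n) (Upper x) (Upper ?w)" using uz unfolding \<pi>(2) by simp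
    then have "?w = mate x" unfolding adj_zeta by simp
    then show ?thesis using permutes_inverses(1)[OF \<pi>(1), of "mate (\<pi> x)"] by simp
  qed
  then show thesis using that \<pi> by blast
qed

text \<open>Commuting with \<open>mate\<close> also preserves the lower blocks of \<zeta>. Thus a
  left stabilizer is a right stabilizer, and translating an element of J by U does not change its
  \<open>hat\<close>.\<close>

lemma zeta_U:
  assumes "u \<in> U_grp n"
  shows "zeta n \<odot> u = zeta n"
proof -
  obtain \<pi> where \<pi>: "\<pi> permutes {1..n}" and u: "u = perm_diagram n \<pi>"
    and comm: "\<And>x. x \<in> {1..n} \<Longrightarrow> \<pi> (mate x) = mate (\<pi> x)" by (rule U_perm[OF assms]) blast
  note Z = zeta_closed and P = perm_diagram_closed[OF \<pi>]
  have "zeta n = zeta n \<odot> perm_diagram n \<pi>"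
  proof (rule brauer_eqI_cases[OF Z mult_closed[OF Z P]])
    fix x y
    show "adj (zeta n \<odot> perm_diagram n \<pi>) (Upper x) (Upper y)" if "adj (zeta n) (Upper x) (Upper y)"
      by (rule mult_Upper_Upper[OF Z P that])
    show "adj (zeta n \<odot> perm_diagram n \<pi>) (Upper x) (Lower y)" if "adj (zeta n) (Upper x) (Lower y)"
      using that unfolding adj_zeta by simp
    show "adj (zeta n \<odot> perm_diagram n \<pi>) (Lower x) (Lower y)" if "adj (zeta n) (Lower x) (Lower y)"
    proof -
      have x: "x \<in> {1..n}" "y = mate x" using that unfolding adj_zeta by auto
      let ?a = "inv_into UNIV \<pi> x"
      have a: "?a \<in> {1..n}" "\<pi> ?a = x"
        using permutes_in_image[OF permutes_inv[OF \<pi>]] permutes_inverses(1)[OF \<pi>] x by auto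
      have "\<pi> (mate ?a) = y" using comm[OF a(1)] a(2) x(2) by simp
      then have y: "adj (perm_diagram n \<pi>) (Upper (mate ?a)) (Lower y)"
        using adj_perm_Upper[OF \<pi> mate_in[OF a(1)]] by simp
      show ?thesis
        by (rule mult_Lower_Lower_via[OF Z P adj_perm_Lower[OF \<pi> x(1)] _ y]) (use a adj_zeta(2) in simp)
    qed
  qed
  then show ?thesis unfolding u by simp
qed

lemma U_coset: "U_grp n #>\<^bsub>brauer n\<^esub> \<alpha> = (\<lambda>u. u \<odot> \<alpha>) ` U_grp n"
  unfolding r_coset_def by auto

lemma U_coset_mult:
  assumes "u \<in> U_grp n" and A: "\<alpha> \<in> D"
  shows "U_grp n #>\<^bsub>brauer n\<^esub> (u \<odot> \<alpha>) = U_grp n #>\<^bsub>brauer n\<^esub> \<alpha>"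
  unfolding U_coset
proof (intro equalityI subsetI)
  note u = U_closed[OF assms(1)]
  fix \<gamma> assume "\<gamma> \<in> (\<lambda>w. w \<odot> (u \<odot> \<alpha>)) ` U_grp n"
  then obtain w where w: "w \<in> U_grp n" "\<gamma> = w \<odot> (u \<odot> \<alpha>)" by blast
  then have "\<gamma> = (w \<odot> u) \<odot> \<alpha>" using mult_assoc[OF U_closed[OF w(1)] u A] by simp
  then show "\<gamma> \<in> (\<lambda>w. w \<odot> \<alpha>) ` U_grp n" using U_mult[OF w(1) assms(1)] by blast
next
  note u = U_closed[OF assms(1)]
  obtain v where v: "v \<in> U_grp n" "u \<odot> v = identity n" "v \<odot> u = identity n" by (rule U_inv[OF assms(1)])
  fix \<gamma> assume "\<gamma> \<in> (\<lambda>w. w \<odot> \<alpha>) ` U_grp n"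
  then obtain w where w: "w \<in> U_grp n" "\<gamma> = w \<odot> \<alpha>" by blast
  note v' = U_closed[OF v(1)] and w' = U_closed[OF w(1)]
  have "(w \<odot> v) \<odot> (u \<odot> \<alpha>) = w \<odot> (v \<odot> (u \<odot> \<alpha>))" by (rule mult_assoc[OF w' v' mult_closed[OF u A]])
  also have "v \<odot> (u \<odot> \<alpha>) = \<alpha>" using mult_assoc[OF v' u A] v(3) identity_left[OF A] by simp
  finally have "\<gamma> = (w \<odot> v) \<odot> (u \<odot> \<alpha>)" using w(2) by simp
  then show "\<gamma> \<in> (\<lambda>w. w \<odot> (u \<odot> \<alpha>)) ` U_grp n" using U_mult[OF w(1) v(1)] by blast
qed

lemma U_K_imp:
  assumes "u \<in> U_grp n" and A: "\<alpha> \<in> D" and "u \<odot> \<alpha> \<in> K_set n"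
  shows "\<alpha> \<in> K_set n"
proof -
  obtain \<pi> where \<pi>: "\<pi> permutes {1..n}" and u: "u = perm_diagram n \<pi>"
    and comm: "\<And>x. x \<in> {1..n} \<Longrightarrow> \<pi> (mate x) = mate (\<pi> x)" by (rule U_perm[OF assms(1)]) blast
  note P = perm_diagram_closed[OF \<pi>]
  have "y = mate x" if xy: "adj \<alpha> (Upper x) (Upper y)" for x y
  proof -
    let ?a = "inv_into UNIV \<pi> x" and ?b = "inv_into UNIV \<pi> y"
    have x: "x \<in> {1..n}" and y: "y \<in> {1..n}" using adj_range[OF A] xy by blast+
    have a: "?a \<in> {1..n}" "\<pi> ?a = x"
      using permutes_in_image[OF permutes_inv[OF \<pi>]] permutes_inverses(1)[OF \<pi>] x by auto
    have "adj (u \<odot> \<alpha>) (Upper ?a) (Upper ?b)"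
      unfolding u using mult_Upper_Upper_via[OF P A adj_perm_Lower[OF \<pi> x] xy adj_perm_Lower[OF \<pi> y]] .
    then have "?b = mate ?a" using assms(3) unfolding K_iff by blast
    then have "y = \<pi> (mate ?a)" using permutes_inverses(1)[OF \<pi>, of y] by simp
    then show ?thesis using comm[OF a(1)] a(2) by simp
  qed
  then show ?thesis using A unfolding K_iff by blast
qed

text \<open>Translation by U preserves K and, being invertible, the rank; so it preserves each of
  the three parts. On I there is nothing to compare, on J \<open>zeta_U\<close> applies, and on the
  rest the cosets agree.\<close>

lemma tau_U:
  assumes uU: "u \<in> U_grp n" and A: "\<alpha> \<in> D"
  shows "(\<alpha>, u \<odot> \<alpha>) \<in> tau n"
proof -
  note u = U_closed[OF uU]
  note uA = mult_closed[OF u A]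
  obtain v where v: "v \<in> U_grp n" "u \<odot> v = identity n" "v \<odot> u = identity n" by (rule U_inv[OF uU])
  note v' = U_closed[OF v(1)]
  have vu: "v \<odot> (u \<odot> \<alpha>) = \<alpha>" using mult_assoc[OF v' u A] v(3) identity_left[OF A] by simp
  have K: "\<alpha> \<in> K_set n \<longleftrightarrow> u \<odot> \<alpha> \<in> K_set n"
    using U_K_imp[OF uU A] U_K_imp[OF v(1) uA] vu by auto
  have "rank \<alpha> = rank (u \<odot> \<alpha>)" using rank_mult_le(2)[OF u A] rank_mult_le(2)[OF v' uA] vu by simp
  then have J: "\<alpha> \<in> J_set n \<longleftrightarrow> u \<odot> \<alpha> \<in> J_set n" using K unfolding J_iff by simp
  have hat: "hat \<alpha> = hat (u \<odot> \<alpha>)" if "\<alpha> \<in> J_set n"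
  proof -
    have "zeta n \<odot> (u \<odot> \<alpha>) = zeta n \<odot> \<alpha>" using mult_assoc[OF zeta_closed u A] zeta_U[OF uU] by simp
    then show ?thesis using that J hat_eq by simp
  qed
  consider "\<alpha> \<in> I_set n" | "\<alpha> \<in> J_set n" | "\<alpha> \<in> K_set n - J_set n" using A unfolding I_set_def by auto
  then show ?thesis
  proof cases
    case 1
    then have "u \<odot> \<alpha> \<in> I_set n" using K uA unfolding I_set_def by simp
    then show ?thesis using 1 unfolding tau_def by simp
  next
    case 2
    then show ?thesis using J hat unfolding tau_def by simp
  next
    case 3
    then show ?thesis using J K U_coset_mult[OF uU A] unfolding tau_def by simp
  qed
qed

lemma tau_equiv: "equiv D (tau n)"
proof (rule equivI)
  have D: "D = I_set n \<union> J_set n \<union> (K_set n - J_set n)" "I_set n \<inter> K_set n = {}" "J_set n \<subseteq> K_set n"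
    unfolding I_set_def J_iff K_set_def J_set_def by auto
  show "refl_on D (tau n)" unfolding refl_on_def tau_def using D(1) by blast
  show "tau n \<subseteq> D \<times> D" unfolding tau_def using D(1) by blast
  show "sym (tau n)" unfolding sym_def tau_def by auto
  show "trans (tau n)" unfolding trans_def tau_def using D(2,3) by auto
qed

text \<open>In the coset case multiplication by \<gamma> may carry the elements into J or I. The
  products are still translates of each other under U, and \<open>tau_U\<close> covers all three
  parts, so it does not matter where they land.\<close>

lemma tau_mult:
  assumes ab: "(\<alpha>, \<beta>) \<in> tau n" and C: "\<gamma> \<in> D"
  shows "(\<alpha> \<odot> \<gamma>, \<beta> \<odot> \<gamma>) \<in> tau n"
proof -
  have A: "\<alpha> \<in> D" and B: "\<beta> \<in> D" using equiv_type[OF tau_equiv] ab by blast+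
  consider "\<alpha> \<in> I_set n" "\<beta> \<in> I_set n" | "\<alpha> \<in> J_set n" "\<beta> \<in> J_set n" "hat \<alpha> = hat \<beta>"
    | "U_grp n #>\<^bsub>brauer n\<^esub> \<alpha> = U_grp n #>\<^bsub>brauer n\<^esub> \<beta>" using ab unfolding tau_def by blast
  then show ?thesis
  proof cases
    case 1
    then show ?thesis using I_mult[OF _ C] unfolding tau_def by simp
  next
    case 2
    then have "zeta n \<odot> \<alpha> = zeta n \<odot> \<beta>" by (simp add: hat_eq)
    then have "zeta n \<odot> (\<alpha> \<odot> \<gamma>) = zeta n \<odot> (\<beta> \<odot> \<gamma>)"
      using mult_assoc[OF zeta_closed A C] mult_assoc[OF zeta_closed B C] by simp
    then have "hat (\<alpha> \<odot> \<gamma>) = hat (\<beta> \<odot> \<gamma>)" using J_mult[OF 2(1) C] J_mult[OF 2(2) C] hat_eq by simp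
    then show ?thesis using J_mult[OF 2(1) C] J_mult[OF 2(2) C] unfolding tau_def by simp
  next
    case 3
    have "\<beta> \<in> (\<lambda>u. u \<odot> \<beta>) ` U_grp n" using U_one identity_left[OF B] by (metis image_eqI)
    then have "\<beta> \<in> (\<lambda>u. u \<odot> \<alpha>) ` U_grp n" using 3 unfolding U_coset by simp
    then obtain u where u: "u \<in> U_grp n" "\<beta> = u \<odot> \<alpha>" by blast
    then have "\<beta> \<odot> \<gamma> = u \<odot> (\<alpha> \<odot> \<gamma>)" using mult_assoc[OF U_closed[OF u(1)] A C] by simp
    then show ?thesis using tau_U[OF u(1) mult_closed[OF A C]] by simp
  qed
qed

lemma tau_class_eq_iff: "\<alpha> \<in> D \<Longrightarrow> \<beta> \<in> D \<Longrightarrow> tau_class n \<alpha> = tau_class n \<beta> \<longleftrightarrow> (\<alpha>, \<beta>) \<in> tau n"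
  unfolding tau_class_def by (rule eq_equiv_class_iff[OF tau_equiv])

lemma mu2_class:
  assumes A: "\<alpha> \<in> D" and B: "\<beta> \<in> D"
  shows "mu2 n (tau_class n \<alpha>) \<beta> = tau_class n (\<alpha> \<odot> \<beta>)"
proof -
  have "tau_class n (\<gamma> \<odot> \<beta>) = tau_class n (\<alpha> \<odot> \<beta>)" if "\<gamma> \<in> tau_class n \<alpha>" for \<gamma>
  proof -
    have "(\<alpha>, \<gamma>) \<in> tau n" "\<gamma> \<in> D" using that equiv_type[OF tau_equiv] unfolding tau_class_def by blast+
    then show ?thesis using tau_mult[OF _ B] tau_class_eq_iff mult_closed[OF _ B] A by metis
  qed
  moreover have "\<alpha> \<in> tau_class n \<alpha>" using tau_class_eq_iff[OF A A] unfolding tau_class_def by simp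
  ultimately have "(\<lambda>\<gamma>. tau_class n (\<gamma> \<odot> \<beta>)) ` tau_class n \<alpha> = {tau_class n (\<alpha> \<odot> \<beta>)}" by blast
  then show ?thesis unfolding mu2_def brauer_simps by simp
qed

section \<open>The action on the push-out\<close>

definition points :: "(diagram + diagram set) set" where
  "points = Omega1 n <+> Omega2 n"

text \<open>A canonical representative of each identified pair, on the side of
  \<open>Omega2\<close>. It turns the generated equivalence into an equality of values.\<close>

definition glue :: "diagram + diagram set \<Rightarrow> diagram + diagram set" where
  "glue u = (case u of Inl \<alpha> \<Rightarrow> if \<alpha> \<in> R_zeta n then Inr (tau_class n \<alpha>) else Inl \<alpha> | Inr C \<Rightarrow> Inr C)"

definition act :: "diagram + diagram set \<Rightarrow> diagram \<Rightarrow> diagram + diagram set" where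
  "act u \<beta> = (case u of Inl \<alpha> \<Rightarrow> Inl (mu1 n \<alpha> \<beta>) | Inr C \<Rightarrow> Inr (mu2 n C \<beta>))"

definition point_class :: "diagram + diagram set \<Rightarrow> (diagram + diagram set) set" where
  "point_class u = pushout_rel n `` {u}"

text \<open>A generating pair has equal values under \<open>glue\<close>, and every point is joined
  to its value by at most one generating pair.\<close>

lemma pushout_rel_iff: "(u, v) \<in> pushout_rel n \<longleftrightarrow> u \<in> points \<and> v \<in> points \<and> glue u = glue v"
proof -
  let ?R = "\<lambda>x y. \<exists>\<alpha>\<in>R_zeta n. x = Inl \<alpha> \<and> y = Inr (tau_class n \<alpha>)"
  have "glue u = glue v" if "equivclp ?R u v"
    using that
  proof (induction rule: equivclp_induct)
    case (step y z)
    then have "glue y = glue z" unfolding glue_def by auto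
    then show ?case using step.IH by simp
  qed simp
  moreover have glue: "equivclp ?R w (glue w)" for w
    unfolding glue_def by (cases w) (auto intro: r_into_equivclp)
  have "equivclp ?R u v" if "glue u = glue v"
    using equivclp_trans[OF glue equivclp_sym[OF glue[of v], folded that]] .
  ultimately show ?thesis unfolding pushout_rel_def points_def by auto
qed

lemma pushout_equiv: "equiv points (pushout_rel n)"
  by (rule equivI) (auto simp: refl_on_def sym_def trans_def pushout_rel_iff)

lemma point_class_eq_iff:
  "u \<in> points \<Longrightarrow> v \<in> points \<Longrightarrow> point_class u = point_class v \<longleftrightarrow> glue u = glue v"
  unfolding point_class_def using eq_equiv_class_iff[OF pushout_equiv] pushout_rel_iff by simp

lemma Omega_eq: "Omega n = point_class ` points"
  unfolding Omega_def quotient_def point_class_def points_def by auto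

section \<open>\<open>R_zeta\<close> inside J, and the compatibility of the gluing with the two
  actions\<close>

lemma R_zeta_J:
  assumes "\<alpha> \<in> R_zeta n"
  shows "\<alpha> \<in> J_set n" "rank \<alpha> = 0"
proof -
  have A: "\<alpha> \<in> D" using assms unfolding R_zeta_iff by blast
  show rank: "rank \<alpha> = 0" using rank_free(1)[OF A] upper_free_R_zeta[OF assms] by simp
  have "y = mate x" if xy: "adj \<alpha> (Upper x) (Upper y)" for x y
    using assms adj_range(1)[OF A xy] adj_unique[OF A xy, of "Upper (mate x)"] unfolding R_zeta_iff by simp
  then show "\<alpha> \<in> J_set n" unfolding J_iff K_iff using A rank by simp
qed

lemma tau_J:
  assumes "(\<alpha>, \<beta>) \<in> tau n" "\<alpha> \<in> J_set n"
  shows "\<beta> \<in> J_set n" "zeta n \<odot> \<alpha> = zeta n \<odot> \<beta>"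
proof -
  have "\<alpha> \<notin> I_set n" using assms(2) unfolding I_set_def J_iff by blast
  then have b: "\<beta> \<in> J_set n" "hat \<alpha> = hat \<beta>" using assms unfolding tau_def by auto
  then show "\<beta> \<in> J_set n" "zeta n \<odot> \<alpha> = zeta n \<odot> \<beta>" using hat_eq assms(2) by simp_all
qed

text \<open>On J the relation \<tau> compares \<open>zeta n \<odot> \<alpha>\<close>, which on
  \<open>R_zeta\<close> is \<alpha> itself. This is the injectivity of \<xi>; consequently the
  gluing never merges two points of \<open>Omega1\<close>.\<close>

lemma tau_class_R_zeta_inj:
  assumes "\<alpha> \<in> R_zeta n" "\<beta> \<in> R_zeta n" "tau_class n \<alpha> = tau_class n \<beta>"
  shows "\<alpha> = \<beta>"
proof -
  have "\<alpha> \<in> D" "\<beta> \<in> D" using assms(1,2) unfolding R_zeta_iff by blast+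
  then have "(\<alpha>, \<beta>) \<in> tau n" using assms(3) tau_class_eq_iff by blast
  then have "zeta n \<odot> \<alpha> = zeta n \<odot> \<beta>" using tau_J(2) R_zeta_J(1)[OF assms(1)] by blast
  then show ?thesis using R_zeta_zeta_mult assms(1,2) by simp
qed

lemma glue_Inl_eq: "glue (Inl \<alpha>) = glue (Inl \<beta>) \<Longrightarrow> \<alpha> = \<beta>"
  unfolding glue_def using tau_class_R_zeta_inj by (auto split: if_splits)

lemma Omega1_mult: "\<alpha> \<in> Omega1 n \<Longrightarrow> \<beta> \<in> D \<Longrightarrow> \<alpha> \<odot> \<beta> \<in> Omega1 n"
  unfolding Omega1_iff using mult_closed mult_Upper_Upper by blast

lemma R_zeta_mult: "\<alpha> \<in> R_zeta n \<Longrightarrow> \<beta> \<in> D \<Longrightarrow> \<alpha> \<odot> \<beta> \<in> R_zeta n"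
  unfolding R_zeta_iff using mult_closed mult_Upper_Upper by blast

lemma rank_ideal_mult: "\<alpha> \<in> rank_ideal n r \<Longrightarrow> \<beta> \<in> D \<Longrightarrow> \<alpha> \<odot> \<beta> \<in> rank_ideal n r"
  unfolding rank_ideal_def using mult_closed rank_mult_le(1) le_trans by fastforce

lemma pointsE:
  assumes "u \<in> points"
  obtains \<alpha> where "\<alpha> \<in> Omega1 n" "\<alpha> \<in> D" "u = Inl \<alpha>"
    | \<alpha> where "\<alpha> \<in> rank_ideal n 4" "\<alpha> \<in> D" "u = Inr (tau_class n \<alpha>)"
proof -
  have "Omega1 n \<subseteq> D" "rank_ideal n 4 \<subseteq> D" using Omega1_iff unfolding rank_ideal_def by auto
  note D = subsetD[OF this(1)] subsetD[OF this(2)] and result = that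
  consider \<alpha> where "\<alpha> \<in> Omega1 n" "u = Inl \<alpha>" | \<alpha> where "\<alpha> \<in> rank_ideal n 4" "u = Inr (tau_class n \<alpha>)"
    using assms unfolding points_def Omega2_def by blast
  then show thesis
  proof cases
    case 1
    show ?thesis by (rule result(1)[OF 1(1) D(1)[OF 1(1)] 1(2)])
  next
    case 2
    show ?thesis by (rule result(2)[OF 2(1) D(2)[OF 2(1)] 2(2)])
  qed
qed

lemma act_simps:
  "act (Inl \<alpha>) \<beta> = Inl (\<alpha> \<odot> \<beta>)"
  "\<alpha> \<in> D \<Longrightarrow> \<beta> \<in> D \<Longrightarrow> act (Inr (tau_class n \<alpha>)) \<beta> = Inr (tau_class n (\<alpha> \<odot> \<beta>))"
  by (simp_all add: act_def mu1_def mu2_class)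

lemma act_points:
  assumes "u \<in> points" "\<beta> \<in> D"
  shows "act u \<beta> \<in> points"
  using assms(1)
proof (cases rule: pointsE)
  case (1 \<alpha>)
  then show ?thesis using Omega1_mult[OF 1(1) assms(2)] by (auto simp: act_simps points_def)
next
  case (2 \<alpha>)
  then show ?thesis using rank_ideal_mult[OF 2(1) assms(2)] assms(2) by (auto simp: act_simps points_def Omega2_def)
qed

text \<open>The map \<xi> respects the actions: \<open>R_zeta\<close> is closed under right
  multiplication, and gluing before or after multiplying gives the class of the same
  product.\<close>

lemma glue_act:
  assumes "u \<in> points" "\<beta> \<in> D"
  shows "glue (act u \<beta>) = glue (act (glue u) \<beta>)"
  using assms(1)
proof (cases rule: pointsE)
  case (1 \<alpha>)
  then show ?thesis using R_zeta_mult[of \<alpha> \<beta>] assms(2) by (simp add: glue_def act_simps)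
next
  case (2 \<alpha>)
  then show ?thesis by (simp add: glue_def)
qed

lemma mu_point_class:
  assumes u: "u \<in> points" and B: "\<beta> \<in> D"
  shows "mu n (point_class u) \<beta> = point_class (act u \<beta>)"
proof -
  have eq: "point_class (act v \<beta>) = point_class (act u \<beta>)" if "v \<in> point_class u" for v
  proof -
    have v: "v \<in> points" "glue u = glue v" using that pushout_rel_iff[of u v] unfolding point_class_def by auto
    have "glue (act v \<beta>) = glue (act u \<beta>)" using glue_act[OF u B] glue_act[OF v(1) B] v(2) by simp
    then show ?thesis using point_class_eq_iff[OF act_points[OF v(1) B] act_points[OF u B]] by blast
  qed
  have "u \<in> point_class u" using u unfolding point_class_def by (simp add: pushout_rel_iff)
  then have "(\<lambda>v. point_class (act v \<beta>)) ` point_class u = {point_class (act u \<beta>)}" using eq by blast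
  moreover have "mu n (point_class u) \<beta> = \<Union>((\<lambda>v. point_class (act v \<beta>)) ` point_class u)"
    unfolding mu_def act_def point_class_def by simp
  ultimately show ?thesis by simp
qed

lemma act_act:
  assumes "u \<in> points" "\<beta> \<in> D" "\<gamma> \<in> D"
  shows "act (act u \<beta>) \<gamma> = act u (\<beta> \<odot> \<gamma>)"
  using assms(1)
  by (cases rule: pointsE)
    (simp_all add: act_simps mult_assoc[OF _ assms(2,3)] mult_closed[OF _ assms(2)] mult_closed[OF assms(2,3)] assms(2,3))

lemma right_action_mu: "right_action (brauer n) (Omega n) (mu n)"
  unfolding right_action_def Omega_eq
  by (auto simp: mu_point_class act_points act_act mult_closed)

subsection \<open>Faithfulness\<close>

lemma extend_to_permutation:
  assumes X: "finite X" and A: "A \<subseteq> X" and f: "inj_on f A" "f ` A \<subseteq> X"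
  obtains \<pi> where "\<pi> permutes X" "\<And>x. x \<in> A \<Longrightarrow> \<pi> x = f x"
proof -
  have "card (X - A) = card (X - f ` A)"
    using card_image[OF f(1)] card_Diff_subset[of A X] card_Diff_subset[of "f ` A" X] A f(2) X
    by (simp add: finite_subset)
  then obtain g where g: "bij_betw g (X - A) (X - f ` A)"
    using finite_same_card_bij[of "X - A" "X - f ` A"] X by auto
  define \<pi> where "\<pi> = (\<lambda>x. if x \<in> A then f x else if x \<in> X then g x else x)"
  have "bij_betw \<pi> A (f ` A)" unfolding \<pi>_def using f(1) by (simp add: bij_betw_def cong: image_cong inj_on_cong)
  moreover have "bij_betw \<pi> (X - A) (X - f ` A)"
    using g by (rule bij_betw_cong[THEN iffD1, rotated]) (simp add: \<pi>_def)
  ultimately have "bij_betw \<pi> (A \<union> (X - A)) (f ` A \<union> (X - f ` A))" by (rule bij_betw_combine) blast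
  moreover have "A \<union> (X - A) = X" "f ` A \<union> (X - f ` A) = X" using A f(2) by blast+
  ultimately have "\<pi> permutes X" by (intro bij_imp_permutes) (use A in \<open>auto simp: \<pi>_def\<close>)
  then show thesis using that[of \<pi>] by (simp add: \<pi>_def)
qed

lemma theta_perm:
  assumes r: "even r" "r \<le> n" and x: "x \<in> {1..n}" and \<pi>: "\<pi> permutes {1..n}"
  shows "theta n r \<odot> perm_diagram n \<pi> \<in> D"
    and "x \<le> r \<Longrightarrow> adj (theta n r \<odot> perm_diagram n \<pi>) (Upper x) (Lower (\<pi> x))"
    and "r < x \<Longrightarrow> adj (theta n r \<odot> perm_diagram n \<pi>) (Upper x) (Upper (mate x))"
proof -
  note T = theta_closed[OF r(1)] and P = perm_diagram_closed[OF \<pi>]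
  show "theta n r \<odot> perm_diagram n \<pi> \<in> D" by (rule mult_closed[OF T P])
  show "adj (theta n r \<odot> perm_diagram n \<pi>) (Upper x) (Lower (\<pi> x))" if "x \<le> r"
    by (rule mult_Upper_Lower[OF T P _ adj_perm_Upper[OF \<pi> x]]) (use that x adj_theta[OF r(1)] in simp)
  show "adj (theta n r \<odot> perm_diagram n \<pi>) (Upper x) (Upper (mate x))" if "r < x"
    by (rule mult_Upper_Upper[OF T P]) (use that x adj_theta[OF r(1)] in simp)
qed

text \<open>The element is \<gamma> followed by a permutation taking 1 and 2 to \<open>i\<close> and
  \<open>j\<close>; it serves to probe an unknown diagram at these two points.\<close>

lemma Omega1_through:
  assumes "i \<in> {1..n}" "j \<in> {1..n}" "i \<noteq> j"
  obtains \<alpha> where "\<alpha> \<in> Omega1 n" "adj \<alpha> (Upper 1) (Lower i)" "adj \<alpha> (Upper 2) (Lower j)"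
proof -
  let ?f = "\<lambda>x. if x = 1 then i else j"
  obtain \<pi> where \<pi>: "\<pi> permutes {1..n}" "\<And>x. x \<in> {1, 2} \<Longrightarrow> \<pi> x = ?f x"
    by (rule extend_to_permutation[of "{1..n}" "{1, 2}" ?f]) (use assms n_ge in \<open>auto simp: inj_on_def\<close>)
  have r: "even 2" "2 \<le> n" using n_ge by simp_all
  note t = theta_perm[OF r _ \<pi>(1)]
  show thesis
  proof (rule that)
    show "theta n 2 \<odot> perm_diagram n \<pi> \<in> Omega1 n" unfolding Omega1_iff using t(1)[of 1] t(3) n_ge by simp
    show "adj (theta n 2 \<odot> perm_diagram n \<pi>) (Upper 1) (Lower i)" using t(2)[of 1] \<pi>(2)[of 1] n_ge by simp
    show "adj (theta n 2 \<odot> perm_diagram n \<pi>) (Upper 2) (Lower j)" using t(2)[of 2] \<pi>(2)[of 2] n_ge by simp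
  qed
qed

lemma other_index:
  assumes "i \<in> {1..n}"
  obtains j where "j \<in> {1..n}" "i \<noteq> j"
proof (cases "i = 1")
  case True
  then show thesis using that[of 2] n_ge by simp
next
  case False
  then show thesis using that[of 1] n_ge by simp
qed

text \<open>A probe entering at \<open>i\<close> turns the transversal of \<beta> into one from 1 to
  \<open>x\<close>. If \<gamma> had an upper block \<open>{i, l}\<close>, letting the second
  transversal of the probe enter at \<open>l\<close> would join 1 to 2 instead; so \<gamma> has a
  transversal at \<open>i\<close>, and its lower end can be read off.\<close>

lemma same_transversals:
  assumes B: "\<beta> \<in> D" and C: "\<gamma> \<in> D" and eq: "\<And>\<alpha>. \<alpha> \<in> Omega1 n \<Longrightarrow> \<alpha> \<odot> \<beta> = \<alpha> \<odot> \<gamma>"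
    and t: "adj \<beta> (Upper i) (Lower x)"
  shows "adj \<gamma> (Upper i) (Lower x)"
proof -
  have i: "i \<in> {1..n}" using adj_range(1)[OF B t] .
  show ?thesis using C i
  proof (cases rule: Upper_partner)
    case (1 l)
    have l: "l \<in> {1..n}" "i \<noteq> l" using adj_range(2)[OF C 1] adjD(1)[OF C 1] by auto
    obtain \<alpha> where \<alpha>: "\<alpha> \<in> Omega1 n" "adj \<alpha> (Upper 1) (Lower i)" "adj \<alpha> (Upper 2) (Lower l)"
      by (rule Omega1_through[OF i l])
    have A: "\<alpha> \<in> D" using \<alpha>(1) unfolding Omega1_iff by blast
    have "adj (\<alpha> \<odot> \<gamma>) (Upper 1) (Lower x)"
      using mult_Upper_Lower[OF A B \<alpha>(2) t] eq[OF \<alpha>(1)] by simp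
    then show ?thesis
      using adj_unique[OF mult_closed[OF A C] mult_Upper_Upper_via[OF A C \<alpha>(2) 1 \<alpha>(3)]] by blast
  next
    case (2 z)
    obtain j where j: "j \<in> {1..n}" "i \<noteq> j" by (rule other_index[OF i])
    obtain \<alpha> where \<alpha>: "\<alpha> \<in> Omega1 n" "adj \<alpha> (Upper 1) (Lower i)" by (rule Omega1_through[OF i j])
    have A: "\<alpha> \<in> D" using \<alpha>(1) unfolding Omega1_iff by blast
    have "adj (\<alpha> \<odot> \<gamma>) (Upper 1) (Lower x)"
      using mult_Upper_Lower[OF A B \<alpha>(2) t] eq[OF \<alpha>(1)] by simp
    then have "x = z"
      using adj_unique[OF mult_closed[OF A C] mult_Upper_Lower[OF A C \<alpha>(2) 2]] by blast
    then show ?thesis using 2 by simp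
  qed
qed

lemma same_lower_blocks:
  assumes B: "\<beta> \<in> D" and C: "\<gamma> \<in> D" and eq: "\<And>\<alpha>. \<alpha> \<in> Omega1 n \<Longrightarrow> \<alpha> \<odot> \<beta> = \<alpha> \<odot> \<gamma>"
    and t: "adj \<beta> (Lower x) (Lower y)"
  shows "adj \<gamma> (Lower x) (Lower y)"
proof -
  have x: "x \<in> {1..n}" using adj_range(3)[OF B t] .
  show ?thesis using C x
  proof (cases rule: Lower_partner)
    case (1 z)
    have G: "zeta n \<in> Omega1 n" unfolding Omega1_iff using zeta_closed adj_zeta(1) by simp
    have "adj (zeta n \<odot> \<gamma>) (Lower x) (Lower y)" using mult_Lower_Lower[OF zeta_closed B t] eq[OF G] by simp
    then have "y = z"
      using adj_unique[OF mult_closed[OF zeta_closed C] mult_Lower_Lower[OF zeta_closed C 1]] by blast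
    then show ?thesis using 1 by simp
  next
    case (2 i)
    \<comment> \<open>The assumptions are symmetric in \<beta> and \<gamma>, so a transversal of
      \<gamma> passes back to \<beta>, where \<open>x\<close> already lies in a lower block.\<close>
    have "adj \<beta> (Upper i) (Lower x)" by (rule same_transversals[OF C B eq[symmetric] 2])
    from adj_unique[OF B t adj_sym[OF this]] show ?thesis by simp
  qed
qed

text \<open>If \<open>\<beta>\<close> has upper blocks \<open>{i, j}\<close>, \<open>{l, m}\<close> while \<open>\<gamma>\<close> has \<open>{i, l}\<close>, an element of rank
  four sending \<open>1, 2, 3, 4\<close> to \<open>i, j, l, m\<close> is moved into \<open>J\<close> by \<open>\<beta>\<close> and into \<open>I\<close> by \<open>\<gamma>\<close>.\<close>

lemma same_upper_blocks:
  assumes B: "\<beta> \<in> D" and C: "\<gamma> \<in> D" and eq: "\<And>\<alpha>. \<alpha> \<in> Omega1 n \<Longrightarrow> \<alpha> \<odot> \<beta> = \<alpha> \<odot> \<gamma>"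
    and tau: "\<And>\<alpha>. \<alpha> \<in> rank_ideal n 4 \<Longrightarrow> (\<alpha> \<odot> \<beta>, \<alpha> \<odot> \<gamma>) \<in> tau n"
    and ij: "adj \<beta> (Upper i) (Upper j)"
  shows "adj \<gamma> (Upper i) (Upper j)"
proof -
  have i: "i \<in> {1..n}" "j \<in> {1..n}" "i \<noteq> j" using adj_range[OF B] adjD(1)[OF B] ij by blast+
  show ?thesis using C i(1)
  proof (cases rule: Upper_partner)
    case (2 z)
    have "adj \<beta> (Upper i) (Lower z)" by (rule same_transversals[OF C B eq[symmetric] 2])
    from adj_unique[OF B ij this] show ?thesis by simp
  next
    case (1 l)
    have l: "l \<in> {1..n}" "i \<noteq> l" using adj_range(2)[OF C 1] adjD(1)[OF C 1] by auto
    show ?thesis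
    proof (cases "l = j")
      case True
      then show ?thesis using 1 by simp
    next
      case False
      \<comment> \<open>A transversal of \<beta> at \<open>l\<close> would be one of \<gamma> too,
        but there \<open>l\<close> lies in the upper block \<open>{i, l}\<close>.\<close>
      obtain m where lm: "adj \<beta> (Upper l) (Upper m)" using B l(1)
      proof (cases rule: Upper_partner)
        case (2 z)
        have "adj \<gamma> (Upper l) (Lower z)" by (rule same_transversals[OF B C eq 2])
        from adj_unique[OF C adj_sym[OF 1] this] show thesis by simp
      qed
      have m: "m \<in> {1..n}" "m \<noteq> l" using adj_range(2)[OF B lm] adjD(1)[OF B lm] by auto
      have "m \<noteq> i" using adj_unique[OF B adj_sym[OF lm], of "Upper j"] ij False by auto
      moreover have "m \<noteq> j" using adj_unique[OF B adj_sym[OF lm], of "Upper i"] adj_sym[OF ij] l by auto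
      ultimately have dist: "distinct [i, j, l, m]" using i l m False by auto
      let ?f = "\<lambda>x. if x = 1 then i else if x = 2 then j else if x = 3 then l else m"
      obtain \<pi> where \<pi>: "\<pi> permutes {1..n}" "\<And>x. x \<in> {1, 2, 3, 4} \<Longrightarrow> \<pi> x = ?f x"
        by (rule extend_to_permutation[of "{1..n}" "{1, 2, 3, 4}" ?f])
          (use dist i l m n_ge in \<open>auto simp: inj_on_def\<close>)
      let ?\<alpha> = "theta n 4 \<odot> perm_diagram n \<pi>"
      have r: "even 4" "4 \<le> n" using n_ge by simp_all
      note t = theta_perm[OF r _ \<pi>(1)]
      have A: "?\<alpha> \<in> D" using t(1)[of 1] n_ge by simp
      have up: "adj ?\<alpha> (Upper 1) (Lower i)" "adj ?\<alpha> (Upper 2) (Lower j)"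
        "adj ?\<alpha> (Upper 3) (Lower l)" "adj ?\<alpha> (Upper 4) (Lower m)"
        using t(2)[of 1] t(2)[of 2] t(2)[of 3] t(2)[of 4]
          \<pi>(2)[of 1] \<pi>(2)[of 2] \<pi>(2)[of 3] \<pi>(2)[of 4] n_ge by simp_all
      have "upper_free ?\<alpha> \<subseteq> {1, 2, 3, 4}"
      proof
        fix x assume "x \<in> upper_free ?\<alpha>"
        then have "x \<in> {1..n}" "\<not> 4 < x" unfolding upper_free_iff[OF A] using t(3) by blast+
        then show "x \<in> {1, 2, 3, 4}" by auto
      qed
      then have "card (upper_free ?\<alpha>) \<le> card {1, 2, 3, 4 :: nat}" by (intro card_mono) auto
      then have "rank ?\<alpha> \<le> 4" using rank_free(1)[OF A] by simp
      then have "?\<alpha> \<in> rank_ideal n 4" using A unfolding rank_ideal_def by simp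
      then have tau': "(?\<alpha> \<odot> \<beta>, ?\<alpha> \<odot> \<gamma>) \<in> tau n" by (rule tau)
      note AB = mult_closed[OF A B]
      have m12: "mate 1 = 2" "mate 2 = 1" "mate 3 = 4" "mate 4 = 3" by (simp_all add: mate_def)
      have b12: "adj (?\<alpha> \<odot> \<beta>) (Upper 1) (Upper 2)" by (rule mult_Upper_Upper_via[OF A B up(1) ij up(2)])
      have b34: "adj (?\<alpha> \<odot> \<beta>) (Upper 3) (Upper 4)" by (rule mult_Upper_Upper_via[OF A B up(3) lm up(4)])
      \<comment> \<open>\<beta> closes 1 with 2 and 3 with 4, and the pairs beyond 4 are upper
        blocks of the probe already.\<close>
      have all: "adj (?\<alpha> \<odot> \<beta>) (Upper x) (Upper (mate x))" if x: "x \<in> {1..n}" for x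
      proof -
        have "x = 1 \<or> x = 2 \<or> x = 3 \<or> x = 4 \<or> 4 < x" using x by simp linarith
        then consider "x = 1" | "x = 2" | "x = 3" | "x = 4" | "4 < x" by blast
        then show ?thesis
        proof cases
          case 5
          then show ?thesis using mult_Upper_Upper[OF A B t(3)] x by blast
        qed (use b12 b34 adj_sym[OF b12] adj_sym[OF b34] m12 in simp_all)
      qed
      have "?\<alpha> \<odot> \<beta> \<in> R_zeta n" unfolding R_zeta_iff using AB all by blast
      then have "?\<alpha> \<odot> \<gamma> \<in> J_set n" using tau_J(1)[OF tau' R_zeta_J(1)] by blast
      moreover have "adj (?\<alpha> \<odot> \<gamma>) (Upper 1) (Upper 3)" by (rule mult_Upper_Upper_via[OF A C up(1) 1 up(3)])
      ultimately have "3 = mate 1" unfolding J_iff K_iff by blast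
      then show ?thesis using m12 by simp
    qed
  qed
qed

lemma faithful_mu: "faithful_right_action (brauer n) (Omega n) (mu n)"
  unfolding faithful_right_action_def
proof (intro conjI inj_onI right_action_mu)
  fix \<beta> \<gamma> assume "\<beta> \<in> carrier (brauer n)" "\<gamma> \<in> carrier (brauer n)"
    and eq: "(\<lambda>x\<in>Omega n. mu n x \<beta>) = (\<lambda>x\<in>Omega n. mu n x \<gamma>)"
  then have B: "\<beta> \<in> D" and C: "\<gamma> \<in> D" by simp_all
  have glue: "glue (act u \<beta>) = glue (act u \<gamma>)" if u: "u \<in> points" for u
  proof -
    have "point_class u \<in> Omega n" unfolding Omega_eq using u by blast
    then have "mu n (point_class u) \<beta> = mu n (point_class u) \<gamma>" using fun_cong[OF eq, of "point_class u"] by simp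
    then show ?thesis
      using mu_point_class[OF u] B C point_class_eq_iff[OF act_points[OF u B] act_points[OF u C]] by simp
  qed
  have 1: "\<alpha> \<odot> \<beta> = \<alpha> \<odot> \<gamma>" if "\<alpha> \<in> Omega1 n" for \<alpha>
    using glue[of "Inl \<alpha>"] glue_Inl_eq that unfolding act_simps points_def by blast
  have 2: "(\<alpha> \<odot> \<beta>, \<alpha> \<odot> \<gamma>) \<in> tau n" if "\<alpha> \<in> rank_ideal n 4" for \<alpha>
  proof -
    have A: "\<alpha> \<in> D" using that unfolding rank_ideal_def by simp
    have "Inr (tau_class n \<alpha>) \<in> points" using that unfolding points_def Omega2_def by blast
    from glue[OF this] have "tau_class n (\<alpha> \<odot> \<beta>) = tau_class n (\<alpha> \<odot> \<gamma>)"
      using act_simps(2)[OF A] B C by (simp add: glue_def)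
    then show ?thesis using tau_class_eq_iff mult_closed A B C by blast
  qed
  show "\<beta> = \<gamma>"
  proof (rule brauer_eqI_cases[OF B C])
    fix x y
    show "adj \<gamma> (Upper x) (Upper y)" if "adj \<beta> (Upper x) (Upper y)" using same_upper_blocks[OF B C 1 2 that] .
    show "adj \<gamma> (Upper x) (Lower y)" if "adj \<beta> (Upper x) (Lower y)" using same_transversals[OF B C 1 that] .
    show "adj \<gamma> (Lower x) (Lower y)" if "adj \<beta> (Lower x) (Lower y)" using same_lower_blocks[OF B C 1 that] .
  qed
qed

end

section \<open>Counting the points\<close>

text \<open>Numbering the points of \<open>X\<close> turns the action into a homomorphism to
  self-maps, multiplicative because both sides compose from left to right. Faithfulness makes it
  injective, and nonemptiness gives the bound 1 \<le> m demanded of a degree.\<close>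

lemma transf_degree_le:
  assumes faithful: "faithful_right_action S X \<mu>" and X: "finite X" "X \<noteq> {}"
  shows "transf_degree S \<le> card X"
proof -
  let ?m = "card X"
  have act: "\<mu> x a \<in> X" "b \<in> carrier S \<Longrightarrow> \<mu> (\<mu> x a) b = \<mu> x (a \<otimes>\<^bsub>S\<^esub> b)" if "x \<in> X" "a \<in> carrier S" for x a b
    using faithful that unfolding faithful_right_action_def right_action_def by blast+
  obtain h where h: "bij_betw h X {1..?m}" using ex_bij_betw_finite_nat[OF X(1)]
    by (metis X(1) card_atLeastAtMost diff_Suc_1 finite_atLeastAtMost finite_same_card_bij)
  define g where "g = inv_into X h"
  have g: "g i \<in> X" "h (g i) = i" if "i \<in> {1..?m}" for i
    using h that unfolding g_def bij_betw_def by (metis inv_into_into, metis f_inv_into_f)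
  have gh: "h x \<in> {1..?m}" "g (h x) = x" if "x \<in> X" for x
    using h that unfolding g_def bij_betw_def by auto
  define \<phi> where "\<phi> a = (\<lambda>i\<in>{1..?m}. h (\<mu> (g i) a))" for a
  have "\<phi> \<in> hom S (full_transf_monoid ?m)"
  proof (rule homI)
    fix a assume a: "a \<in> carrier S"
    then show "\<phi> a \<in> carrier (full_transf_monoid ?m)"
      unfolding full_transf_monoid_def \<phi>_def using act(1) g(1) gh(1) by auto
    fix b assume b: "b \<in> carrier S"
    have "\<phi> (a \<otimes>\<^bsub>S\<^esub> b) = compose {1..?m} (\<phi> b) (\<phi> a)"
    proof (rule ext)
      fix i
      show "\<phi> (a \<otimes>\<^bsub>S\<^esub> b) i = compose {1..?m} (\<phi> b) (\<phi> a) i"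
      proof (cases "i \<in> {1..?m}")
        case True
        have x: "\<mu> (g i) a \<in> X" using act(1) g(1) True a by blast
        have "\<phi> a i = h (\<mu> (g i) a)" unfolding \<phi>_def using True by simp
        then have "\<phi> b (\<phi> a i) = h (\<mu> (\<mu> (g i) a) b)" using gh[OF x] unfolding \<phi>_def by simp
        then show ?thesis using act(2)[OF g(1)[OF True] a b] True by (simp add: \<phi>_def compose_def)
      next
        case False
        then show ?thesis by (simp add: \<phi>_def compose_def del: atLeastAtMost_iff)
      qed
    qed
    then show "\<phi> (a \<otimes>\<^bsub>S\<^esub> b) = \<phi> a \<otimes>\<^bsub>full_transf_monoid ?m\<^esub> \<phi> b"
      unfolding full_transf_monoid_def by simp
  qed
  moreover have "inj_on \<phi> (carrier S)"
  proof (rule inj_onI)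
    fix a b assume a: "a \<in> carrier S" and b: "b \<in> carrier S" and eq: "\<phi> a = \<phi> b"
    have "\<mu> x a = \<mu> x b" if x: "x \<in> X" for x
    proof -
      have "h (\<mu> x a) = h (\<mu> x b)" using fun_cong[OF eq, of "h x"] gh[OF x] unfolding \<phi>_def by simp
      then show ?thesis using act(1)[OF x a] act(1)[OF x b] gh(2) by metis
    qed
    then have "(\<lambda>x\<in>X. \<mu> x a) = (\<lambda>x\<in>X. \<mu> x b)" by auto
    then show "a = b" using faithful a b unfolding faithful_right_action_def inj_on_def by blast
  qed
  moreover have "1 \<le> ?m" using X by (simp add: Suc_leI card_gt_0_iff)
  ultimately show ?thesis unfolding transf_degree_def by (intro Least_le) blast
qed

text \<open>On \<open>A\<close> the map \<open>f\<close> factors through \<open>g\<close>. This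
  bounds a number of classes by the number of values of an invariant that determines the
  class.\<close>

lemma card_image_le_image:
  assumes "finite (g ` A)" "\<And>x y. x \<in> A \<Longrightarrow> y \<in> A \<Longrightarrow> g x = g y \<Longrightarrow> f x = f y"
  shows "card (f ` A) \<le> card (g ` A)"
proof -
  have "f x = f (inv_into A g (g x))" if "x \<in> A" for x
    using assms(2)[OF that inv_into_into[of "g x" g A]] that f_inv_into_f[of "g x" g A] by auto
  then have "f ` A = (\<lambda>z. f (inv_into A g z)) ` (g ` A)" by (auto simp: image_image cong: image_cong)
  then show ?thesis using card_image_le[OF assms(1)] by metis
qed

text \<open>The cokernel of \<alpha> without its diagonal.\<close>

definition lower_pattern :: "diagram \<Rightarrow> (nat \<times> nat) set" where
  "lower_pattern \<alpha> = {(x, y). adj \<alpha> (Lower x) (Lower y)}"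

lemma lower_pattern_eqD:
  "lower_pattern \<alpha> = lower_pattern \<beta> \<Longrightarrow> adj \<alpha> (Lower x) (Lower y) \<longleftrightarrow> adj \<beta> (Lower x) (Lower y)"
  unfolding lower_pattern_def by auto

text \<open>Recovers the free lower points, and hence the rank, from the lower pattern
  alone.\<close>

definition unmatched :: "nat \<Rightarrow> (nat \<times> nat) set \<Rightarrow> nat set" where
  "unmatched n L = {x \<in> {1..n}. \<forall>y. (x, y) \<notin> L}"

lemma lower_free_eq: "\<alpha> \<in> brauer_diagrams n \<Longrightarrow> lower_free \<alpha> = unmatched n (lower_pattern \<alpha>)"
  unfolding unmatched_def lower_pattern_def by (auto simp: lower_free_iff)

subsection \<open>The projection \<open>\<alpha>\<^sup>*\<alpha>\<close>\<close>

definition lower_partner :: "diagram \<Rightarrow> nat \<Rightarrow> nat" where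
  "lower_partner \<alpha> x = (THE y. adj \<alpha> (Lower x) (Lower y))"

fun projection_vertex :: "diagram \<Rightarrow> vertex \<Rightarrow> vertex" where
  "projection_vertex \<alpha> (Upper x) = (if x \<in> lower_free \<alpha> then Lower x else Upper (lower_partner \<alpha> x))"
| "projection_vertex \<alpha> (Lower x) = (if x \<in> lower_free \<alpha> then Upper x else Lower (lower_partner \<alpha> x))"
| "projection_vertex \<alpha> (Middle x) = Middle x"

text \<open>The blocks of the projection written out: the lower blocks of \<alpha>, their copies in
  the upper row, and vertical transversals at the free lower points. Written as an involution, it
  needs no tracing of a product.\<close>

definition projection_of :: "nat \<Rightarrow> diagram \<Rightarrow> diagram" where
  "projection_of n \<alpha> = diagram_of n (projection_vertex \<alpha>)"

context
  fixes n :: nat and \<alpha> :: diagram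
  assumes A: "\<alpha> \<in> brauer_diagrams n"
begin

lemma lower_partner_eq: "adj \<alpha> (Lower x) (Lower y) \<Longrightarrow> lower_partner \<alpha> x = y"
  unfolding lower_partner_def using adj_unique[OF A] by blast

lemma lower_partner:
  assumes "x \<in> {1..n}" "x \<notin> lower_free \<alpha>"
  shows "adj \<alpha> (Lower x) (Lower (lower_partner \<alpha> x))" "lower_partner \<alpha> x \<in> {1..n}"
    "lower_partner \<alpha> x \<notin> lower_free \<alpha>" "lower_partner \<alpha> x \<noteq> x" "lower_partner \<alpha> (lower_partner \<alpha> x) = x"
proof -
  obtain y where y: "adj \<alpha> (Lower x) (Lower y)" using assms unfolding lower_free_iff[OF A] by blast
  note eq = lower_partner_eq[OF y] lower_partner_eq[OF adj_sym[OF y]]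
  show "adj \<alpha> (Lower x) (Lower (lower_partner \<alpha> x))" "lower_partner \<alpha> x \<in> {1..n}"
    "lower_partner \<alpha> x \<noteq> x" "lower_partner \<alpha> (lower_partner \<alpha> x) = x"
    using y adj_range(4)[OF A y] adjD(1)[OF A y] unfolding eq by auto
  show "lower_partner \<alpha> x \<notin> lower_free \<alpha>" unfolding eq lower_free_iff[OF A] using adj_sym[OF y] by blast
qed

lemma projection_vertex:
  assumes "v \<in> vertices n"
  shows "projection_vertex \<alpha> v \<in> vertices n \<and> projection_vertex \<alpha> v \<noteq> v \<and>
    projection_vertex \<alpha> (projection_vertex \<alpha> v) = v"
  using assms
proof (cases rule: verticesE)
  case (1 x)
  then show ?thesis using lower_partner[OF 1(1)] by simp
next
  case (2 x)
  then show ?thesis using lower_partner[OF 2(1)] by simp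
qed

lemma projection_of_closed: "projection_of n \<alpha> \<in> brauer_diagrams n"
  unfolding projection_of_def by (rule diagram_of(1)[OF projection_vertex])

lemma adj_projection_of:
  "adj (projection_of n \<alpha>) v w \<longleftrightarrow> v \<in> vertices n \<and> w = projection_vertex \<alpha> v"
  unfolding projection_of_def by (rule diagram_of(2)[OF projection_vertex])

lemma projection_of_pattern: "lower_pattern (projection_of n \<alpha>) = lower_pattern \<alpha>"
proof -
  have "adj (projection_of n \<alpha>) (Lower x) (Lower y) \<longleftrightarrow> adj \<alpha> (Lower x) (Lower y)" for x y
  proof
    assume "adj (projection_of n \<alpha>) (Lower x) (Lower y)"
    then show "adj \<alpha> (Lower x) (Lower y)"
      unfolding adj_projection_of using lower_partner(1)[of x] by (auto split: if_splits)
  next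
    assume y: "adj \<alpha> (Lower x) (Lower y)"
    then have "x \<notin> lower_free \<alpha>" unfolding lower_free_iff[OF A] by blast
    then show "adj (projection_of n \<alpha>) (Lower x) (Lower y)"
      unfolding adj_projection_of using lower_partner_eq[OF y] adj_range(3)[OF A y] by simp
  qed
  then show ?thesis unfolding lower_pattern_def by simp
qed

lemma projection_of_projection: "projection_of n \<alpha> \<in> projections n"
proof -
  let ?E = "projection_of n \<alpha>"
  note E = projection_of_closed
  have "?E = diagram_mult n ?E ?E"
  proof (rule brauer_eqI_cases[OF E diagram_mult_closed[OF E E]])
    fix x y
    show "adj (diagram_mult n ?E ?E) (Upper x) (Upper y)" if "adj ?E (Upper x) (Upper y)"
      by (rule mult_Upper_Upper[OF E E that])
    show "adj (diagram_mult n ?E ?E) (Lower x) (Lower y)" if "adj ?E (Lower x) (Lower y)"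
      by (rule mult_Lower_Lower[OF E E that])
    show "adj (diagram_mult n ?E ?E) (Upper x) (Lower y)" if xy: "adj ?E (Upper x) (Lower y)"
    proof -
      have "y = x" using xy unfolding adj_projection_of by (auto split: if_splits)
      then show ?thesis using mult_Upper_Lower[OF E E xy, of y] xy by simp
    qed
  qed
  moreover have "star ?E = ?E"
  proof -
    have comm: "flip_vertex (projection_vertex \<alpha> v) = projection_vertex \<alpha> (flip_vertex v)" for v
      by (cases v) auto
    have V: "flip_vertex ` vertices n = vertices n" by (auto simp: vertices_def image_Un image_image)
    have "star ?E = (\<lambda>v. {v, projection_vertex \<alpha> v}) ` (flip_vertex ` vertices n)"
      unfolding star_def projection_of_def diagram_of_def by (simp add: image_image comm)
    then show ?thesis unfolding V projection_of_def diagram_of_def .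
  qed
  ultimately show ?thesis unfolding projections_def using E by simp
qed

end

text \<open>Each pattern is also the pattern of the projection
  \<open>projection_of n \<alpha>\<close>, whose rank is the same because the rank is the number of
  unmatched points.\<close>

lemma card_lower_patterns:
  "card (lower_pattern ` {\<alpha> \<in> brauer_diagrams n. rank \<alpha> = r}) \<le> num_projections n r"
proof -
  let ?P = "{\<epsilon> \<in> projections n. rank \<epsilon> = r}"
  have fin: "finite ?P" unfolding projections_def using finite_brauer_diagrams by simp
  have "lower_pattern \<alpha> \<in> lower_pattern ` ?P" if A: "\<alpha> \<in> brauer_diagrams n" and r: "rank \<alpha> = r" for \<alpha>
  proof -
    note E = projection_of_closed[OF A]
    have "rank (projection_of n \<alpha>) = rank \<alpha>"
      unfolding rank_free(2)[OF A] rank_free(2)[OF E] lower_free_eq[OF A] lower_free_eq[OF E] projection_of_pattern[OF A] ..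
    then show ?thesis using projection_of_pattern[OF A] projection_of_projection[OF A] r
      by (metis (mono_tags, lifting) image_eqI mem_Collect_eq)
  qed
  then have "lower_pattern ` {\<alpha> \<in> brauer_diagrams n. rank \<alpha> = r} \<subseteq> lower_pattern ` ?P" by blast
  then have "card (lower_pattern ` {\<alpha> \<in> brauer_diagrams n. rank \<alpha> = r}) \<le> card (lower_pattern ` ?P)"
    using fin by (intro card_mono) auto
  also have "\<dots> \<le> card ?P" by (rule card_image_le[OF fin])
  finally show ?thesis unfolding num_projections_def .
qed

lemma finite_lower_patterns: "finite (lower_pattern ` {\<alpha> \<in> brauer_diagrams n. P \<alpha>})"
  by simp

text \<open>The odd elements represent the pairs, so both sets have equally many of them. Any
  bijection between the odd elements extends to their mates.\<close>

lemma mate_closed_bij: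
  assumes A: "0 \<notin> A" "finite A" "\<And>x. x \<in> A \<Longrightarrow> mate x \<in> A"
    and B: "0 \<notin> B" "finite B" "\<And>x. x \<in> B \<Longrightarrow> mate x \<in> B" and card: "card A = card B"
  obtains g where "bij_betw g A B" "\<And>x. x \<in> A \<Longrightarrow> g (mate x) = mate (g x)"
proof -
  let ?OA = "{x \<in> A. odd x}" and ?OB = "{x \<in> B. odd x}"
  have "card ?OA = card ?OB" using card card_mate_closed[OF A] card_mate_closed[OF B] by simp
  then obtain f where f: "bij_betw f ?OA ?OB" using finite_same_card_bij[of ?OA ?OB] A(2) B(2) by auto
  define g where "g x = (if odd x then f x else mate (f (mate x)))" for x
  have odd: "bij_betw g ?OA ?OB" using f by (rule bij_betw_cong[THEN iffD1, rotated]) (simp add: g_def)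
  have gm: "g (mate x) = mate (g x)" if x: "x \<in> A" for x
  proof -
    have pos: "0 < x" using A(1) x by (metis gr0I)
    show ?thesis
    proof (cases "odd x")
      case True
      then show ?thesis unfolding g_def using odd_mate[OF pos] mate_mate[OF pos] by simp
    next
      case False
      then have "mate x \<in> ?OA" using A(3)[OF x] odd_mate[OF pos] by simp
      then have "f (mate x) \<in> ?OB" using f unfolding bij_betw_def by blast
      then have "0 < f (mate x)" by (auto elim: oddE)
      then show ?thesis unfolding g_def using odd_mate[OF pos] False by simp
    qed
  qed
  have "bij_betw mate ?OB (mate ` ?OB)" "bij_betw mate ?OA (mate ` ?OA)"
    using mate_closed_split(3)[OF A(1,3)] mate_closed_split(3)[OF B(1,3)] by (simp_all add: inj_on_imp_bij_betw)
  then have "bij_betw (mate \<circ> g \<circ> inv_into ?OA mate) (mate ` ?OA) (mate ` ?OB)"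
    using odd bij_betw_inv_into by (blast intro: bij_betw_trans)
  then have "bij_betw g (mate ` ?OA) (mate ` ?OB)"
  proof (rule bij_betw_cong[THEN iffD1, rotated])
    fix y assume "y \<in> mate ` ?OA"
    then obtain x where "x \<in> ?OA" "y = mate x" by blast
    then show "(mate \<circ> g \<circ> inv_into ?OA mate) y = g y"
      using inv_into_f_f[OF mate_closed_split(3)[OF A(1,3)]] gm by simp
  qed
  then have "bij_betw g (?OA \<union> mate ` ?OA) (?OB \<union> mate ` ?OB)"
    using odd mate_closed_split(2)[OF B(1,3)] by (intro bij_betw_combine)
  then have "bij_betw g A B"
    using mate_closed_split(1)[OF A(1,3)] mate_closed_split(1)[OF B(1,3)] by metis
  then show thesis using that gm by blast
qed

section \<open>Invariants that count \<open>R_zeta\<close> and \<open>R_gamma\<close>\<close>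

context even_degree
begin

text \<open>The upper blocks are prescribed and there are no transversals, so only the lower blocks
  can vary.\<close>

lemma R_zeta_pattern_inj: "inj_on lower_pattern (R_zeta n)"
proof (rule inj_onI)
  fix \<alpha> \<beta> assume a: "\<alpha> \<in> R_zeta n" and b: "\<beta> \<in> R_zeta n" and eq: "lower_pattern \<alpha> = lower_pattern \<beta>"
  have A: "\<alpha> \<in> D" and B: "\<beta> \<in> D" using a b unfolding R_zeta_iff by blast+
  show "\<alpha> = \<beta>"
  proof (rule brauer_eqI_cases[OF A B])
    fix x y
    show "adj \<beta> (Upper x) (Upper y)" if xy: "adj \<alpha> (Upper x) (Upper y)"
    proof -
      have x: "x \<in> {1..n}" using adj_range(1)[OF A xy] .
      then have "y = mate x" using a adj_unique[OF A xy, of "Upper (mate x)"] unfolding R_zeta_iff by simp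
      then show ?thesis using b x unfolding R_zeta_iff by simp
    qed
    show "adj \<beta> (Upper x) (Lower y)" if "adj \<alpha> (Upper x) (Lower y)"
      using that upper_free_R_zeta[OF a] unfolding upper_free_def by blast
    show "adj \<beta> (Lower x) (Lower y)" if "adj \<alpha> (Lower x) (Lower y)"
      using that lower_pattern_eqD[OF eq] by blast
  qed
qed

lemma card_R_zeta: "card (R_zeta n) \<le> num_projections n 0"
proof -
  have "lower_pattern ` R_zeta n \<subseteq> lower_pattern ` {\<alpha> \<in> D. rank \<alpha> = 0}"
  proof (rule image_mono, rule subsetI)
    fix \<alpha> assume "\<alpha> \<in> R_zeta n"
    then show "\<alpha> \<in> {\<alpha> \<in> D. rank \<alpha> = 0}" using R_zeta_J(2) by (simp add: R_zeta_iff)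
  qed
  then have "card (lower_pattern ` R_zeta n) \<le> card (lower_pattern ` {\<alpha> \<in> D. rank \<alpha> = 0})"
    by (intro card_mono finite_lower_patterns)
  then show ?thesis using card_image[OF R_zeta_pattern_inj] card_lower_patterns[of n 0] by simp
qed

lemma R_gamma_transversals:
  assumes "\<alpha> \<in> R_gamma n"
  obtains a b where "adj \<alpha> (Upper 1) (Lower a)" "adj \<alpha> (Upper 2) (Lower b)" "a \<noteq> b"
    "upper_free \<alpha> = {1, 2}" "lower_free \<alpha> = {a, b}"
proof -
  have A: "\<alpha> \<in> D" and up: "\<And>x. x \<in> {3..n} \<Longrightarrow> adj \<alpha> (Upper x) (Upper (mate x))"
    and not12: "\<not> adj \<alpha> (Upper 1) (Upper 2)" using assms unfolding R_gamma_iff by blast+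
  have no: "\<not> adj \<alpha> (Upper x) (Upper y)" if x: "x \<in> {1, 2}" for x y
  proof
    assume xy: "adj \<alpha> (Upper x) (Upper y)"
    have y: "y \<in> {1..n}" "x \<noteq> y" using adj_range(2)[OF A xy] adjD(1)[OF A xy] by auto
    show False
    proof (cases "y \<in> {3..n}")
      case True
      then have "x = mate y" using adj_unique[OF A adj_sym[OF xy] up] by blast
      moreover have "2 < mate y" using mate_le_iff[of 2 y] True by auto
      ultimately show False using x by auto
    next
      case False
      then have "y = 1 \<or> y = 2" using y by auto
      then show False using x y(2) xy adj_sym[OF xy] not12 by auto
    qed
  qed
  have free: "upper_free \<alpha> = {1, 2}"
  proof (intro equalityI subsetI)
    fix x assume "x \<in> upper_free \<alpha>"
    then have "x \<in> {1..n}" "x \<notin> {3..n}" unfolding upper_free_iff[OF A] using up by blast+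
    then show "x \<in> {1, 2}" by auto
  next
    fix x :: nat assume "x \<in> {1, 2}"
    then show "x \<in> upper_free \<alpha>" unfolding upper_free_iff[OF A] using no n_ge by auto
  qed
  obtain a where a: "adj \<alpha> (Upper 1) (Lower a)" using free unfolding upper_free_def by blast
  obtain b where b: "adj \<alpha> (Upper 2) (Lower b)" using free unfolding upper_free_def by blast
  have "a \<noteq> b" using adj_unique'[OF A a, of "Upper 2"] b by auto
  moreover have "lower_free \<alpha> = {a, b}"
  proof (intro equalityI subsetI)
    fix y assume "y \<in> lower_free \<alpha>"
    then obtain x where x: "adj \<alpha> (Upper x) (Lower y)" unfolding lower_free_def by blast
    then have "x \<in> upper_free \<alpha>" unfolding upper_free_def by blast
    then consider "x = 1" | "x = 2" unfolding free by blast
    then show "y \<in> {a, b}" using adj_unique[OF A a, of "Lower y"] adj_unique[OF A b, of "Lower y"] x by cases auto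
  qed (use a b in \<open>auto simp: lower_free_def\<close>)
  ultimately show thesis using that a b free by blast
qed

lemma card_R_gamma: "card (R_gamma n) \<le> 2 * num_projections n 2"
proof -
  let ?L = "lower_pattern ` {\<alpha> \<in> D. rank \<alpha> = 2}"
  \<comment> \<open>The Boolean tells which of the two free lower points is joined to 1, the other
    being joined to 2. The minimum singles out one of them by means of the pattern alone.\<close>
  define key where "key \<alpha> = (lower_pattern \<alpha>, adj \<alpha> (Upper 1) (Lower (Min (lower_free \<alpha>))))" for \<alpha>
  have "inj_on key (R_gamma n)"
  proof (rule inj_onI)
    fix \<alpha> \<beta> assume a: "\<alpha> \<in> R_gamma n" and b: "\<beta> \<in> R_gamma n" and eq: "key \<alpha> = key \<beta>"
    have A: "\<alpha> \<in> D" and B: "\<beta> \<in> D" using a b unfolding R_gamma_iff by blast+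
    obtain i j where ij: "adj \<alpha> (Upper 1) (Lower i)" "adj \<alpha> (Upper 2) (Lower j)" "i \<noteq> j"
      "upper_free \<alpha> = {1, 2}" "lower_free \<alpha> = {i, j}" by (rule R_gamma_transversals[OF a])
    obtain k l where kl: "adj \<beta> (Upper 1) (Lower k)" "adj \<beta> (Upper 2) (Lower l)" "k \<noteq> l"
      "upper_free \<beta> = {1, 2}" "lower_free \<beta> = {k, l}" by (rule R_gamma_transversals[OF b])
    have low: "lower_pattern \<alpha> = lower_pattern \<beta>" using eq unfolding key_def by simp
    then have free: "lower_free \<alpha> = lower_free \<beta>" using lower_free_eq[OF A] lower_free_eq[OF B] by simp
    define m where "m = Min (lower_free \<alpha>)"
    have m: "m \<in> lower_free \<alpha>" unfolding m_def by (rule Min_in) (simp_all add: ij)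
    have "adj \<alpha> (Upper 1) (Lower m) \<longleftrightarrow> adj \<beta> (Upper 1) (Lower m)" using eq free unfolding key_def m_def by simp
    then have "i = m \<longleftrightarrow> k = m" using ij(1) kl(1) adj_unique[OF A ij(1)] adj_unique[OF B kl(1)] by blast
    moreover have "{i, j} = {k, l}" using free ij(5) kl(5) by simp
    ultimately have "i = k \<and> j = l" using ij(3,5) kl(3) m by (auto simp: doubleton_eq_iff)
    show "\<alpha> = \<beta>"
    proof (rule brauer_eqI_cases[OF A B])
      fix x y
      show "adj \<beta> (Upper x) (Upper y)" if xy: "adj \<alpha> (Upper x) (Upper y)"
      proof -
        have "x \<in> {1..n}" "x \<notin> {1, 2}"
          using adj_range(1)[OF A xy] upper_free_iff[OF A] xy ij(4) by blast+
        then have x: "x \<in> {3..n}" by auto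
        then have "y = mate x" using a adj_unique[OF A xy, of "Upper (mate x)"] unfolding R_gamma_iff by simp
        then show ?thesis using b x unfolding R_gamma_iff by simp
      qed
      show "adj \<beta> (Upper x) (Lower y)" if xy: "adj \<alpha> (Upper x) (Lower y)"
      proof -
        have "x \<in> upper_free \<alpha>" using xy unfolding upper_free_def by blast
        then consider "x = 1" | "x = 2" unfolding ij(4) by blast
        then show ?thesis
          using adj_unique[OF A ij(1), of "Lower y"] adj_unique[OF A ij(2), of "Lower y"] xy kl(1,2) \<open>i = k \<and> j = l\<close>
          by cases auto
      qed
      show "adj \<beta> (Lower x) (Lower y)" if "adj \<alpha> (Lower x) (Lower y)"
        using that lower_pattern_eqD[OF low] by blast
    qed
  qed
  then have "card (R_gamma n) = card (key ` R_gamma n)" by (rule card_image[symmetric])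
  also have "key ` R_gamma n \<subseteq> ?L \<times> UNIV"
  proof
    fix p assume "p \<in> key ` R_gamma n"
    then obtain \<alpha> where p: "\<alpha> \<in> R_gamma n" "p = key \<alpha>" by blast
    then have A: "\<alpha> \<in> D" unfolding R_gamma_iff by blast
    obtain i j where "upper_free \<alpha> = {1, 2}" by (rule R_gamma_transversals[OF p(1)])
    then have "rank \<alpha> = 2" unfolding rank_free(1)[OF A] by simp
    then show "p \<in> ?L \<times> UNIV" unfolding p(2) key_def using A by blast
  qed
  then have "card (key ` R_gamma n) \<le> card (?L \<times> (UNIV :: bool set))"
    by (intro card_mono finite_cartesian_product finite_lower_patterns) auto
  also have "\<dots> = 2 * card ?L" by (simp add: card_cartesian_product)
  finally show ?thesis using card_lower_patterns[of n 2] by linarith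
qed

section \<open>The U-orbits of rank four\<close>

lemma perm_diagram_U:
  assumes \<pi>: "\<pi> permutes {1..n}" and comm: "\<And>x. x \<in> {1..n} \<Longrightarrow> \<pi> (mate x) = mate (\<pi> x)"
  shows "perm_diagram n \<pi> \<in> U_grp n"
proof -
  note P = perm_diagram_closed[OF \<pi>] and Z = zeta_closed
  have "zeta n = perm_diagram n \<pi> \<odot> zeta n"
  proof (rule brauer_eqI_cases[OF Z mult_closed[OF P Z]])
    fix x y
    show "adj (perm_diagram n \<pi> \<odot> zeta n) (Lower x) (Lower y)" if "adj (zeta n) (Lower x) (Lower y)"
      by (rule mult_Lower_Lower[OF P Z that])
    show "adj (perm_diagram n \<pi> \<odot> zeta n) (Upper x) (Lower y)" if "adj (zeta n) (Upper x) (Lower y)"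
      using that unfolding adj_zeta by simp
    show "adj (perm_diagram n \<pi> \<odot> zeta n) (Upper x) (Upper y)" if "adj (zeta n) (Upper x) (Upper y)"
    proof -
      have x: "x \<in> {1..n}" "y = mate x" using that unfolding adj_zeta by auto
      have px: "\<pi> x \<in> {1..n}" using permutes_in_image[OF \<pi>] x(1) by blast
      show ?thesis
      proof (rule mult_Upper_Upper_via[OF P Z adj_perm_Upper[OF \<pi> x(1)]])
        show "adj (zeta n) (Upper (\<pi> x)) (Upper (mate (\<pi> x)))" using px adj_zeta(1) by simp
        show "adj (perm_diagram n \<pi>) (Upper y) (Lower (mate (\<pi> x)))"
          using adj_perm_Upper[OF \<pi> mate_in[OF x(1)]] comm[OF x(1)] x(2) by simp
      qed
    qed
  qed
  then show ?thesis using perm_diagram_Units[OF \<pi>] unfolding U_grp_def by simp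
qed

text \<open>A transversal of \<beta> is matched with the transversal of \<alpha> that has the same
  lower end. Equality of the products with \<zeta> says that this matching of upper ends respects
  \<open>mate\<close>. The other upper points form mate pairs in both diagrams, equally many, and
  can be matched pair by pair; together this gives a permutation commuting with \<open>mate\<close>,
  hence an element of U.\<close>

lemma K_same_orbit:
  assumes a: "\<alpha> \<in> K_set n" and b: "\<beta> \<in> K_set n" and low: "lower_pattern \<alpha> = lower_pattern \<beta>"
    and z: "zeta n \<odot> \<alpha> = zeta n \<odot> \<beta>"
  obtains u where "u \<in> U_grp n" "\<beta> = u \<odot> \<alpha>"
proof -
  have A: "\<alpha> \<in> D" and B: "\<beta> \<in> D" using a b unfolding K_iff by blast+
  note Z = zeta_closed
  let ?P = "upper_free \<beta>" and ?Q = "upper_free \<alpha>"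
  have lf: "lower_free \<alpha> = lower_free \<beta>" using lower_free_eq[OF A] lower_free_eq[OF B] low by simp
  have ex: "\<exists>w y. adj \<beta> (Upper x) (Lower y) \<and> adj \<alpha> (Upper w) (Lower y)" if x: "x \<in> ?P" for x
  proof -
    obtain y where y: "adj \<beta> (Upper x) (Lower y)" using x unfolding upper_free_def by blast
    then have "y \<in> lower_free \<beta>" unfolding lower_free_def by blast
    then have "y \<in> lower_free \<alpha>" unfolding lf .
    then show ?thesis using y unfolding lower_free_def by blast
  qed
  define c where "c x = (SOME w. \<exists>y. adj \<beta> (Upper x) (Lower y) \<and> adj \<alpha> (Upper w) (Lower y))" for x
  have c: "\<exists>y. adj \<beta> (Upper x) (Lower y) \<and> adj \<alpha> (Upper (c x)) (Lower y)" if "x \<in> ?P" for x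
    unfolding c_def by (rule someI_ex[OF ex[OF that]])
  have c': "adj \<alpha> (Upper (c x)) (Lower y)" if y: "adj \<beta> (Upper x) (Lower y)" for x y
  proof -
    have "x \<in> ?P" using y unfolding upper_free_def by blast
    then show ?thesis using c adj_unique[OF B y] by blast
  qed
  have cQ: "c x \<in> ?Q" if "x \<in> ?P" for x using c[OF that] unfolding upper_free_def by blast
  have "inj_on c ?P"
  proof (rule inj_onI)
    fix x x' assume x: "x \<in> ?P" "x' \<in> ?P" "c x = c x'"
    obtain y y' where y: "adj \<beta> (Upper x) (Lower y)" "adj \<beta> (Upper x') (Lower y')"
      using x unfolding upper_free_def by blast
    have "y = y'" using adj_unique[OF A c'[OF y(1)]] c'[OF y(2)] x(3) by auto
    then show "x = x'" using adj_unique'[OF B y(1)] y(2) by auto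
  qed
  moreover have card: "card ?P = card ?Q" using rank_free[OF A] rank_free[OF B] lf by simp
  ultimately have bc: "bij_betw c ?P ?Q"
    using cQ finite_free(1)[OF A] by (intro bij_betw_imageI card_subset_eq) (auto simp: card_image)
  \<comment> \<open>The transversals at \<open>x\<close> in \<beta> and at \<open>c x\<close> in
    \<alpha> share a lower end. Multiplication by \<zeta> joins it to the lower end at
    \<open>mate x\<close> in \<beta>, and to the one at \<open>mate (c x)\<close> in \<alpha>; the
    products agree, so these two lower ends coincide.\<close>
  have cm: "c (mate x) = mate (c x)" if x: "x \<in> ?P" for x
  proof -
    have mx: "mate x \<in> ?P" by (rule upper_free_mate[OF b x])
    have x1: "x \<in> {1..n}" "c x \<in> {1..n}" using x cQ[OF x] free_subset(1)[OF A] free_subset(1)[OF B] by blast+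
    obtain y where y: "adj \<beta> (Upper x) (Lower y)" using x unfolding upper_free_def by blast
    obtain y' where y': "adj \<beta> (Upper (mate x)) (Lower y')" using mx unfolding upper_free_def by blast
    have "mate (c x) \<in> ?Q" by (rule upper_free_mate[OF a cQ[OF x]])
    then obtain w where w: "adj \<alpha> (Upper (mate (c x))) (Lower w)" unfolding upper_free_def by blast
    have "adj (zeta n \<odot> \<beta>) (Lower y) (Lower y')"
      by (rule mult_Lower_Lower_via[OF Z B y _ y']) (use x1 adj_zeta(2) in simp)
    moreover have "adj (zeta n \<odot> \<alpha>) (Lower y) (Lower w)"
      by (rule mult_Lower_Lower_via[OF Z A c'[OF y] _ w]) (use x1 adj_zeta(2) in simp)
    ultimately have "y' = w" using adj_unique[OF mult_closed[OF Z B]] z by fastforce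
    then show ?thesis using adj_unique'[OF A c'[OF y'], of "Upper (mate (c x))"] w by simp
  qed
  \<comment> \<open>The points lying in upper blocks: on each side a union of mate pairs, by
    membership in K.\<close>
  let ?N = "{1..n} - ?P" and ?M = "{1..n} - ?Q"
  have mN: "mate x \<in> ?N" if "x \<in> ?N" for x
    using mate_in[of x] upper_free_mate[OF b, of "mate x"] that by auto
  have mM: "mate x \<in> ?M" if "x \<in> ?M" for x
    using mate_in[of x] upper_free_mate[OF a, of "mate x"] that by auto
  have "card ?N = card ?M"
    using card card_Diff_subset[OF finite_free(1)[OF A] free_subset(1)[OF A]]
      card_Diff_subset[OF finite_free(1)[OF B] free_subset(1)[OF B]] by simp
  then obtain g where g: "bij_betw g ?N ?M" and gm: "\<And>x. x \<in> ?N \<Longrightarrow> g (mate x) = mate (g x)"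
    using mate_closed_bij[OF _ _ mN _ _ mM] by auto
  define \<pi> where "\<pi> x = (if x \<in> ?P then c x else if x \<in> {1..n} then g x else x)" for x
  have "bij_betw \<pi> ?P ?Q" using bc by (rule bij_betw_cong[THEN iffD1, rotated]) (simp add: \<pi>_def)
  moreover have "bij_betw \<pi> ?N ?M" using g by (rule bij_betw_cong[THEN iffD1, rotated]) (simp add: \<pi>_def)
  ultimately have "bij_betw \<pi> (?P \<union> ?N) (?Q \<union> ?M)" by (rule bij_betw_combine) blast
  moreover have "?P \<union> ?N = {1..n}" "?Q \<union> ?M = {1..n}" using free_subset(1)[OF A] free_subset(1)[OF B] by blast+
  ultimately have \<pi>: "\<pi> permutes {1..n}"
    by (intro bij_imp_permutes) (use free_subset(1)[OF B] in \<open>auto simp: \<pi>_def\<close>)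
  have comm: "\<pi> (mate x) = mate (\<pi> x)" if "x \<in> {1..n}" for x
  proof (cases "x \<in> ?P")
    case True
    then show ?thesis using cm[OF True] upper_free_mate[OF b True] unfolding \<pi>_def by simp
  next
    case False
    then have "x \<in> ?N" using that by blast
    then show ?thesis using gm[of x] mN[of x] unfolding \<pi>_def by simp
  qed
  let ?u = "perm_diagram n \<pi>"
  note u = perm_diagram_closed[OF \<pi>]
  have "\<beta> = ?u \<odot> \<alpha>"
  proof (rule brauer_eqI_cases[OF B mult_closed[OF u A]])
    fix x y
    show "adj (?u \<odot> \<alpha>) (Lower x) (Lower y)" if "adj \<beta> (Lower x) (Lower y)"
      using mult_Lower_Lower[OF u A] that lower_pattern_eqD[OF low] by blast
    show "adj (?u \<odot> \<alpha>) (Upper x) (Lower y)" if xy: "adj \<beta> (Upper x) (Lower y)"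
    proof -
      have x: "x \<in> ?P" "x \<in> {1..n}" using xy adj_range(1)[OF B xy] unfolding upper_free_def by blast+
      then have "adj \<alpha> (Upper (\<pi> x)) (Lower y)" using c'[OF xy] unfolding \<pi>_def by simp
      then show ?thesis by (rule mult_Upper_Lower[OF u A adj_perm_Upper[OF \<pi> x(2)]])
    qed
    show "adj (?u \<odot> \<alpha>) (Upper x) (Upper y)" if xy: "adj \<beta> (Upper x) (Upper y)"
    proof -
      have x: "x \<in> {1..n}" "y = mate x" using adj_range(1)[OF B xy] xy b unfolding K_iff by blast+
      have "x \<notin> ?P" using xy unfolding upper_free_iff[OF B] by blast
      then have "\<pi> x \<in> ?M" using x(1) bij_betwE[OF g] unfolding \<pi>_def by auto
      then obtain w where w: "adj \<alpha> (Upper (\<pi> x)) (Upper w)" using upper_free_iff[OF A] by blast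
      then have "w = mate (\<pi> x)" using a unfolding K_iff by blast
      then have "w = \<pi> y" using comm[OF x(1)] x(2) by simp
      moreover have "y \<in> {1..n}" using adj_range(2)[OF B xy] .
      ultimately have "adj ?u (Upper y) (Lower w)" using adj_perm_Upper[OF \<pi>] by simp
      then show ?thesis by (rule mult_Upper_Upper_via[OF u A adj_perm_Upper[OF \<pi> x(1)] w])
    qed
  qed
  then show thesis using that perm_diagram_U[OF \<pi> comm] by blast
qed

text \<open>A rank four element of \<open>K\<close> is determined up to \<open>U\<close> by its lower blocks and by the point which
  \<open>\<zeta>\<close> pairs with the least of the four lower ends of its transversals: three choices.\<close>

lemma card_K4:
  "card (tau_class n ` {\<alpha> \<in> K_set n. rank \<alpha> = 4}) \<le> 3 * num_projections n 4"
proof -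
  let ?K = "{\<alpha> \<in> K_set n. rank \<alpha> = 4}"
  let ?L = "lower_pattern ` {\<alpha> \<in> D. rank \<alpha> = 4}"
  note Z = zeta_closed
  define p where "p \<alpha> = (THE y. adj (zeta n \<odot> \<alpha>) (Lower (Min (lower_free \<alpha>))) (Lower y))" for \<alpha>
  define key where "key \<alpha> = (lower_pattern \<alpha>, p \<alpha>)" for \<alpha>
  \<comment> \<open>The possible values of \<open>p\<close>, expressed through the pattern alone;
    the keys thus lie in a dependent sum with three choices over each pattern.\<close>
  define F where "F L = unmatched n L - {Min (unmatched n L)}" for L
  have zpair: "\<exists>y\<in>lower_free \<alpha>. adj (zeta n \<odot> \<alpha>) (Lower x) (Lower y)"
    if \<alpha>: "\<alpha> \<in> K_set n" and x: "x \<in> lower_free \<alpha>" for \<alpha> x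
  proof -
    have A: "\<alpha> \<in> D" using \<alpha> unfolding K_iff by blast
    obtain a where a: "adj \<alpha> (Upper a) (Lower x)" using x unfolding lower_free_def by blast
    then have "mate a \<in> upper_free \<alpha>" using upper_free_mate[OF \<alpha>] unfolding upper_free_def by blast
    then obtain y where y: "adj \<alpha> (Upper (mate a)) (Lower y)" unfolding upper_free_def by blast
    have "adj (zeta n \<odot> \<alpha>) (Lower x) (Lower y)"
      by (rule mult_Lower_Lower_via[OF Z A a _ y]) (use adj_range(1)[OF A a] adj_zeta(2) in simp)
    then show ?thesis using y unfolding lower_free_def by blast
  qed
  have pm: "adj (zeta n \<odot> \<alpha>) (Lower (Min (lower_free \<alpha>))) (Lower (p \<alpha>))" "p \<alpha> \<in> lower_free \<alpha>"
    "p \<alpha> \<noteq> Min (lower_free \<alpha>)" "Min (lower_free \<alpha>) \<in> lower_free \<alpha>" if \<alpha>: "\<alpha> \<in> ?K" for \<alpha>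
  proof -
    have A: "\<alpha> \<in> D" using \<alpha> unfolding K_iff by blast
    have "lower_free \<alpha> \<noteq> {}" using \<alpha> rank_free(2)[OF A] by auto
    then show m: "Min (lower_free \<alpha>) \<in> lower_free \<alpha>" by (rule Min_in[OF finite_free(2)[OF A]])
    obtain y where y: "y \<in> lower_free \<alpha>" "adj (zeta n \<odot> \<alpha>) (Lower (Min (lower_free \<alpha>))) (Lower y)"
      using zpair[OF _ m] \<alpha> by blast
    have "p \<alpha> = y" unfolding p_def using adj_unique[OF mult_closed[OF Z A] y(2)] y(2) by blast
    then show "adj (zeta n \<odot> \<alpha>) (Lower (Min (lower_free \<alpha>))) (Lower (p \<alpha>))" "p \<alpha> \<in> lower_free \<alpha>"
      "p \<alpha> \<noteq> Min (lower_free \<alpha>)" using y adjD(1)[OF mult_closed[OF Z A] y(2)] by auto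
  qed
  have cls: "tau_class n \<alpha> = tau_class n \<beta>" if a: "\<alpha> \<in> ?K" and b: "\<beta> \<in> ?K" and eq: "key \<alpha> = key \<beta>" for \<alpha> \<beta>
  proof -
    have A: "\<alpha> \<in> D" and B: "\<beta> \<in> D" using a b unfolding K_iff by blast+
    note ZA = mult_closed[OF Z A] and ZB = mult_closed[OF Z B]
    have low: "lower_pattern \<alpha> = lower_pattern \<beta>" and pp: "p \<alpha> = p \<beta>" using eq unfolding key_def by simp_all
    have lf: "lower_free \<alpha> = lower_free \<beta>" using lower_free_eq[OF A] lower_free_eq[OF B] low by simp
    define F0 where "F0 = lower_free \<alpha>"
    define m where "m = Min F0"
    define q where "q = p \<alpha>"
    have F0: "finite F0" "card F0 = 4" "m \<in> F0" "q \<in> F0" "q \<noteq> m"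
      using finite_free(2)[OF A] rank_free(2)[OF A] a pm[OF a] unfolding F0_def m_def q_def by auto
    have mA: "adj (zeta n \<odot> \<alpha>) (Lower m) (Lower q)" using pm(1)[OF a] unfolding F0_def m_def q_def .
    have mB: "adj (zeta n \<odot> \<beta>) (Lower m) (Lower q)" using pm(1)[OF b] lf pp unfolding F0_def m_def q_def by simp
    have rest: "card (F0 - {m, q}) = 2" using F0 card_Diff_subset[of "{m, q}" F0] by simp
    \<comment> \<open>Left multiplication by \<zeta> pairs the four free lower points among
      themselves. With \<open>m\<close> paired to \<open>q\<close>, the remaining two are left to
      each other, so a single partner determines the whole pairing.\<close>
    have other: "y \<in> F0 - {m, q}" if d: "x \<in> F0 - {m, q}" "\<delta> \<in> K_set n" "lower_free \<delta> = F0"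
      "adj (zeta n \<odot> \<delta>) (Lower m) (Lower q)" "adj (zeta n \<odot> \<delta>) (Lower x) (Lower y)" for x y \<delta>
    proof -
      have "\<delta> \<in> D" using d(2) unfolding K_iff by blast
      note ZD = mult_closed[OF Z this]
      obtain y' where "y' \<in> F0" "adj (zeta n \<odot> \<delta>) (Lower x) (Lower y')" using zpair[OF d(2), of x] d(1,3) by blast
      then have "y \<in> F0" using adj_unique[OF ZD d(5)] by blast
      moreover have "y \<noteq> m" using adj_unique[OF ZD adj_sym[OF d(5)], of "Lower q"] d(1,4) by auto
      moreover have "y \<noteq> q" using adj_unique[OF ZD adj_sym[OF d(5)], of "Lower m"] d(1) adj_sym[OF d(4)] by auto
      ultimately show ?thesis by blast
    qed
    have "lower_pattern (zeta n \<odot> \<alpha>) = lower_pattern (zeta n \<odot> \<beta>)"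
    proof -
      \<comment> \<open>Stated for a variable pair of elements so that it yields both inclusions
        between the patterns.\<close>
      have "adj (zeta n \<odot> \<delta>') (Lower x) (Lower y)"
        if xy: "adj (zeta n \<odot> \<delta>) (Lower x) (Lower y)" and \<delta>: "\<delta> \<in> K_set n" "lower_free \<delta> = F0"
          "adj (zeta n \<odot> \<delta>) (Lower m) (Lower q)" and \<delta>': "\<delta>' \<in> K_set n" "lower_free \<delta>' = F0"
          "adj (zeta n \<odot> \<delta>') (Lower m) (Lower q)" and same: "lower_pattern \<delta> = lower_pattern \<delta>'" for \<delta> \<delta>' x y
      proof -
        have E: "\<delta> \<in> D" and E': "\<delta>' \<in> D" using \<delta>(1) \<delta>'(1) unfolding K_iff by blast+
        note ZD = mult_closed[OF Z E] and ZD' = mult_closed[OF Z E']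
        consider "x \<notin> F0" | "x = m" | "x = q" | "x \<in> F0 - {m, q}" by blast
        then show ?thesis
        proof cases
          case 1
          then obtain w where w: "adj \<delta> (Lower x) (Lower w)"
            using adj_range(3)[OF ZD xy] lower_free_iff[OF E] \<delta>(2) by blast
          then have "w = y" using adj_unique[OF ZD mult_Lower_Lower[OF Z E w] xy] by simp
          then show ?thesis using mult_Lower_Lower[OF Z E'] w lower_pattern_eqD[OF same] by blast
        next
          case 2
          then show ?thesis using adj_unique[OF ZD xy] \<delta>(3) \<delta>'(3) by blast
        next
          case 3
          then have "Lower y = Lower m" using adj_unique[OF ZD xy] adj_sym[OF \<delta>(3)] by blast
          then show ?thesis using 3 adj_sym[OF \<delta>'(3)] by simp
        next
          case 4
          obtain y' where y': "adj (zeta n \<odot> \<delta>') (Lower x) (Lower y')" using zpair[OF \<delta>'(1), of x] 4 \<delta>'(2) by blast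
          have "y \<in> F0 - {m, q}" "y' \<in> F0 - {m, q}" using other[OF 4 \<delta> xy] other[OF 4 \<delta>' y'] by blast+
          moreover have "y \<noteq> x" "y' \<noteq> x" using adjD(1)[OF ZD xy] adjD(1)[OF ZD' y'] by auto
          moreover obtain s t where "F0 - {m, q} = {s, t}" using rest by (meson card_2_iff)
          ultimately have "y' = y" using 4 by auto
          then show ?thesis using y' by simp
        qed
      qed
      then have "adj (zeta n \<odot> \<alpha>) (Lower x) (Lower y) \<longleftrightarrow> adj (zeta n \<odot> \<beta>) (Lower x) (Lower y)" for x y
        using a b lf mA mB low unfolding F0_def by (metis (no_types, lifting) mem_Collect_eq)
      then show ?thesis unfolding lower_pattern_def by simp
    qed
    then have "zeta n \<odot> \<alpha> = zeta n \<odot> \<beta>"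
      using inj_onD[OF R_zeta_pattern_inj] zeta_mult_R_zeta A B by blast
    then obtain u where "u \<in> U_grp n" "\<beta> = u \<odot> \<alpha>" using K_same_orbit[OF _ _ low] a b by blast
    then show ?thesis using tau_U[OF _ A] tau_class_eq_iff[OF A B] by blast
  qed
  have sub: "key ` ?K \<subseteq> Sigma ?L F"
  proof
    fix k assume "k \<in> key ` ?K"
    then obtain \<alpha> where \<alpha>: "\<alpha> \<in> ?K" "k = key \<alpha>" by blast
    then have A: "\<alpha> \<in> D" unfolding K_iff by blast
    have "p \<alpha> \<in> F (lower_pattern \<alpha>)" using pm[OF \<alpha>(1)] unfolding F_def lower_free_eq[OF A] by simp
    then show "k \<in> Sigma ?L F" using \<alpha> A unfolding key_def by blast
  qed
  have card3: "finite (F L) \<and> card (F L) = 3" if "L \<in> ?L" for L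
  proof -
    obtain \<alpha> where A: "\<alpha> \<in> D" and \<alpha>: "rank \<alpha> = 4" "L = lower_pattern \<alpha>" using \<open>L \<in> ?L\<close> by blast
    have F: "F L = lower_free \<alpha> - {Min (lower_free \<alpha>)}" unfolding F_def \<alpha>(2) lower_free_eq[OF A] ..
    have "card (lower_free \<alpha>) = 4" using rank_free(2)[OF A] \<alpha>(1) by simp
    moreover from this have "Min (lower_free \<alpha>) \<in> lower_free \<alpha>" by (intro Min_in finite_free(2)[OF A]) auto
    ultimately show ?thesis unfolding F using finite_free(2)[OF A] by simp
  qed
  have fin: "finite (Sigma ?L F)" using card3 by (intro finite_SigmaI finite_lower_patterns) blast
  have "card (tau_class n ` ?K) \<le> card (key ` ?K)"
    by (rule card_image_le_image[OF finite_subset[OF sub fin] cls])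
  also have "\<dots> \<le> card (Sigma ?L F)" by (rule card_mono[OF fin sub])
  also have "\<dots> = (\<Sum>L\<in>?L. card (F L))"
    using card3 by (intro card_SigmaI finite_lower_patterns) blast
  also have "\<dots> = 3 * card ?L" using card3 by simp
  finally show ?thesis using card_lower_patterns[of n 4] by linarith
qed

lemma card_Omega:
  "card (Omega n) \<le> 1 + 3 * num_projections n 4 + 2 * num_projections n 2 + num_projections n 0"
  "finite (Omega n)" "Omega n \<noteq> {}"
proof -
  let ?K = "{\<alpha> \<in> K_set n. rank \<alpha> = 4}"
  let ?A = "(\<lambda>\<alpha>. point_class (Inl \<alpha>)) ` R_gamma n" and ?B = "(\<lambda>\<alpha>. point_class (Inl \<alpha>)) ` R_zeta n"
    and ?C = "(\<lambda>C. point_class (Inr C)) ` tau_class n ` ?K" and ?E = "{point_class (Inr (I_set n))}"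
  have finD: "finite X" if "X \<subseteq> D" for X using finite_subset[OF that] by simp
  have fin: "finite (R_gamma n)" "finite (R_zeta n)" "finite ?K"
    by (rule finD; auto simp: R_gamma_iff R_zeta_iff K_iff)+
  have sub: "Omega n \<subseteq> ?E \<union> ?C \<union> ?A \<union> ?B"
  proof
    fix P assume "P \<in> Omega n"
    then obtain u where u: "u \<in> points" "P = point_class u" unfolding Omega_eq by blast
    from u(1) show "P \<in> ?E \<union> ?C \<union> ?A \<union> ?B"
    proof (cases rule: pointsE)
      case (1 \<alpha>)
      then show ?thesis unfolding u(2) Omega1_def by blast
    next
      case (2 \<alpha>)
      consider "\<alpha> \<in> I_set n" | "\<alpha> \<in> J_set n" | "\<alpha> \<in> K_set n" "2 < rank \<alpha>"
        using 2(2) unfolding I_set_def J_iff by fastforce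
      then show ?thesis
      proof cases
        case 1
        then have "tau_class n \<alpha> = I_set n"
          unfolding tau_class_def tau_def I_set_def J_set_def by auto
        then show ?thesis unfolding u(2) 2(3) by simp
      next
        case J: 2
        \<comment> \<open>The surjectivity of \<xi>: this element of \<open>R_zeta\<close> lies in
          the class of \<alpha>, so the class is glued to a point of \<open>Omega1\<close> and is
          already counted there.\<close>
        let ?z = "zeta n \<odot> \<alpha>"
        have z: "?z \<in> R_zeta n" by (rule zeta_mult_R_zeta[OF 2(2)])
        have zJ: "?z \<in> J_set n" by (rule R_zeta_J(1)[OF z])
        have "hat ?z = hat \<alpha>" using hat_eq[OF zJ] hat_eq[OF J] R_zeta_zeta_mult[OF z] by simp
        then have "(?z, \<alpha>) \<in> tau n" using zJ J unfolding tau_def by simp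
        moreover have "?z \<in> D" using z unfolding R_zeta_iff by blast
        ultimately have "tau_class n ?z = tau_class n \<alpha>" using tau_class_eq_iff 2(2) by blast
        then have "glue (Inl ?z) = glue u" unfolding glue_def 2(3) using z by simp
        moreover have "Inl ?z \<in> points" unfolding points_def Omega1_def using z by blast
        ultimately have "P = point_class (Inl ?z)" unfolding u(2) using point_class_eq_iff u(1) by blast
        then show ?thesis using z by blast
      next
        case K: 3
        have "even (rank \<alpha>)" by (rule rank_K_even[OF K(1)])
        moreover have "rank \<alpha> \<le> 4" using 2(1) unfolding rank_ideal_def by simp
        ultimately have "rank \<alpha> = 4" using K(2) by presburger
        then show ?thesis unfolding u(2) 2(3) using K(1) by blast
      qed
    qed
  qed
  show "finite (Omega n)" by (rule finite_subset[OF sub]) (use fin in auto)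
  have "Inl (zeta n) \<in> points" unfolding points_def
    using zeta_closed adj_zeta(1) Omega1_iff by auto
  then show "Omega n \<noteq> {}" unfolding Omega_eq by blast
  have "card (Omega n) \<le> card (?E \<union> ?C \<union> ?A \<union> ?B)" by (rule card_mono[OF _ sub]) (use fin in auto)
  also have "\<dots> \<le> card ?E + card ?C + card ?A + card ?B"
    using card_Un_le[of "?E \<union> ?C \<union> ?A" ?B] card_Un_le[of "?E \<union> ?C" ?A] card_Un_le[of ?E ?C] by linarith
  also have "\<dots> \<le> 1 + 3 * num_projections n 4 + 2 * num_projections n 2 + num_projections n 0"
  proof -
    have "card ?C \<le> 3 * num_projections n 4"
      using card_image_le[of "tau_class n ` ?K" "\<lambda>C. point_class (Inr C)"] fin(3) card_K4 by fastforce
    moreover have "card ?A \<le> 2 * num_projections n 2"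
      using card_image_le[OF fin(1), of "\<lambda>\<alpha>. point_class (Inl \<alpha>)"] card_R_gamma by linarith
    moreover have "card ?B \<le> num_projections n 0"
      using card_image_le[OF fin(2), of "\<lambda>\<alpha>. point_class (Inl \<alpha>)"] card_R_zeta by linarith
    moreover have "card ?E = 1" by simp
    ultimately show ?thesis by linarith
  qed
  finally show "card (Omega n) \<le> 1 + 3 * num_projections n 4 + 2 * num_projections n 2 + num_projections n 0" .
qed

end

theorem theorem6p21:
  fixes n :: nat
  assumes "n \<ge> 4" and "even n"
  shows "faithful_right_action (brauer n) (Omega n) (mu n) \<and>
    transf_degree (brauer n)
      \<le> 1 + 3 * num_projections n 4 + 2 * num_projections n 2 + num_projections n 0"
proof -
  interpret even_degree n using assms by unfold_locales
  show ?thesis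
    using faithful_mu transf_degree_le[OF faithful_mu card_Omega(2,3)] card_Omega(1) by linarith
qed

end
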